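(* The following decision problem (the decision version of \textsf{Min-Max-Delay}) is NP-complete: given a directed graph $G=(V,E)$ in which every edge $e$ has a non-negative integer capacity $c_e$ and a non-negative integer delay $d_e$, a source $s\in V$, a sink $t\in V\setminus\{s\}$, a positive integer rate requirement $R$, and a number $D$, decide whether there exists a feasible flow $f$ with maximum delay $\mathcal{D}(f)\le D$.
   Context: Let $P$ be the set of all directed $s$-$t$ paths in $G$; for $p\in P$ its delay is $d^p=\sum_{e\in p} d_e$. A flow is an assignment $f=\{f^p\ge 0: p\in P\}$ of (possibly fractional) non-negative rates to paths; its edge rates are $f_e=\sum_{p\in P: e\in p} f^p$. The flow is feasible if $\sum_{p\in P} f^p=R$ and $f_e\le c_e$ for every $e\in E$. The maximum delay of $f$ is $\mathcal{D}(f)=\max_{p\in P: f^p>0} d^p$, the largest delay among paths carrying positive rate. The optimization problem \textsf{Min-Max-Delay} asks for a feasible flow minimizing $\mathcal{D}(f)$. *)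

theory Defs
  imports "HOL-Computational_Algebra.Polynomial" "Graph_Theory.Graph_Theory"
begin

section \<open>Deterministic multi-tape Turing machines\<close>

datatype dir = Lft | Stay | Rgt

fun shift :: "dir \<Rightarrow> int" where
  "shift Lft = -1"
| "shift Stay = 0"
| "shift Rgt = 1"

text \<open>
  A machine has control states \<open>0, \<dots>, tm_states - 1\<close>, of which \<open>0\<close> is initial, and one further
  halting state \<open>tm_states\<close>. Its tape alphabet is \<open>{0, \<dots>, tm_symbols - 1}\<close>, where \<open>0\<close> is the
  blank and \<open>1\<close>, \<open>2\<close> stand for the bits \<open>False\<close>, \<open>True\<close>. The transition function maps a state
  and the list of scanned symbols to the next state and, for each tape, the symbol to write and
  the head movement.
\<close>

record tm =
  tm_tapes :: nat
  tm_symbols :: nat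
  tm_states :: nat
  tm_delta :: "nat \<Rightarrow> nat list \<Rightarrow> nat \<times> (nat \<times> dir) list"

definition wf_tm :: "tm \<Rightarrow> bool" where
  "wf_tm M \<longleftrightarrow> 2 \<le> tm_tapes M \<and> 3 \<le> tm_symbols M \<and> 1 \<le> tm_states M \<and>
     (\<forall>q ys. q < tm_states M \<and> length ys = tm_tapes M \<and> set ys \<subseteq> {..<tm_symbols M} \<longrightarrow>
        fst (tm_delta M q ys) \<le> tm_states M \<and>
        length (snd (tm_delta M q ys)) = tm_tapes M \<and>
        fst ` set (snd (tm_delta M q ys)) \<subseteq> {..<tm_symbols M})"

text \<open>Tapes are infinite in both directions; a tape is its contents and its head position.\<close>

type_synonym tape = "(int \<Rightarrow> nat) \<times> int"
type_synonym config = "nat \<times> tape list"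

definition act :: "tape \<Rightarrow> nat \<times> dir \<Rightarrow> tape" where
  "act T a = ((fst T)(snd T := fst a), snd T + shift (snd a))"

definition step :: "tm \<Rightarrow> config \<Rightarrow> config" where
  "step M C =
     (let q = fst C; ts = snd C; r = tm_delta M q (map (\<lambda>T. fst T (snd T)) ts) in
      if q < tm_states M then (fst r, map2 act ts (snd r)) else C)"

definition contents :: "bool list \<Rightarrow> int \<Rightarrow> nat" where
  "contents x i = (if 0 \<le> i \<and> i < int (length x) then (if x ! nat i then 2 else 1) else 0)"

definition start :: "tm \<Rightarrow> bool list \<Rightarrow> config" where
  "start M x = (0, (contents x, 0) # replicate (tm_tapes M - 1) (contents [], 0))"

text \<open>
  The output is the string on tape \<open>1\<close> that starts at cell \<open>0\<close> and extends to the first blank.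
  As \<^const>\<open>step\<close> leaves halting configurations unchanged, being halted after \<open>n\<close> iterations means
  having halted within \<open>n\<close> steps.
\<close>

definition outputs_within :: "tm \<Rightarrow> bool list \<Rightarrow> bool list \<Rightarrow> nat \<Rightarrow> bool" where
  "outputs_within M x y n \<longleftrightarrow>
     (let C = (step M ^^ n) (start M x) in
      fst C = tm_states M \<and>
      (\<forall>i\<le>length y. fst (snd C ! 1) (int i) = contents y (int i)))"


section \<open>NP-completeness\<close>

type_synonym lang = "bool list set"

definition polytime :: "(bool list \<Rightarrow> bool list) \<Rightarrow> bool" where
  "polytime f \<longleftrightarrow>
     (\<exists>M (p :: nat poly). wf_tm M \<and> (\<forall>x. outputs_within M x (f x) (poly p (length x))))"

definition in_P :: "lang \<Rightarrow> bool" where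
  "in_P A \<longleftrightarrow> polytime (\<lambda>x. [x \<in> A])"

text \<open>Self-delimiting codes: \<open>True\<close> announces a further list element, \<open>False\<close> ends the list.\<close>

definition enc_list :: "('a \<Rightarrow> bool list) \<Rightarrow> 'a list \<Rightarrow> bool list" where
  "enc_list c xs = concat (map (\<lambda>x. True # c x) xs) @ [False]"

definition enc_bits :: "bool list \<Rightarrow> bool list" where
  "enc_bits = enc_list (\<lambda>b. [b])"

definition pair_string :: "bool list \<Rightarrow> bool list \<Rightarrow> bool list" where
  "pair_string x u = enc_bits x @ u"

definition in_NP :: "lang \<Rightarrow> bool" where
  "in_NP A \<longleftrightarrow>
     (\<exists>B (p :: nat poly). in_P B \<and>
        (\<forall>x. x \<in> A \<longleftrightarrow> (\<exists>u. length u \<le> poly p (length x) \<and> pair_string x u \<in> B)))"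

definition poly_reducible :: "lang \<Rightarrow> lang \<Rightarrow> bool" where
  "poly_reducible A B \<longleftrightarrow> (\<exists>f. polytime f \<and> (\<forall>x. x \<in> A \<longleftrightarrow> f x \<in> B))"

definition NP_hard :: "lang \<Rightarrow> bool" where
  "NP_hard B \<longleftrightarrow> (\<forall>A. in_NP A \<longrightarrow> poly_reducible A B)"

definition NP_complete :: "lang \<Rightarrow> bool" where
  "NP_complete B \<longleftrightarrow> in_NP B \<and> NP_hard B"


section \<open>Path flows and maximum delay\<close>

definition st_paths :: "('a, 'b) pre_digraph \<Rightarrow> 'a \<Rightarrow> 'a \<Rightarrow> 'b list set" where
  "st_paths G s t = {p. pre_digraph.apath G s p t}"

definition path_delay :: "('b \<Rightarrow> nat) \<Rightarrow> 'b list \<Rightarrow> nat" where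
  "path_delay d p = (\<Sum>e\<in>set p. d e)"

definition edge_rate ::
  "('a, 'b) pre_digraph \<Rightarrow> 'a \<Rightarrow> 'a \<Rightarrow> ('b list \<Rightarrow> real) \<Rightarrow> 'b \<Rightarrow> real" where
  "edge_rate G s t f e = (\<Sum>p\<in>{p \<in> st_paths G s t. e \<in> set p}. f p)"

definition feasible_flow ::
  "('a, 'b) pre_digraph \<Rightarrow> ('b \<Rightarrow> nat) \<Rightarrow> 'a \<Rightarrow> 'a \<Rightarrow> nat \<Rightarrow> ('b list \<Rightarrow> real) \<Rightarrow> bool" where
  "feasible_flow G c s t R f \<longleftrightarrow>
     (\<forall>p\<in>st_paths G s t. 0 \<le> f p) \<and>
     (\<Sum>p\<in>st_paths G s t. f p) = real R \<and>
     (\<forall>e\<in>arcs G. edge_rate G s t f e \<le> real (c e))"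

text \<open>The maximum ranges over a nonempty set whenever \<open>f\<close> is feasible for a positive rate.\<close>

definition max_delay ::
  "('a, 'b) pre_digraph \<Rightarrow> ('b \<Rightarrow> nat) \<Rightarrow> 'a \<Rightarrow> 'a \<Rightarrow> ('b list \<Rightarrow> real) \<Rightarrow> nat" where
  "max_delay G d s t f = Max (path_delay d ` {p \<in> st_paths G s t. 0 < f p})"


section \<open>The decision problem as a language\<close>

text \<open>An entry \<open>((u, v), c, d)\<close> of \<open>edges\<close> is the edge from \<open>u\<close> to \<open>v\<close> with capacity \<open>c\<close> and delay \<open>d\<close>.\<close>

record mmd_instance =
  vertices :: "nat list"
  edges :: "((nat \<times> nat) \<times> nat \<times> nat) list"
  source :: nat
  sink :: nat
  rate :: nat
  delay_bound :: nat

definition inst_graph :: "mmd_instance \<Rightarrow> (nat, nat \<times> nat) pre_digraph" where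
  "inst_graph I =
     \<lparr>verts = set (vertices I), arcs = fst ` set (edges I), tail = fst, head = snd\<rparr>"

definition inst_capacity :: "mmd_instance \<Rightarrow> nat \<times> nat \<Rightarrow> nat" where
  "inst_capacity I e = fst (the (map_of (edges I) e))"

definition inst_delay :: "mmd_instance \<Rightarrow> nat \<times> nat \<Rightarrow> nat" where
  "inst_delay I e = snd (the (map_of (edges I) e))"

definition wf_instance :: "mmd_instance \<Rightarrow> bool" where
  "wf_instance I \<longleftrightarrow>
     wf_digraph (inst_graph I) \<and> distinct (vertices I) \<and> distinct (map fst (edges I)) \<and>
     source I \<in> set (vertices I) \<and> sink I \<in> set (vertices I) - {source I} \<and> 0 < rate I"

definition mmd_yes :: "mmd_instance \<Rightarrow> bool" where
  "mmd_yes I \<longleftrightarrow>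
     (\<exists>f. feasible_flow (inst_graph I) (inst_capacity I) (source I) (sink I) (rate I) f \<and>
          max_delay (inst_graph I) (inst_delay I) (source I) (sink I) f \<le> delay_bound I)"

text \<open>All numbers are written in binary, least significant bit first.\<close>

fun nat_bits :: "nat \<Rightarrow> bool list" where
  "nat_bits n = (if n = 0 then [] else odd n # nat_bits (n div 2))"

declare nat_bits.simps [simp del]

definition enc_nat :: "nat \<Rightarrow> bool list" where
  "enc_nat n = enc_bits (nat_bits n)"

fun enc_edge :: "(nat \<times> nat) \<times> nat \<times> nat \<Rightarrow> bool list" where
  "enc_edge ((u, v), c, d) = enc_nat u @ enc_nat v @ enc_nat c @ enc_nat d"

definition encode :: "mmd_instance \<Rightarrow> bool list" where
  "encode I =
     enc_list enc_nat (vertices I) @ enc_list enc_edge (edges I) @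
     enc_nat (source I) @ enc_nat (sink I) @ enc_nat (rate I) @ enc_nat (delay_bound I)"

definition Min_Max_Delay :: lang where
  "Min_Max_Delay = {encode I | I. wf_instance I \<and> mmd_yes I}"


section \<open>Unambiguity of the encoding\<close>

lemma enc_list_append_eq:
  assumes "\<And>x y r s. c x @ r = c y @ s \<longleftrightarrow> x = y \<and> r = s"
  shows "enc_list c xs @ r = enc_list c ys @ s \<longleftrightarrow> xs = ys \<and> r = s"
proof (induction xs arbitrary: ys)
  case Nil
  then show ?case by (cases ys) (auto simp: enc_list_def)
next
  case (Cons x xs)
  then show ?case using assms by (cases ys) (auto simp: enc_list_def)
qed

lemma enc_bits_append_eq: "enc_bits x @ r = enc_bits y @ s \<longleftrightarrow> x = y \<and> r = s"
  unfolding enc_bits_def by (rule enc_list_append_eq) auto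

lemma nat_bits_inject: "nat_bits m = nat_bits n \<longleftrightarrow> m = n"
proof (induction m arbitrary: n rule: less_induct)
  case (less m)
  show ?case
  proof (cases "m = 0 \<or> n = 0")
    case True
    then show ?thesis by (auto simp: nat_bits.simps[of m] nat_bits.simps[of n])
  next
    case False
    then have "nat_bits m = nat_bits n \<longleftrightarrow> odd m = odd n \<and> m div 2 = n div 2"
      using less.IH[of "m div 2" "n div 2"]
      by (simp add: nat_bits.simps[of m] nat_bits.simps[of n])
    also have "\<dots> \<longleftrightarrow> m = n"
      by presburger
    finally show ?thesis .
  qed
qed

lemma enc_nat_append_eq: "enc_nat m @ r = enc_nat n @ s \<longleftrightarrow> m = n \<and> r = s"
  by (simp add: enc_nat_def enc_bits_append_eq nat_bits_inject)

lemma enc_edge_append_eq: "enc_edge e @ r = enc_edge e' @ s \<longleftrightarrow> e = e' \<and> r = s"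
  by (cases e rule: enc_edge.cases, cases e' rule: enc_edge.cases)
     (auto simp: enc_nat_append_eq)

lemma encode_inject: "encode I = encode J \<longleftrightarrow> I = J"
  using enc_nat_append_eq[of "delay_bound I" "[]" "delay_bound J" "[]"]
  by (cases I; cases J)
     (auto simp: encode_def enc_nat_append_eq enc_edge_append_eq
        enc_list_append_eq[of enc_nat] enc_list_append_eq[of enc_edge])

end

theory Submission
  imports Defs "Jordan_Normal_Form.Determinant"
begin

text \<open>
  Membership: fix a feasible flow meeting the delay bound. The rates of its paths, together with the residual
  capacities, solve a linear system with one row for the rate requirement and one row per edge, and entries
  \<open>0\<close> and \<open>1\<close>. A solution with minimal support has independent columns, so it involves at most
  \<open>|E| + 1\<close> paths, and Cramer's rule for the Gram matrix of these columns shows that its values are fractions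
  with a common denominator of polynomial bit length. Listing these paths with their rates is a certificate.

  Hardness: the computation of a verifier on an input \<open>x\<close> with an unknown certificate is expressed by a
  selection of items (one transition per time step, one unchanged cell, one certificate bit, ...) whose
  contributions must add up to prescribed values at certain positions. Reading contributions as digits in a large
  base turns this into a subset sum problem. A subset sum instance becomes a chain of stages in which a path
  either takes a direct edge or a detour; with unit capacities, rate \<open>2\<close> and delay bound equal to half of the
  total delay, every path carrying flow must have exactly that delay, so a feasible flow splits the total delay
  evenly.

  Polynomial-time functions are obtained from a small stack language that is compiled to Turing machines.
\<close>

section \<open>A stack language compiled to Turing machines\<close>

text \<open>The stages of the chain are cuts of capacity 2, so rate 2 saturates both alternatives of
  each stage. The mean delay of every feasible flow is therefore the delay bound, and a maximum
  equal to the mean leaves no variation. In the tableau a linear equation can express that a value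
  read equals a value produced only because readers contribute complements; a run is thus described
  by subset sum directly, without passing through satisfiability. For membership the obstacle is
  that rates are real and paths may be exponentially many. A solution with minimal support bounds
  the number of paths and the length of the numbers at once, and the normal equations spare the
  choice of a nonsingular square subsystem. The definitions ask for actual Turing machines. Hence
  running times are handled by a notion of polynomial time relative to a domain of inputs, closed
  under the usual operations on lists and numbers; the reduction and the verifier are assembled from
  closure rules instead of being programmed. The domain supplies the facts about intermediate values
  on which partial operations and size bounds depend.\<close>

datatype com =
    Skip
  | Push nat nat
  | PushTop nat nat
  | Pop nat
  | Seq com com (infixr ";;" 60)
  | Cond nat "nat \<Rightarrow> bool" com com
  | Loop nat "nat \<Rightarrow> bool" com

type_synonym stacks = "nat \<Rightarrow> nat list"

text \<open>An empty stack shows \<open>0\<close>, the blank, so that \<open>peek\<close> is what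
  the head scans on every tape except the output tape.\<close>

definition peek :: "nat list \<Rightarrow> nat" where
  "peek xs = (case xs of [] \<Rightarrow> 0 | x # _ \<Rightarrow> x)"

lemma peek_simps [simp]: "peek [] = 0" "peek (x # xs) = x"
  by (simp_all add: peek_def)

text \<open>The counts are the exact step numbers of the compiled machine: a push moves and then
  writes, a taken first branch ends with a jump over the second one, and a round of a loop pays for
  its test and for the jump back.\<close>

inductive exec :: "com \<Rightarrow> stacks \<Rightarrow> nat \<Rightarrow> stacks \<Rightarrow> bool" where
  Skip: "exec Skip s 0 s"
| Push: "exec (Push i a) s 2 (s(i := a # s i))"
| PushTop: "exec (PushTop i j) s 2 (s(i := peek (s j) # s i))"
| Pop: "exec (Pop i) s 1 (s(i := tl (s i)))"
| Seq: "exec c1 s m s' \<Longrightarrow> exec c2 s' n s'' \<Longrightarrow> exec (c1 ;; c2) s (m + n) s''"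
| CondT: "P (peek (s i)) \<Longrightarrow> exec c1 s n s' \<Longrightarrow> exec (Cond i P c1 c2) s (n + 2) s'"
| CondF: "\<not> P (peek (s i)) \<Longrightarrow> exec c2 s n s' \<Longrightarrow> exec (Cond i P c1 c2) s (n + 1) s'"
| LoopT: "P (peek (s i)) \<Longrightarrow> exec c s m s' \<Longrightarrow> exec (Loop i P c) s' n s'' \<Longrightarrow>
    exec (Loop i P c) s (m + n + 2) s''"
| LoopF: "\<not> P (peek (s i)) \<Longrightarrow> exec (Loop i P c) s 1 s"

fun csize :: "com \<Rightarrow> nat" where
  "csize Skip = 0"
| "csize (Push i a) = 2"
| "csize (PushTop i j) = 2"
| "csize (Pop i) = 1"
| "csize (c1 ;; c2) = csize c1 + csize c2"
| "csize (Cond i P c1 c2) = csize c1 + csize c2 + 2"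
| "csize (Loop i P c) = csize c + 2"

text \<open>Tape \<open>1\<close> is the write-only output tape. The stack symbols are \<open>1\<close>, \<open>2\<close>, \<open>3\<close>.\<close>

fun wf_com :: "com \<Rightarrow> bool" where
  "wf_com Skip \<longleftrightarrow> True"
| "wf_com (Push i a) \<longleftrightarrow> i < 5 \<and> a < 4"
| "wf_com (PushTop i j) \<longleftrightarrow> i < 5 \<and> j < 5 \<and> i \<noteq> j \<and> j \<noteq> 1"
| "wf_com (Pop i) \<longleftrightarrow> i < 5 \<and> i \<noteq> 1"
| "wf_com (c1 ;; c2) \<longleftrightarrow> wf_com c1 \<and> wf_com c2"
| "wf_com (Cond i P c1 c2) \<longleftrightarrow> i < 5 \<and> i \<noteq> 1 \<and> wf_com c1 \<and> wf_com c2"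
| "wf_com (Loop i P c) \<longleftrightarrow> i < 5 \<and> i \<noteq> 1 \<and> wf_com c"

definition noop :: "nat list \<Rightarrow> (nat \<times> dir) list" where
  "noop ys = map (\<lambda>y. (y, Stay)) ys"

lemma length_noop [simp]: "length (noop ys) = length ys"
  by (simp add: noop_def)

text \<open>\<open>trans_of c q\<close> is the transition function of \<open>c\<close> on the states
  \<open>q, \<dots>, q + csize c - 1\<close>; control leaves \<open>c\<close> in state \<open>q + csize c\<close>.\<close>

fun trans_of :: "com \<Rightarrow> nat \<Rightarrow> nat \<Rightarrow> nat list \<Rightarrow> nat \<times> (nat \<times> dir) list" where
  "trans_of Skip q pc ys = (0, noop ys)"
| "trans_of (Push i a) q pc ys = (Suc pc,
     if pc = q then (noop ys)[i := (ys ! i, if i = 1 then Stay else Lft)]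
     else (noop ys)[i := (a, if i = 1 then Rgt else Stay)])"
| "trans_of (PushTop i j) q pc ys = (Suc pc,
     if pc = q then (noop ys)[i := (ys ! i, if i = 1 then Stay else Lft)]
     else (noop ys)[i := (ys ! j, if i = 1 then Rgt else Stay)])"
| "trans_of (Pop i) q pc ys = (Suc pc, (noop ys)[i := (ys ! i, Rgt)])"
| "trans_of (c1 ;; c2) q pc ys =
     (if pc < q + csize c1 then trans_of c1 q pc ys else trans_of c2 (q + csize c1) pc ys)"
| "trans_of (Cond i P c1 c2) q pc ys =
     (if pc = q then (if P (ys ! i) then q + 1 else q + 2 + csize c1, noop ys)
      else if pc < q + 1 + csize c1 then trans_of c1 (q + 1) pc ys
      else if pc = q + 1 + csize c1 then (q + 2 + csize c1 + csize c2, noop ys)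
      else trans_of c2 (q + 2 + csize c1) pc ys)"
| "trans_of (Loop i P c) q pc ys =
     (if pc = q then (if P (ys ! i) then q + 1 else q + 2 + csize c, noop ys)
      else if pc < q + 1 + csize c then trans_of c (q + 1) pc ys
      else (q, noop ys))"

definition compile :: "com \<Rightarrow> tm" where
  "compile c = \<lparr>tm_tapes = 5, tm_symbols = 4, tm_states = csize c, tm_delta = trans_of c 0\<rparr>"

section \<open>Compiled machines simulate commands step by step\<close>

lemma trans_of_wf:
  assumes "wf_com c" "q \<le> pc" "pc < q + csize c" "length ys = 5" "set ys \<subseteq> {..<4}"
  shows "fst (trans_of c q pc ys) \<le> q + csize c \<and> length (snd (trans_of c q pc ys)) = 5 \<and>
    fst ` set (snd (trans_of c q pc ys)) \<subseteq> {..<4}"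
proof -
  have noop: "fst ` set (noop ys) \<subseteq> {..<4}" using assms(5) by (auto simp: noop_def)
  have upd: "fst ` set ((noop ys)[i := (a, d)]) \<subseteq> {..<4}" if "a < 4" for i a d
  proof -
    have "set ((noop ys)[i := (a, d)]) \<subseteq> insert (a, d) (set (noop ys))"
      by (rule set_update_subset_insert)
    then show ?thesis using noop that by fastforce
  qed
  have nth: "ys ! i < 4" if "i < 5" for i
    using assms(4,5) that nth_mem[of i ys] by (simp add: subset_iff)
  show ?thesis
    using assms(1-3)
  proof (induction c arbitrary: q pc)
    case Skip
    then show ?case by simp
  next
    case (Push i a)
    then show ?case using assms(4) by (simp add: upd nth)
  next
    case (PushTop i j)
    then show ?case using assms(4) by (simp add: upd nth)
  next
    case (Pop i)
    then show ?case using assms(4) by (simp add: upd nth)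
  next
    case (Seq c1 c2)
    show ?case
      using Seq.prems Seq.IH(1)[of q pc] Seq.IH(2)[of "q + csize c1" pc] by (cases "pc < q + csize c1") simp_all
  next
    case (Cond i P c1 c2)
    then consider "pc = q" | "q + 1 \<le> pc" "pc < q + 1 + csize c1" | "pc = q + 1 + csize c1"
      | "q + 2 + csize c1 \<le> pc" by linarith
    then show ?case
      using Cond.prems Cond.IH(1)[of "q + 1" pc] Cond.IH(2)[of "q + 2 + csize c1" pc] noop assms(4)
      by cases (simp_all add: image_subset_iff)
  next
    case (Loop i P c)
    then consider "pc = q" | "q + 1 \<le> pc" "pc < q + 1 + csize c" | "pc = q + 1 + csize c"
      by fastforce
    then show ?case
      using Loop.prems Loop.IH[of "q + 1" pc] noop assms(4)
      by cases (simp_all add: image_subset_iff)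
  qed
qed

lemma wf_compile: "wf_com c \<Longrightarrow> 0 < csize c \<Longrightarrow> wf_tm (compile c)"
  using trans_of_wf[of c 0] by (auto simp: wf_tm_def compile_def)

text \<open>An ordinary stack has its top under the head and grows to the left; what lies left of
  the head is arbitrary. The output stack grows to the right from cell \<open>0\<close>, hence the
  reversal, because the output of a machine is read from there on.\<close>

definition tape_rel :: "nat \<Rightarrow> nat list \<Rightarrow> tape \<Rightarrow> bool" where
  "tape_rel i xs T \<longleftrightarrow>
     (if i = 1 then snd T = int (length xs) \<and>
        (\<forall>n. fst T (int n) = (if n < length xs then rev xs ! n else 0))
      else (\<forall>n. fst T (snd T + int n) = (if n < length xs then xs ! n else 0)))"

definition stacks_rel :: "stacks \<Rightarrow> tape list \<Rightarrow> bool" where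
  "stacks_rel s ts \<longleftrightarrow> length ts = 5 \<and> (\<forall>i<5. tape_rel i (s i) (ts ! i))"

lemma tape_rel_scan: "tape_rel i xs T \<Longrightarrow> i \<noteq> 1 \<Longrightarrow> fst T (snd T) = peek xs"
  by (cases xs) (auto simp: tape_rel_def dest!: spec[of _ 0])

text \<open>Left of the head there may be remains of popped symbols; moving there first and writing
  afterwards overwrites them. On the output tape the head already stands on the first free
  cell.\<close>

lemma tape_rel_push:
  assumes "tape_rel i xs T"
  shows "tape_rel i (a # xs)
    (act (act T (fst T (snd T), if i = 1 then Stay else Lft)) (a, if i = 1 then Rgt else Stay))"
proof (cases "i = 1")
  case True
  then show ?thesis using assms
    by (auto simp: tape_rel_def act_def nth_append)
next
  case False
  then have f: "fst T (snd T + int n) = (if n < length xs then xs ! n else 0)" for n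
    using assms by (auto simp: tape_rel_def)
  have "fst T (snd T - 1 + int n) = (if n < Suc (length xs) then (a # xs) ! n else 0)" if "n \<noteq> 0" for n
    using f[of "n - 1"] that by (auto simp: of_nat_diff nth_Cons split: nat.splits)
  then show ?thesis using False
    by (auto simp: tape_rel_def act_def)
qed

lemma tape_rel_pop:
  assumes "tape_rel i xs T" "i \<noteq> 1"
  shows "tape_rel i (tl xs) (act T (fst T (snd T), Rgt))"
proof -
  have f: "fst T (snd T + int n) = (if n < length xs then xs ! n else 0)" for n
    using assms by (auto simp: tape_rel_def)
  show ?thesis using assms(2) f[of "Suc n" for n]
    by (auto simp: tape_rel_def act_def algebra_simps nth_tl)
qed

lemma map2_act_noop:
  "map2 act ts (noop (map (\<lambda>T. fst T (snd T)) ts)) = ts"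
  by (rule nth_equalityI) (auto simp: noop_def act_def)

lemma map2_act_update:
  "map2 act ts ((noop (map (\<lambda>T. fst T (snd T)) ts))[i := a]) = ts[i := act (ts ! i) a]"
proof (rule nth_equalityI)
  fix j assume "j < length (map2 act ts ((noop (map (\<lambda>T. fst T (snd T)) ts))[i := a]))"
  then show "map2 act ts ((noop (map (\<lambda>T. fst T (snd T)) ts))[i := a]) ! j = ts[i := act (ts ! i) a] ! j"
    by (cases "j = i") (auto simp: noop_def act_def)
qed simp

lemma step_eq:
  assumes "q < tm_states M"
    "tm_delta M q (map (\<lambda>T. fst T (snd T)) ts) = (q', as)"
  shows "step M (q, ts) = (q', map2 act ts as)"
  using assms by (simp add: step_def Let_def)

lemma stacks_rel_update:
  assumes "stacks_rel s ts" "i < 5" "tape_rel i xs T"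
  shows "stacks_rel (s(i := xs)) (ts[i := T])"
  using assms by (auto simp: stacks_rel_def nth_list_update)

lemma funpow_add_apply: "(f ^^ (m + n)) x = (f ^^ n) ((f ^^ m) x)"
  by (simp add: add.commute[of m] funpow_add)

text \<open>Keeps the machine fixed while the simulation proof descends to subcommands, each of
  which occupies a segment of its states.\<close>

definition embeds :: "tm \<Rightarrow> com \<Rightarrow> nat \<Rightarrow> bool" where
  "embeds M c q \<longleftrightarrow> q + csize c \<le> tm_states M \<and>
     (\<forall>pc ys. q \<le> pc \<longrightarrow> pc < q + csize c \<longrightarrow> tm_delta M pc ys = trans_of c q pc ys)"

lemma stacks_rel_scan:
  assumes "stacks_rel s ts" "i < 5" "i \<noteq> 1"
  shows "map (\<lambda>T. fst T (snd T)) ts ! i = peek (s i)"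
  using assms tape_rel_scan[of i "s i" "ts ! i"] by (auto simp: stacks_rel_def)

text \<open>Induction on the execution instead of the command unfolds loops; the start state and the
  tapes vary because each subcommand begins where its predecessor stopped.\<close>

lemma exec_compiled:
  assumes "exec c s n s'" "wf_com c" "embeds M c q" "stacks_rel s ts"
  shows "\<exists>ts'. stacks_rel s' ts' \<and> (step M ^^ n) (q, ts) = (q + csize c, ts')"
  using assms
proof (induction arbitrary: q ts rule: exec.induct)
  case (Skip s)
  then show ?case by auto
next
  case (Push i a s)
  define T where "T = ts ! i"
  define T1 where "T1 = act T (fst T (snd T), if i = 1 then Stay else Lft)"
  have len: "length ts = 5" "i < 5" "tape_rel i (s i) T"
    using Push by (auto simp: stacks_rel_def T_def)
  have 1: "step M (q, ts) = (Suc q, ts[i := T1])"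
    using Push(2) len by (subst step_eq) (auto simp: embeds_def map2_act_update T1_def T_def)
  have 2: "step M (Suc q, ts[i := T1]) =
      (Suc (Suc q), ts[i := act T1 (a, if i = 1 then Rgt else Stay)])"
    using Push(2) len by (subst step_eq) (auto simp: embeds_def map2_act_update)
  show ?case
    by (intro exI conjI, rule stacks_rel_update[OF Push(3) len(2) tape_rel_push[OF len(3)]])
       (use 1 2 in \<open>simp add: numeral_2_eq_2 T1_def\<close>)
next
  case (PushTop i j s)
  define T where "T = ts ! i"
  define T1 where "T1 = act T (fst T (snd T), if i = 1 then Stay else Lft)"
  have len: "length ts = 5" "i < 5" "tape_rel i (s i) T" "j < 5" "i \<noteq> j" "j \<noteq> 1"
    using PushTop by (auto simp: stacks_rel_def T_def)
  have 1: "step M (q, ts) = (Suc q, ts[i := T1])"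
    using PushTop(2) len by (subst step_eq) (auto simp: embeds_def map2_act_update T1_def T_def)
  have rj: "fst (ts ! j) (snd (ts ! j)) = peek (s j)"
    using stacks_rel_scan[OF PushTop(3) len(4,6)] len by simp
  have 2: "step M (Suc q, ts[i := T1]) =
      (Suc (Suc q), ts[i := act T1 (peek (s j), if i = 1 then Rgt else Stay)])"
    using PushTop(2) len rj by (subst step_eq) (auto simp: embeds_def map2_act_update)
  show ?case
    by (intro exI conjI, rule stacks_rel_update[OF PushTop(3) len(2) tape_rel_push[OF len(3)]])
       (use 1 2 in \<open>simp add: numeral_2_eq_2 T1_def\<close>)
next
  case (Pop i s)
  define T where "T = ts ! i"
  have len: "length ts = 5" "i < 5" "tape_rel i (s i) T" "i \<noteq> 1"
    using Pop by (auto simp: stacks_rel_def T_def)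
  have 1: "step M (q, ts) = (Suc q, ts[i := act T (fst T (snd T), Rgt)])"
    using Pop(2) len by (subst step_eq) (auto simp: embeds_def map2_act_update T_def)
  show ?case
    by (intro exI conjI, rule stacks_rel_update[OF Pop(3) len(2) tape_rel_pop[OF len(3,4)]])
       (use 1 in simp)
next
  case (Seq c1 s m s' c2 n s'')
  have "embeds M c1 q" "embeds M c2 (q + csize c1)" using Seq.prems(2) by (auto simp: embeds_def)
  then obtain ts' ts'' where "stacks_rel s' ts'" "(step M ^^ m) (q, ts) = (q + csize c1, ts')"
    "stacks_rel s'' ts''" "(step M ^^ n) (q + csize c1, ts') = (q + csize c1 + csize c2, ts'')"
    using Seq by (metis wf_com.simps(5))
  then show ?case by (auto simp: funpow_add_apply add.assoc)
next
  case (CondT P s i c1 n s' c2)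
  have e: "embeds M c1 (q + 1)" using CondT.prems(2) by (auto simp: embeds_def)
  have sc: "map (\<lambda>T. fst T (snd T)) ts ! i = peek (s i)"
    using stacks_rel_scan CondT.prems by simp
  have 1: "step M (q, ts) = (q + 1, ts)"
    using CondT sc by (subst step_eq) (auto simp: embeds_def map2_act_noop simp del: nth_map)
  obtain ts' where ts': "stacks_rel s' ts'" "(step M ^^ n) (q + 1, ts) = (q + 1 + csize c1, ts')"
    using CondT.IH[OF _ e CondT.prems(3)] CondT.prems(1) by auto
  have 2: "step M (q + 1 + csize c1, ts') = (q + 2 + csize c1 + csize c2, ts')"
    using CondT.prems(2) by (subst step_eq) (auto simp: embeds_def map2_act_noop)
  have "(step M ^^ (1 + n + 1)) (q, ts) = (q + 2 + csize c1 + csize c2, ts')"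
    unfolding funpow_add_apply using 1 2 ts' by simp
  then show ?case using ts' by (auto simp: add.commute add.left_commute)
next
  case (CondF P s i c2 n s' c1)
  have e: "embeds M c2 (q + 2 + csize c1)" using CondF.prems(2) by (auto simp: embeds_def)
  have sc: "map (\<lambda>T. fst T (snd T)) ts ! i = peek (s i)"
    using stacks_rel_scan CondF.prems by simp
  have 1: "step M (q, ts) = (q + 2 + csize c1, ts)"
    using CondF sc by (subst step_eq) (auto simp: embeds_def map2_act_noop simp del: nth_map)
  obtain ts' where ts': "stacks_rel s' ts'"
      "(step M ^^ n) (q + 2 + csize c1, ts) = (q + 2 + csize c1 + csize c2, ts')"
    using CondF.IH[OF _ e CondF.prems(3)] CondF.prems(1) by auto
  have "(step M ^^ (1 + n)) (q, ts) = (q + 2 + csize c1 + csize c2, ts')"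
    unfolding funpow_add_apply using 1 ts' by simp
  then show ?case using ts' by (auto simp: add.commute add.left_commute)
next
  case (LoopT P s i c m s' n s'')
  have e: "embeds M c (q + 1)" using LoopT.prems(2) by (auto simp: embeds_def)
  have sc: "map (\<lambda>T. fst T (snd T)) ts ! i = peek (s i)"
    using stacks_rel_scan LoopT.prems by simp
  have 1: "step M (q, ts) = (q + 1, ts)"
    using LoopT sc by (subst step_eq) (auto simp: embeds_def map2_act_noop simp del: nth_map)
  obtain ts' where ts': "stacks_rel s' ts'" "(step M ^^ m) (q + 1, ts) = (q + 1 + csize c, ts')"
    using LoopT.IH(1)[OF _ e LoopT.prems(3)] LoopT.prems(1) by auto
  have 2: "step M (q + 1 + csize c, ts') = (q, ts')"
    using LoopT.prems(2) by (subst step_eq) (auto simp: embeds_def map2_act_noop)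
  obtain ts'' where ts'': "stacks_rel s'' ts''"
      "(step M ^^ n) (q, ts') = (q + csize (Loop i P c), ts'')"
    using LoopT.IH(2)[OF LoopT.prems(1,2) ts'(1)] by blast
  have "(step M ^^ (1 + m + 1 + n)) (q, ts) = (q + csize (Loop i P c), ts'')"
    unfolding funpow_add_apply using 1 2 ts' ts'' by simp
  then show ?case using ts'' by (auto simp: add.commute add.left_commute)
next
  case (LoopF P s i c)
  have sc: "map (\<lambda>T. fst T (snd T)) ts ! i = peek (s i)"
    using stacks_rel_scan LoopF.prems by simp
  have 1: "step M (q, ts) = (q + csize (Loop i P c), ts)"
    using LoopF sc by (subst step_eq) (auto simp: embeds_def map2_act_noop simp del: nth_map)
  then show ?case using LoopF by auto
qed

definition bits_symbols :: "bool list \<Rightarrow> nat list" where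
  "bits_symbols x = map (\<lambda>b. if b then 2 else 1) x"

lemma contents_nth: "contents x (int n) = (if n < length x then bits_symbols x ! n else 0)"
  by (simp add: contents_def bits_symbols_def)

lemma step_halted: "fst C = tm_states M \<Longrightarrow> (step M ^^ n) C = C"
  by (induction n) (auto simp: step_def)

text \<open>State \<open>csize c\<close> is the halting state of \<open>compile c\<close>, so the
  remaining \<open>N - n\<close> steps change nothing. The reversal in the premise undoes that of
  the output tape.\<close>

lemma exec_outputs_within:
  assumes "exec c ((\<lambda>_. [])(0 := bits_symbols x)) n s'" "wf_com c" "0 < csize c"
    "s' 1 = rev (bits_symbols y)" "n \<le> N"
  shows "outputs_within (compile c) x y N"
proof -
  have "stacks_rel ((\<lambda>_. [])(0 := bits_symbols x)) (snd (start (compile c) x))"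
    unfolding stacks_rel_def
  proof (intro conjI allI impI)
    fix i :: nat assume "i < 5"
    then show "tape_rel i (((\<lambda>_. [])(0 := bits_symbols x)) i) (snd (start (compile c) x) ! i)"
      by (cases i) (auto simp: start_def compile_def tape_rel_def contents_nth bits_symbols_def)
  qed (simp add: start_def compile_def)
  moreover have "embeds (compile c) c 0" by (simp add: embeds_def compile_def)
  ultimately obtain ts' where ts': "stacks_rel s' ts'"
      "(step (compile c) ^^ n) (start (compile c) x) = (csize c, ts')"
    using exec_compiled[OF assms(1,2), of "compile c" 0 "snd (start (compile c) x)"]
    by (auto simp: start_def)
  have "(step (compile c) ^^ N) (start (compile c) x) = (csize c, ts')"
    using funpow_add_apply[of n "N - n" "step (compile c)" "start (compile c) x"] ts'(2) assms(5)
      step_halted[of "(csize c, ts')" "compile c" "N - n"]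
    by (simp add: compile_def[of c, THEN arg_cong[of _ _ tm_states]])
  then show ?thesis
    using ts'(1) assms(4)
    by (auto simp: outputs_within_def Let_def compile_def stacks_rel_def tape_rel_def contents_nth
        bits_symbols_def dest!: spec[of _ "1::nat"])
qed

section \<open>Trees on stacks\<close>

text \<open>A bound in place of the exact count lets branches of different length share one
  bound.\<close>

definition runs :: "com \<Rightarrow> stacks \<Rightarrow> nat \<Rightarrow> stacks \<Rightarrow> bool" where
  "runs c s t s' \<longleftrightarrow> (\<exists>n\<le>t. exec c s n s')"

lemma runs_mono: "runs c s t s' \<Longrightarrow> t \<le> t' \<Longrightarrow> runs c s t' s'"
  unfolding runs_def by (meson le_trans)

lemma execs_runs: "exec c s t s' \<Longrightarrow> runs c s t s'"
  by (auto simp: runs_def)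

lemma runs_Seq: "runs c1 s t1 s' \<Longrightarrow> runs c2 s' t2 s'' \<Longrightarrow> runs (c1 ;; c2) s (t1 + t2) s''"
  unfolding runs_def by (meson add_mono exec.Seq)

lemma runs_CondT: "P (peek (s i)) \<Longrightarrow> runs c1 s t s' \<Longrightarrow> runs (Cond i P c1 c2) s (t + 2) s'"
  unfolding runs_def by (meson add_le_mono1 exec.CondT)

lemma runs_CondF: "\<not> P (peek (s i)) \<Longrightarrow> runs c2 s t s' \<Longrightarrow> runs (Cond i P c1 c2) s (t + 2) s'"
  unfolding runs_def by (meson add_le_mono exec.CondF one_le_numeral)

lemma runs_LoopT:
  "P (peek (s i)) \<Longrightarrow> runs c s t1 s' \<Longrightarrow> runs (Loop i P c) s' t2 s'' \<Longrightarrow>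
    runs (Loop i P c) s (t1 + t2 + 2) s''"
  unfolding runs_def by (meson add_le_mono1 add_mono exec.LoopT)

lemma runs_LoopF: "\<not> P (peek (s i)) \<Longrightarrow> runs (Loop i P c) s 1 s"
  by (rule execs_runs[OF exec.LoopF])

definition st :: "nat list \<Rightarrow> nat list \<Rightarrow> nat list \<Rightarrow> nat list \<Rightarrow> nat list \<Rightarrow> stacks" where
  "st a w b c d = (\<lambda>i. if i = 0 then a else if i = 1 then w else if i = 2 then b else
     if i = 3 then c else if i = 4 then d else [])"

lemma st_simps [simp]:
  "st a w b c d 0 = a" "st a w b c d 1 = w" "st a w b c d 2 = b" "st a w b c d 3 = c"
  "st a w b c d 4 = d" "(st a w b c d)(0 := x) = st x w b c d"
  "(st a w b c d)(1 := x) = st a x b c d" "(st a w b c d)(2 := x) = st a w x c d"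
  "(st a w b c d)(3 := x) = st a w b x d" "(st a w b c d)(4 := x) = st a w b c x"
  by (auto simp: st_def fun_eq_iff)

lemma runs_basic:
  "runs Skip s 0 s"
  "runs (Push 0 x) (st a w b c d) 2 (st (x # a) w b c d)"
  "runs (Push 1 x) (st a w b c d) 2 (st a (x # w) b c d)"
  "runs (Push 2 x) (st a w b c d) 2 (st a w (x # b) c d)"
  "runs (Push 3 x) (st a w b c d) 2 (st a w b (x # c) d)"
  "runs (Push 4 x) (st a w b c d) 2 (st a w b c (x # d))"
  "runs (Pop 0) (st (x # a) w b c d) 1 (st a w b c d)"
  "runs (Pop 2) (st a w (x # b) c d) 1 (st a w b c d)"
  "runs (Pop 3) (st a w b (x # c) d) 1 (st a w b c d)"
  "runs (Pop 4) (st a w b c (x # d)) 1 (st a w b c d)"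
  "runs (PushTop 2 0) (st (x # a) w b c d) 2 (st (x # a) w (x # b) c d)"
  "runs (PushTop 0 2) (st a w (x # b) c d) 2 (st (x # a) w (x # b) c d)"
  "runs (PushTop 3 2) (st a w (x # b) c d) 2 (st a w (x # b) (x # c) d)"
  "runs (PushTop 2 3) (st a w b (x # c) d) 2 (st a w (x # b) (x # c) d)"
  using exec.Skip[of s, THEN execs_runs]
    exec.Push[of 0 x "st a w b c d", THEN execs_runs]
    exec.Push[of 1 x "st a w b c d", THEN execs_runs]
    exec.Push[of 2 x "st a w b c d", THEN execs_runs]
    exec.Push[of 3 x "st a w b c d", THEN execs_runs]
    exec.Push[of 4 x "st a w b c d", THEN execs_runs]
    exec.Pop[of 0 "st (x # a) w b c d", THEN execs_runs]
    exec.Pop[of 2 "st a w (x # b) c d", THEN execs_runs]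
    exec.Pop[of 3 "st a w b (x # c) d", THEN execs_runs]
    exec.Pop[of 4 "st a w b c (x # d)", THEN execs_runs]
    exec.PushTop[of 2 0 "st (x # a) w b c d", THEN execs_runs]
    exec.PushTop[of 0 2 "st a w (x # b) c d", THEN execs_runs]
    exec.PushTop[of 3 2 "st a w (x # b) c d", THEN execs_runs]
    exec.PushTop[of 2 3 "st a w b (x # c) d", THEN execs_runs]
  by (auto simp flip: One_nat_def)

datatype val = Lf | Nd val val

text \<open>Preorder is self-delimiting: a code ends as soon as leaves outnumber inner nodes. The
  symbol \<open>3\<close> stays free to mark the bottom of a segment on a stack.\<close>

fun code :: "val \<Rightarrow> nat list" where
  "code Lf = [1]"
| "code (Nd a b) = 2 # code a @ code b"

lemma three_notin_code [simp]: "3 \<notin> set (code v)"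
  by (induction v) auto

lemma length_code_pos [simp]: "0 < length (code v)"
  by (cases v) auto

text \<open>Stack \<open>4\<close> counts the subtrees still to be read.\<close>

definition pick_body :: com where
  "pick_body = Cond 0 (\<lambda>x. x = 2) (Push 4 1 ;; PushTop 2 0 ;; Pop 0) (Pop 4 ;; PushTop 2 0 ;; Pop 0)"

definition pick :: com where
  "pick = Push 2 3 ;; Push 4 3 ;; Push 4 1 ;; Loop 4 (\<lambda>x. x = 1) pick_body ;; Pop 4"

text \<open>Formulated with an arbitrary continuation of the loop, so that in the inductive step the
  run for the second subtree continues the one for the first. A symbol costs at most 9 steps, 7 for
  the longer branch of the body and 2 for the loop.\<close>

lemma pick_loop:
  assumes "runs (Loop 4 (\<lambda>x. x = 1) pick_body) (st r w (rev (code v) @ b) c d) t s'"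
  shows "runs (Loop 4 (\<lambda>x. x = 1) pick_body) (st (code v @ r) w b c (1 # d)) (t + 9 * length (code v)) s'"
  using assms
proof (induction v arbitrary: r b d t)
  case Lf
  have "runs pick_body (st (1 # r) w b c (1 # d)) (1 + (2 + 1) + 2) (st r w (1 # b) c d)"
    unfolding pick_body_def by (rule runs_CondF, simp) (rule runs_Seq runs_basic)+
  from runs_LoopT[where P = "\<lambda>x. x = 1" and i = 4, OF _ this, of t s'] Lf show ?case
    by (auto elim!: runs_mono)
next
  case (Nd x y)
  have 1: "runs pick_body (st (2 # code x @ code y @ r) w b c (1 # d)) (2 + (2 + 1) + 2)
      (st (code x @ code y @ r) w (2 # b) c (1 # 1 # d))"
    unfolding pick_body_def by (rule runs_CondT, simp) (rule runs_Seq runs_basic)+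
  have "runs (Loop 4 (\<lambda>x. x = 1) pick_body) (st (code y @ r) w (rev (code x) @ 2 # b) c (1 # d))
      (t + 9 * length (code y)) s'"
    by (rule Nd.IH(2)) (use Nd.prems in simp)
  then have "runs (Loop 4 (\<lambda>x. x = 1) pick_body) (st (code x @ code y @ r) w (2 # b) c (1 # 1 # d))
      (t + 9 * length (code y) + 9 * length (code x)) s'"
    by (rule Nd.IH(1))
  from runs_LoopT[where P = "\<lambda>x. x = 1" and i = 4, OF _ 1 this] show ?case
    by (auto elim!: runs_mono)
qed

lemma runs_pick:
  "runs pick (st (code v @ r) w b c d) (9 * length (code v) + 8) (st r w (rev (code v) @ 3 # b) c d)"
proof -
  have *: "runs (Loop 4 (\<lambda>x. x = 1) pick_body) (st (code v @ r) w (3 # b) c (1 # 3 # d))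
      (1 + 9 * length (code v)) (st r w (rev (code v) @ 3 # b) c (3 # d))"
    by (rule pick_loop, rule runs_LoopF) auto
  show ?thesis
    unfolding pick_def by (rule runs_mono, (rule runs_Seq runs_basic * )+) simp
qed

definition put :: com where
  "put = Loop 2 (\<lambda>x. x \<noteq> 3) (PushTop 0 2 ;; Pop 2) ;; Pop 2"

definition two_to_three :: com where
  "two_to_three = Push 3 3 ;; Loop 2 (\<lambda>x. x \<noteq> 3) (PushTop 3 2 ;; Pop 2) ;; Pop 2"

definition three_to_two :: com where
  "three_to_two = Push 2 3 ;; Loop 3 (\<lambda>x. x \<noteq> 3) (PushTop 2 3 ;; Pop 3) ;; Pop 3"

definition two_to_both :: com where
  "two_to_both = Push 3 3 ;;
     Loop 2 (\<lambda>x. x \<noteq> 3) (PushTop 0 2 ;; PushTop 3 2 ;; Pop 2) ;; Pop 2"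

definition discard :: com where
  "discard = pick ;; Loop 2 (\<lambda>x. x \<noteq> 3) (Pop 2) ;; Pop 2"

text \<open>\<open>F\<close> describes the stacks by the unread part of a segment and an
  accumulator; the mark \<open>3\<close> below the segment ends the loop.\<close>

lemma runs_loop_until:
  assumes step: "\<And>x xs a. x \<noteq> 3 \<Longrightarrow> runs body (F (x # xs) a) k (F xs (g x a))"
    and peek: "\<And>xs a. peek (F xs a i) = peek (xs @ [3])" and "3 \<notin> set xs"
  shows "runs (Loop i (\<lambda>x. x \<noteq> 3) body) (F xs a) ((k + 2) * length xs + 1) (F [] (fold g xs a))"
  using assms(3)
proof (induction xs arbitrary: a)
  case Nil
  then show ?case using runs_LoopF[of "\<lambda>x. x \<noteq> 3" "F [] a" i body] peek[of "[]" a] by simp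
next
  case (Cons x xs)
  show ?case
    using runs_LoopT[where P = "\<lambda>x. x \<noteq> 3" and i = i, OF _ step[of x xs a] Cons.IH] Cons.prems
      peek[of "x # xs" a]
    by (auto elim!: runs_mono)
qed

lemma peek_append: "peek (xs @ x # ys) = (if xs = [] then x else hd xs)"
  by (cases xs) auto

lemma fold_push [simp]: "fold (#) xs ys = rev xs @ ys"
  by (induction xs arbitrary: ys) auto

lemma runs_put:
  assumes "3 \<notin> set xs"
  shows "runs put (st r w (xs @ 3 # b) c d) (5 * length xs + 2) (st (rev xs @ r) w b c d)"
proof -
  have "runs (Loop 2 (\<lambda>x. x \<noteq> 3) (PushTop 0 2 ;; Pop 2)) (st r w (xs @ 3 # b) c d)
      ((2 + 1 + 2) * length xs + 1) (st (fold (#) xs r) w ([] @ 3 # b) c d)"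
    by (rule runs_loop_until[where F = "\<lambda>xs a. st a w (xs @ 3 # b) c d"], unfold append_Cons, (rule runs_Seq runs_basic)+)
       (use assms in \<open>auto simp: peek_append\<close>)
  then have *: "runs (Loop 2 (\<lambda>x. x \<noteq> 3) (PushTop 0 2 ;; Pop 2)) (st r w (xs @ 3 # b) c d)
      (5 * length xs + 1) (st (rev xs @ r) w (3 # b) c d)" by simp
  show ?thesis
    unfolding put_def by (rule runs_mono, (rule runs_Seq runs_basic * )+) simp
qed

lemma runs_two_to_three:
  assumes "3 \<notin> set xs"
  shows "runs two_to_three (st r w (xs @ 3 # b) c d) (5 * length xs + 4) (st r w b (rev xs @ 3 # c) d)"
proof -
  have "runs (Loop 2 (\<lambda>x. x \<noteq> 3) (PushTop 3 2 ;; Pop 2)) (st r w (xs @ 3 # b) (3 # c) d)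
      ((2 + 1 + 2) * length xs + 1) (st r w ([] @ 3 # b) (fold (#) xs (3 # c)) d)"
    by (rule runs_loop_until[where F = "\<lambda>xs a. st r w (xs @ 3 # b) a d"], unfold append_Cons, (rule runs_Seq runs_basic)+)
       (use assms in \<open>auto simp: peek_append\<close>)
  then have *: "runs (Loop 2 (\<lambda>x. x \<noteq> 3) (PushTop 3 2 ;; Pop 2)) (st r w (xs @ 3 # b) (3 # c) d)
      (5 * length xs + 1) (st r w (3 # b) (rev xs @ 3 # c) d)" by simp
  show ?thesis
    unfolding two_to_three_def by (rule runs_mono, (rule runs_Seq runs_basic * )+) simp
qed

lemma runs_three_to_two:
  assumes "3 \<notin> set xs"
  shows "runs three_to_two (st r w b (xs @ 3 # c) d) (5 * length xs + 4) (st r w (rev xs @ 3 # b) c d)"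
proof -
  have "runs (Loop 3 (\<lambda>x. x \<noteq> 3) (PushTop 2 3 ;; Pop 3)) (st r w (3 # b) (xs @ 3 # c) d)
      ((2 + 1 + 2) * length xs + 1) (st r w (fold (#) xs (3 # b)) ([] @ 3 # c) d)"
    by (rule runs_loop_until[where F = "\<lambda>xs a. st r w a (xs @ 3 # c) d"], unfold append_Cons, (rule runs_Seq runs_basic)+)
       (use assms in \<open>auto simp: peek_append\<close>)
  then have *: "runs (Loop 3 (\<lambda>x. x \<noteq> 3) (PushTop 2 3 ;; Pop 3)) (st r w (3 # b) (xs @ 3 # c) d)
      (5 * length xs + 1) (st r w (rev xs @ 3 # b) (3 # c) d)" by simp
  show ?thesis
    unfolding three_to_two_def by (rule runs_mono, (rule runs_Seq runs_basic * )+) simp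
qed

lemma runs_two_to_both:
  assumes "3 \<notin> set xs"
  shows "runs two_to_both (st r w (xs @ 3 # b) c d) (7 * length xs + 4)
    (st (rev xs @ r) w b (rev xs @ 3 # c) d)"
proof -
  have fold: "fold (\<lambda>x a. (x # fst a, x # snd a)) xs (p, q) = (rev xs @ p, rev xs @ q)" for p q :: "nat list"
    by (induction xs arbitrary: p q) auto
  have "runs (Loop 2 (\<lambda>x. x \<noteq> 3) (PushTop 0 2 ;; PushTop 3 2 ;; Pop 2))
      (st (fst (r, 3 # c)) w (xs @ 3 # b) (snd (r, 3 # c)) d) ((2 + (2 + 1) + 2) * length xs + 1)
      (st (fst (fold (\<lambda>x a. (x # fst a, x # snd a)) xs (r, 3 # c))) w ([] @ 3 # b)
        (snd (fold (\<lambda>x a. (x # fst a, x # snd a)) xs (r, 3 # c))) d)"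
    by (rule runs_loop_until[where F = "\<lambda>xs a. st (fst a) w (xs @ 3 # b) (snd a) d"], unfold append_Cons fst_conv snd_conv, (rule runs_Seq runs_basic)+)
       (use assms in \<open>auto simp: peek_append\<close>)
  then have *: "runs (Loop 2 (\<lambda>x. x \<noteq> 3) (PushTop 0 2 ;; PushTop 3 2 ;; Pop 2)) (st r w (xs @ 3 # b) (3 # c) d)
      (7 * length xs + 1) (st (rev xs @ r) w (3 # b) (rev xs @ 3 # c) d)" by (simp add: fold)
  show ?thesis
    unfolding two_to_both_def by (rule runs_mono, (rule runs_Seq runs_basic * )+) simp
qed

lemma runs_discard:
  "runs discard (st (code v @ r) w b c d) (12 * length (code v) + 10) (st r w b c d)"
proof -
  have "runs (Loop 2 (\<lambda>x. x \<noteq> 3) (Pop 2)) (st r w (rev (code v) @ 3 # b) c d)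
      ((1 + 2) * length (rev (code v)) + 1) (st r w ([] @ 3 # b) c d)"
    by (rule runs_loop_until[where F = "\<lambda>xs a. st r w (xs @ 3 # b) c d"], unfold append_Cons, (rule runs_Seq runs_basic)+)
       (auto simp: peek_append)
  then have *: "runs (Loop 2 (\<lambda>x. x \<noteq> 3) (Pop 2)) (st r w (rev (code v) @ 3 # b) c d)
      (3 * length (code v) + 1) (st r w (3 # b) c d)" by (auto elim!: runs_mono)
  show ?thesis
    unfolding discard_def by (rule runs_mono, (rule runs_Seq runs_basic runs_pick * )+) simp
qed

lemmas runs_code =
  runs_pick runs_discard
  runs_put[of "rev (code v)" for v, simplified] runs_two_to_three[of "rev (code v)" for v, simplified]
  runs_three_to_two[of "code v" for v, simplified] runs_two_to_both[of "rev (code v)" for v, simplified]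

text \<open>Each move of a segment reverses it, so a copy must arrive after an even number of moves;
  stack \<open>3\<close> provides the additional ones.\<close>

definition dup :: com where
  "dup = pick ;; two_to_both ;; three_to_two ;; put"

lemma runs_dup:
  "runs dup (st (code v @ r) w b c d) (26 * length (code v) + 18) (st (code v @ code v @ r) w b c d)"
  unfolding dup_def by (rule runs_mono, (rule runs_Seq runs_code)+) simp

definition swap :: com where
  "swap = pick ;; pick ;; two_to_three ;; put ;; three_to_two ;; put"

lemma runs_swap:
  "runs swap (st (code u @ code v @ r) w b c d) (24 * (length (code u) + length (code v)) + 28)
    (st (code v @ code u @ r) w b c d)"
  unfolding swap_def by (rule runs_mono, (rule runs_Seq runs_code)+) simp

fun vcar :: "val \<Rightarrow> val" where "vcar Lf = Lf" | "vcar (Nd a b) = a"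
fun vcdr :: "val \<Rightarrow> val" where "vcdr Lf = Lf" | "vcdr (Nd a b) = b"

definition car :: com where
  "car = Cond 0 (\<lambda>x. x = 2) (Pop 0 ;; pick ;; discard ;; put) Skip"

definition cdr :: com where
  "cdr = Cond 0 (\<lambda>x. x = 2) (Pop 0 ;; discard) Skip"

lemma runs_car:
  "runs car (st (code v @ r) w b c d) (26 * length (code v) + 30) (st (code (vcar v) @ r) w b c d)"
proof (cases v)
  case Lf
  have "runs car (st (code Lf @ r) w b c d) (0 + 2) (st (code Lf @ r) w b c d)"
    unfolding car_def by (rule runs_CondF, simp, rule runs_basic)
  then show ?thesis using Lf by (auto elim!: runs_mono)
next
  case (Nd x y)
  have "runs car (st (2 # code x @ code y @ r) w b c d)
      (1 + ((9 * length (code x) + 8) + ((12 * length (code y) + 10) + (5 * length (code x) + 2))) + 2)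
      (st (code x @ r) w b c d)"
    unfolding car_def
    by (rule runs_CondT, simp, rule runs_mono, (rule runs_Seq runs_basic runs_code)+) simp
  then show ?thesis using Nd by (auto elim!: runs_mono)
qed

lemma runs_cdr:
  "runs cdr (st (code v @ r) w b c d) (12 * length (code v) + 30) (st (code (vcdr v) @ r) w b c d)"
proof (cases v)
  case Lf
  have "runs cdr (st (code Lf @ r) w b c d) (0 + 2) (st (code Lf @ r) w b c d)"
    unfolding cdr_def by (rule runs_CondF, simp, rule runs_basic)
  then show ?thesis using Lf by (auto elim!: runs_mono)
next
  case (Nd x y)
  have "runs cdr (st (2 # code x @ code y @ r) w b c d) (1 + (12 * length (code x) + 10) + 2)
      (st (code y @ r) w b c d)"
    unfolding cdr_def
    by (rule runs_CondT, simp, rule runs_mono, (rule runs_Seq runs_basic runs_code)+) simp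
  then show ?thesis using Nd by (auto elim!: runs_mono)
qed

lemma wf_com_programs [simp]:
  "wf_com pick" "wf_com put" "wf_com discard" "wf_com dup" "wf_com swap" "wf_com car" "wf_com cdr"
  by (simp_all add: pick_def pick_body_def put_def discard_def dup_def swap_def car_def cdr_def
      two_to_both_def two_to_three_def three_to_two_def)

text \<open>Each step adds at most one symbol to a stack; hence a time bound is also a bound on the
  size of the result.\<close>

lemma exec_length: "exec c s n s' \<Longrightarrow> length (s' i) \<le> length (s i) + n"
  by (induction rule: exec.induct) auto

section \<open>Polynomial-time functions on encodable types\<close>

class encodable =
  fixes repr :: "'a \<Rightarrow> val"

instantiation val :: encodable
begin
definition repr_val :: "val \<Rightarrow> val" where "repr_val v = v"
instance ..
end

instantiation bool :: encodable
begin
text \<open>Truth is visible at the root of the tree, where a single \<open>Cond\<close> can test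
  it.\<close>

definition repr_bool :: "bool \<Rightarrow> val" where "repr_bool b = (if b then Nd Lf Lf else Lf)"
instance ..
end

instantiation prod :: (encodable, encodable) encodable
begin
definition repr_prod :: "'a \<times> 'b \<Rightarrow> val" where "repr_prod p = Nd (repr (fst p)) (repr (snd p))"
instance ..
end

instantiation list :: (encodable) encodable
begin
primrec repr_list :: "'a list \<Rightarrow> val" where
  "repr_list [] = Lf"
| "repr_list (x # xs) = Nd (repr x) (repr_list xs)"
instance ..
end

instantiation nat :: encodable
begin
text \<open>A number shares the tree of its list of binary digits, so conversion between the two
  takes no time and arithmetic becomes list processing.\<close>

definition repr_nat :: "nat \<Rightarrow> val" where "repr_nat n = repr (nat_bits n)"
instance ..
end

lemma repr_Cons [simp]: "repr (x # xs) = Nd (repr x) (repr xs)"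
  and repr_Nil [simp]: "repr [] = Lf"
  and repr_Pair [simp]: "repr (a, b) = Nd (repr a) (repr b)"
  and repr_self [simp]: "repr v = v"
  by (simp_all add: repr_list_def repr_prod_def repr_val_def)

definition esize :: "'a::encodable \<Rightarrow> nat" where
  "esize x = length (code (repr x))"

lemma code_not_Nil [simp]: "code v \<noteq> []"
  by (cases v) auto

lemma esize_simps [simp]:
  "esize (a, b) = Suc (esize a + esize b)" "esize (x # xs) = Suc (esize x + esize xs)"
  "esize [] = 1" "0 < esize x"
  by (simp_all add: esize_def)

lemma esize_fst: "esize (fst p) \<le> esize p" and esize_snd: "esize (snd p) \<le> esize p"
  by (cases p; simp)+

lemma length_le_esize: "length xs \<le> esize xs"
  by (induction xs) auto

lemma esize_mem: "x \<in> set xs \<Longrightarrow> esize x \<le> esize xs"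
  by (induction xs) auto

lemma esize_append: "esize (xs @ ys) + 1 = esize xs + esize ys"
  by (induction xs) auto

lemma esize_drop: "esize (drop n xs) \<le> esize xs"
  using esize_append[of "take n xs" "drop n xs"] esize_simps(4)[of "take n xs"]
  by (simp del: esize_simps(4))

section \<open>Polynomial bounds on a domain of inputs\<close>

lemma poly_nat_mono: "(x::nat) \<le> y \<Longrightarrow> poly p x \<le> poly p y"
  by (induction p) (auto intro!: add_mono mult_mono)

definition pbound :: "'a::encodable set \<Rightarrow> ('a \<Rightarrow> nat) \<Rightarrow> bool" where
  "pbound A f \<longleftrightarrow> (\<exists>p::nat poly. \<forall>x\<in>A. f x \<le> poly p (esize x))"

lemma pbound_mono: "pbound A g \<Longrightarrow> (\<And>x. x \<in> A \<Longrightarrow> f x \<le> g x) \<Longrightarrow> pbound A f"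
  unfolding pbound_def by (meson le_trans)

lemma pbound_subset: "pbound B f \<Longrightarrow> A \<subseteq> B \<Longrightarrow> pbound A f"
  unfolding pbound_def by blast

lemma pbound_const: "pbound A (\<lambda>_. c)"
  unfolding pbound_def by (rule exI[of _ "[:c:]"]) simp

lemma pbound_self: "pbound A esize"
  unfolding pbound_def by (rule exI[of _ "[:0, 1:]"]) simp

lemma pbound_add: "pbound A f \<Longrightarrow> pbound A g \<Longrightarrow> pbound A (\<lambda>x. f x + g x)"
  unfolding pbound_def
proof (elim exE)
  fix p q :: "nat poly"
  assume "\<forall>x\<in>A. f x \<le> poly p (esize x)" "\<forall>x\<in>A. g x \<le> poly q (esize x)"
  then show "\<exists>p::nat poly. \<forall>x\<in>A. f x + g x \<le> poly p (esize x)"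
    by (intro exI[of _ "p + q"]) (auto intro!: add_mono)
qed

lemma pbound_mult: "pbound A f \<Longrightarrow> pbound A g \<Longrightarrow> pbound A (\<lambda>x. f x * g x)"
  unfolding pbound_def
proof (elim exE)
  fix p q :: "nat poly"
  assume "\<forall>x\<in>A. f x \<le> poly p (esize x)" "\<forall>x\<in>A. g x \<le> poly q (esize x)"
  then show "\<exists>p::nat poly. \<forall>x\<in>A. f x * g x \<le> poly p (esize x)"
    by (intro exI[of _ "p * q"]) (auto intro!: mult_mono)
qed

lemma pbound_poly: "pbound A f \<Longrightarrow> pbound A (\<lambda>x. poly p (f x))"
  by (induction p) (auto intro!: pbound_const pbound_add pbound_mult)

lemma pbound_Suc: "pbound A f \<Longrightarrow> pbound A (\<lambda>x. Suc (f x))"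
  using pbound_add[OF pbound_const[of A 1], of f] by simp

lemmas pbound_intros = pbound_add pbound_mult pbound_Suc pbound_const pbound_self

lemma pbound_compose:
  assumes "pbound B g" "\<And>x. x \<in> A \<Longrightarrow> h x \<in> B" "pbound A (\<lambda>x. esize (h x))"
  shows "pbound A (\<lambda>x. g (h x))"
proof -
  obtain p where "\<forall>y\<in>B. g y \<le> poly p (esize y)" using assms(1) by (auto simp: pbound_def)
  then show ?thesis
    using assms(2) by (intro pbound_mono[OF pbound_poly[OF assms(3), of p]]) auto
qed

lemma pbound_fst: "pbound A f \<Longrightarrow> pbound {z. fst z \<in> A \<and> P z} (\<lambda>z. f (fst z))"
  by (rule pbound_compose) (auto intro: pbound_mono[OF pbound_self] esize_fst)

lemma pbound_union: "pbound A f \<Longrightarrow> pbound B f \<Longrightarrow> pbound (A \<union> B) f"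
  unfolding pbound_def
proof (elim exE)
  fix p q :: "nat poly"
  assume "\<forall>x\<in>A. f x \<le> poly p (esize x)" "\<forall>x\<in>B. f x \<le> poly q (esize x)"
  then show "\<exists>p::nat poly. \<forall>x\<in>A \<union> B. f x \<le> poly p (esize x)"
    by (intro exI[of _ "p + q"]) (auto simp: trans_le_add1 trans_le_add2)
qed

text \<open>Everything below the argument and on the other stacks is preserved, which allows
  programs to be chained. Inputs outside \<open>A\<close> are unconstrained; this admits partial
  operations such as \<open>hd\<close> and loop bodies that are applied only to members of a given
  list.\<close>

definition computes ::
  "com \<Rightarrow> 'a::encodable set \<Rightarrow> ('a \<Rightarrow> nat) \<Rightarrow> ('a \<Rightarrow> 'b::encodable) \<Rightarrow> bool" where
  "computes p A t f \<longleftrightarrow> wf_com p \<and> pbound A t \<and>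
     (\<forall>x\<in>A. \<forall>r w b c d. runs p (st (code (repr x) @ r) w b c d) (t x)
        (st (code (repr (f x)) @ r) w b c d))"

definition ptime :: "'a::encodable set \<Rightarrow> ('a \<Rightarrow> 'b::encodable) \<Rightarrow> bool" where
  "ptime A f \<longleftrightarrow> (\<exists>p t. computes p A t f)"

lemma computesD:
  assumes "computes p A t f"
  shows "wf_com p" "pbound A t" "\<And>x r w b c d. x \<in> A \<Longrightarrow>
    runs p (st (code (repr x) @ r) w b c d) (t x) (st (code (repr (f x)) @ r) w b c d)"
  using assms by (auto simp: computes_def)

lemma ptimeI:
  assumes "wf_com p" "pbound A t"
    "\<And>x r w b c d. x \<in> A \<Longrightarrow>
       runs p (st (code (repr x) @ r) w b c d) (t x) (st (code (repr (f x)) @ r) w b c d)"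
  shows "ptime A f"
  using assms unfolding ptime_def computes_def by blast

lemma ptime_subset: "ptime B f \<Longrightarrow> A \<subseteq> B \<Longrightarrow> ptime A f"
  unfolding ptime_def computes_def by (meson pbound_subset subsetD)

lemma ptime_repr_cong:
  "ptime A f \<Longrightarrow> (\<And>x. x \<in> A \<Longrightarrow> repr (g x) = repr (f x)) \<Longrightarrow> ptime A g"
  unfolding ptime_def computes_def by auto

lemma ptime_cong: "ptime A f \<Longrightarrow> (\<And>x. x \<in> A \<Longrightarrow> g x = f x) \<Longrightarrow> ptime A g"
  by (rule ptime_repr_cong) auto

text \<open>In \<open>t x\<close> steps a stack gains at most \<open>t x\<close> symbols. This keeps
  the time of a composition polynomial in the original input.\<close>

lemma ptime_esize: assumes "ptime A f" shows "pbound A (\<lambda>x. esize (f x))"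
proof -
  obtain p t where "computes p A t f" using assms by (auto simp: ptime_def)
  note pt = computesD(2,3)[OF this]
  have "esize (f x) \<le> esize x + t x" if x: "x \<in> A" for x
  proof -
    obtain n where "n \<le> t x"
      "exec p (st (code (repr x) @ []) [] [] [] []) n (st (code (repr (f x)) @ []) [] [] [] [])"
      using pt(2)[OF x, of "[]" "[]" "[]" "[]" "[]"] by (auto simp: runs_def)
    then show ?thesis using exec_length[of p _ n _ 0] by (fastforce simp: esize_def)
  qed
  then show ?thesis by (rule pbound_mono[OF pbound_add[OF pbound_self pt(1)]])
qed

section \<open>Closure properties of polynomial time\<close>

lemma ptime_id: "ptime A (\<lambda>x. x)"
  by (rule ptimeI[of Skip _ "\<lambda>_. 0"]) (auto intro: pbound_const runs_basic)

lemma ptime_compose: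
  assumes "ptime A f" "ptime B g" "\<And>x. x \<in> A \<Longrightarrow> f x \<in> B"
  shows "ptime A (\<lambda>x. g (f x))"
proof -
  obtain p t where "computes p (A) t f"
    using assms(1) by (auto simp: ptime_def)
  note p = computesD[OF this]
  obtain q u where "computes q (B) u g"
    using assms(2) by (auto simp: ptime_def)
  note q = computesD[OF this]
  show ?thesis
  proof (rule ptimeI)
    show "wf_com (p ;; q)" using p q by simp
    show "pbound A (\<lambda>x. t x + u (f x))"
      by (intro pbound_add p(2) pbound_compose[OF q(2) assms(3)] ptime_esize[OF assms(1)])
    show "runs (p ;; q) (st (code (repr x) @ r) w b c d) (t x + u (f x))
        (st (code (repr (g (f x))) @ r) w b c d)" if "x \<in> A" for x r w b c d
      using that assms(3) by (intro runs_Seq[OF p(3) q(3)])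
  qed
qed

lemma ptime_compose_UNIV: "ptime UNIV g \<Longrightarrow> ptime A f \<Longrightarrow> ptime A (\<lambda>x. g (f x))"
  by (rule ptime_compose) auto

lemma ptime_Pair:
  assumes "ptime A f" "ptime A g"
  shows "ptime A (\<lambda>x. (f x, g x))"
proof -
  obtain p t where "computes p (A) t f"
    using assms(1) by (auto simp: ptime_def)
  note p = computesD[OF this]
  obtain q u where "computes q (A) u g"
    using assms(2) by (auto simp: ptime_def)
  note q = computesD[OF this]
  \<comment> \<open>The input is duplicated first; \<open>p\<close> and \<open>q\<close> consume one
    copy each, and the final \<open>Push 0 2\<close> joins the adjacent codes under a node.\<close>
  let ?T = "\<lambda>x. 26 * esize x + 18 + (t x + (24 * (esize (f x) + esize x) + 28 +
    (u x + (24 * (esize (g x) + esize (f x)) + 28 + 2))))"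
  show ?thesis
  proof (rule ptimeI)
    show "wf_com (dup ;; p ;; swap ;; q ;; swap ;; Push 0 2)" using p q by simp
    show "pbound A ?T"
      by (intro pbound_intros p(2) q(2) ptime_esize[OF assms(1)] ptime_esize[OF assms(2)])
    show "runs (dup ;; p ;; swap ;; q ;; swap ;; Push 0 2) (st (code (repr x) @ r) w b c d) (?T x)
      (st (code (repr (f x, g x)) @ r) w b c d)" if "x \<in> A" for x r w b c d
      using that unfolding esize_def repr_Pair code.simps append_Cons append_assoc
      by (intro runs_Seq[OF runs_dup runs_Seq[OF p(3) runs_Seq[OF runs_swap
            runs_Seq[OF q(3) runs_Seq[OF runs_swap runs_basic(2)]]]]])
  qed
qed

lemma ptime_vcar: "ptime A f \<Longrightarrow> ptime A (\<lambda>x. vcar (repr (f x)))"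
proof (rule ptime_compose[of A f UNIV "\<lambda>y. vcar (repr y)"])
  show "ptime UNIV (\<lambda>y::'b. vcar (repr y))"
    by (rule ptimeI[of car _ "\<lambda>y. 26 * esize y + 30"], simp, intro pbound_intros)
       (simp add: esize_def runs_car)
qed auto

lemma ptime_vcdr: "ptime A f \<Longrightarrow> ptime A (\<lambda>x. vcdr (repr (f x)))"
proof (rule ptime_compose[of A f UNIV "\<lambda>y. vcdr (repr y)"])
  show "ptime UNIV (\<lambda>y::'b. vcdr (repr y))"
    by (rule ptimeI[of cdr _ "\<lambda>y. 12 * esize y + 30"], simp, intro pbound_intros)
       (simp add: esize_def runs_cdr)
qed auto

lemma ptime_fst: "ptime A f \<Longrightarrow> ptime A (\<lambda>x. fst (f x))"
  by (erule ptime_vcar[THEN ptime_repr_cong]) (simp add: repr_prod_def)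

lemma ptime_snd: "ptime A f \<Longrightarrow> ptime A (\<lambda>x. snd (f x))"
  by (erule ptime_vcdr[THEN ptime_repr_cong]) (simp add: repr_prod_def)

lemma ptime_case_prod:
  "ptime A (\<lambda>x. h x (fst (f x)) (snd (f x))) \<Longrightarrow> ptime A (\<lambda>x. case f x of (a, b) \<Rightarrow> h x a b)"
  by (simp add: case_prod_unfold)

lemma ptime_Cons: "ptime A f \<Longrightarrow> ptime A g \<Longrightarrow> ptime A (\<lambda>x. f x # g x)"
  by (rule ptime_repr_cong[OF ptime_Pair]) auto

lemma ptime_tl: "ptime A f \<Longrightarrow> ptime A (\<lambda>x. tl (f x))"
proof (erule ptime_vcdr[THEN ptime_repr_cong])
  fix x show "repr (tl (f x)) = repr (vcdr (repr (f x)))" by (cases "f x") auto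
qed

lemma ptime_hd: "ptime A f \<Longrightarrow> (\<And>x. x \<in> A \<Longrightarrow> f x \<noteq> []) \<Longrightarrow> ptime A (\<lambda>x. hd (f x))"
proof (erule ptime_vcar[THEN ptime_repr_cong])
  fix x assume "x \<in> A" "\<And>x. x \<in> A \<Longrightarrow> f x \<noteq> []"
  then show "repr (hd (f x)) = repr (vcar (repr (f x)))" by (cases "f x") auto
qed

lemma ptime_const: "ptime A (\<lambda>_. c)"
proof -
  have "ptime A (\<lambda>_. v :: val)" for v
  proof (induction v)
    case Lf
    show ?case
    proof (rule ptimeI)
      show "wf_com (discard ;; Push 0 1)" by simp
      show "pbound A (\<lambda>x. 12 * esize x + 10 + 2)" by (intro pbound_intros)
    qed (unfold esize_def repr_self code.simps append_Cons append_Nil, (rule runs_Seq runs_discard runs_basic)+)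
  next
    case (Nd u v)
    show ?case by (rule ptime_repr_cong[OF ptime_Pair[OF Nd.IH]]) simp
  qed
  then show ?thesis by (rule ptime_repr_cong[of _ "\<lambda>_. repr c"]) simp
qed

lemma code_repr_bool: "code (repr b) = (if b then [2, 1, 1] else [1])"
  by (simp add: repr_bool_def)

text \<open>The separate domains serve branches such as \<open>hd\<close>, which are meaningful only
  after the test.\<close>

lemma ptime_If_dom:
  assumes "ptime A B" "ptime {x \<in> A. B x} f" "ptime {x \<in> A. \<not> B x} g"
  shows "ptime A (\<lambda>x. if B x then f x else g x)"
proof -
  obtain p t where "computes p (A) t B"
    using assms(1) by (auto simp: ptime_def)
  note p = computesD[OF this]
  obtain q u where "computes q ({x \<in> A. B x}) u f"
    using assms(2) by (auto simp: ptime_def)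
  note q = computesD[OF this]
  obtain q' u' where "computes q' ({x \<in> A. \<not> B x}) u' g"
    using assms(3) by (auto simp: ptime_def)
  note q' = computesD[OF this]
  let ?U = "\<lambda>x. if B x then u x else u' x"
  \<comment> \<open>The summand \<open>12 * 3 + 10\<close> pays for discarding the truth value,
    whose code has at most 3 symbols.\<close>
  let ?T = "\<lambda>x. 26 * esize x + 18 + (t x + (12 * 3 + 10 + ?U x + 2))"
  have U: "pbound A ?U"
  proof -
    have "pbound {x \<in> A. B x} ?U" "pbound {x \<in> A. \<not> B x} ?U"
      by (rule pbound_mono[OF q(2)], simp) (rule pbound_mono[OF q'(2)], simp)
    from pbound_union[OF this] show ?thesis by (rule pbound_subset) auto
  qed
  show ?thesis
  proof (rule ptimeI)
    let ?c = "dup ;; p ;; Cond 0 (\<lambda>x. x = 2) (discard ;; q) (discard ;; q')"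
    show "wf_com ?c" using p q q' by simp
    show "pbound A ?T" by (intro pbound_intros p(2) U)
    show "runs ?c (st (code (repr x) @ r) w b c d) (?T x)
      (st (code (repr (if B x then f x else g x)) @ r) w b c d)" if "x \<in> A" for x r w b c d
    proof -
      have *: "runs (Cond 0 (\<lambda>x. x = 2) (discard ;; q) (discard ;; q'))
          (st (code (repr (B x)) @ code (repr x) @ r) w b c d) (12 * 3 + 10 + ?U x + 2)
          (st (code (repr (if B x then f x else g x)) @ r) w b c d)"
      proof (cases "B x")
        case True
        have "runs (discard ;; q) (st (code (repr True) @ code (repr x) @ r) w b c d)
            (12 * length (code (repr True)) + 10 + u x) (st (code (repr (f x)) @ r) w b c d)"
          using True that by (intro runs_Seq[OF runs_discard q(3)]) auto
        then have "runs (Cond 0 (\<lambda>x. x = 2) (discard ;; q) (discard ;; q'))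
            (st (code (repr True) @ code (repr x) @ r) w b c d)
            (12 * length (code (repr True)) + 10 + u x + 2) (st (code (repr (f x)) @ r) w b c d)"
          by (rule runs_CondT[rotated]) (simp add: code_repr_bool)
        with True show ?thesis by (simp add: code_repr_bool[of True])
      next
        case False
        have "runs (discard ;; q') (st (code (repr False) @ code (repr x) @ r) w b c d)
            (12 * length (code (repr False)) + 10 + u' x) (st (code (repr (g x)) @ r) w b c d)"
          using False that by (intro runs_Seq[OF runs_discard q'(3)]) auto
        then have "runs (Cond 0 (\<lambda>x. x = 2) (discard ;; q) (discard ;; q'))
            (st (code (repr False) @ code (repr x) @ r) w b c d)
            (12 * length (code (repr False)) + 10 + u' x + 2) (st (code (repr (g x)) @ r) w b c d)"
          by (rule runs_CondF[rotated]) (simp add: code_repr_bool)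
        with False show ?thesis by (auto simp: code_repr_bool[of False] elim: runs_mono)
      qed
      show ?thesis
        unfolding esize_def by (rule runs_Seq[OF runs_dup runs_Seq[OF p(3)[OF that] *]])
    qed
  qed
qed

lemma ptime_If:
  assumes "ptime A B" "ptime A f" "ptime A g"
  shows "ptime A (\<lambda>x. if B x then f x else g x)"
  by (rule ptime_If_dom[OF assms(1) ptime_subset[OF assms(2)] ptime_subset[OF assms(3)]]) auto

lemma ptime_not_Lf: "ptime A f \<Longrightarrow> ptime A (\<lambda>x. repr (f x) \<noteq> Lf)"
proof (rule ptime_compose[of A f UNIV "\<lambda>y. repr y \<noteq> Lf"])
  let ?c = "Cond 0 (\<lambda>x. x = 2) (discard ;; Push 0 1 ;; Push 0 1 ;; Push 0 2) Skip"
  show "ptime UNIV (\<lambda>y::'b. repr y \<noteq> Lf)"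
  proof (rule ptimeI)
    show "wf_com ?c" by simp
    show "pbound UNIV (\<lambda>y::'b. 12 * esize y + 10 + (2 + (2 + 2)) + 2)" by (intro pbound_intros)
    show "runs ?c (st (code (repr y) @ r) w b c d) (12 * esize y + 10 + (2 + (2 + 2)) + 2)
        (st (code (repr (repr y \<noteq> Lf)) @ r) w b c d)" for y :: 'b and r w b c d
    proof (cases "repr y")
      case Lf
      have "runs ?c (st (1 # r) w b c d) (0 + 2) (st (1 # r) w b c d)"
        by (rule runs_CondF, simp) (rule runs_basic)
      from runs_mono[OF this, of "12 * esize y + 10 + (2 + (2 + 2)) + 2"] Lf show ?thesis
        by (simp add: code_repr_bool)
    next
      case (Nd u v)
      have "runs (discard ;; Push 0 1 ;; Push 0 1 ;; Push 0 2) (st (code (repr y) @ r) w b c d)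
          (12 * length (code (repr y)) + 10 + (2 + (2 + 2))) (st (2 # 1 # 1 # r) w b c d)"
        by (rule runs_Seq runs_discard runs_basic)+
      then have "runs ?c (st (code (repr y) @ r) w b c d)
          (12 * length (code (repr y)) + 10 + (2 + (2 + 2)) + 2) (st (2 # 1 # 1 # r) w b c d)"
        by (rule runs_CondT[rotated]) (simp add: Nd)
      with Nd show ?thesis by (simp add: code_repr_bool esize_def)
    qed
  qed
qed auto

lemma ptime_Not: "ptime A B \<Longrightarrow> ptime A (\<lambda>x. \<not> B x)"
  by (rule ptime_cong[OF ptime_If[OF _ ptime_const[of _ False] ptime_const[of _ True]]]) auto

lemma ptime_conj: "ptime A B \<Longrightarrow> ptime A C \<Longrightarrow> ptime A (\<lambda>x. B x \<and> C x)"
  by (rule ptime_cong[OF ptime_If[of A B C "\<lambda>_. False"]]) (auto intro: ptime_const)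

lemma ptime_disj: "ptime A B \<Longrightarrow> ptime A C \<Longrightarrow> ptime A (\<lambda>x. B x \<or> C x)"
  by (rule ptime_cong[OF ptime_If[of A B "\<lambda>_. True" C]]) (auto intro: ptime_const)

lemma ptime_iff: "ptime A B \<Longrightarrow> ptime A C \<Longrightarrow> ptime A (\<lambda>x. B x = C x)" for B C :: "_ \<Rightarrow> bool"
  by (rule ptime_cong[OF ptime_If[of A B C "\<lambda>x. \<not> C x"]]) (auto intro: ptime_Not)

lemma ptime_not_Nil: "ptime A f \<Longrightarrow> ptime A (\<lambda>x. f x \<noteq> [])"
proof (erule ptime_not_Lf[THEN ptime_cong])
  fix x show "(f x \<noteq> []) = (repr (f x) \<noteq> Lf)" by (cases "f x") auto
qed

lemma ptime_is_Nil: "ptime A f \<Longrightarrow> ptime A (\<lambda>x. f x = [])"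
  by (rule ptime_cong[OF ptime_Not[OF ptime_not_Nil]]) auto

text \<open>The functions \<open>n\<close> and \<open>s\<close> are only bounded, never computed.
  The bound \<open>s\<close> on all intermediate states is essential: a polynomial-time body may
  double its argument in every round.\<close>

lemma ptime_while:
  assumes B: "ptime B B'" and g: "ptime {x \<in> B. B' x} g"
    and n: "pbound A n" and s: "pbound A s"
    and inv: "\<And>x m. x \<in> A \<Longrightarrow> m \<le> n x \<Longrightarrow> (g ^^ m) x \<in> B \<and> esize ((g ^^ m) x) \<le> s x"
    and test: "\<And>x m. x \<in> A \<Longrightarrow> m \<le> n x \<Longrightarrow> B' ((g ^^ m) x) \<longleftrightarrow> m < n x"
  shows "ptime A (\<lambda>x. (g ^^ n x) x)"
proof -
  obtain p t where "computes p (B) t B'"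
    using B by (auto simp: ptime_def)
  note p = computesD[OF this]
  obtain q u where "computes q ({x \<in> B. B' x}) u g"
    using g by (auto simp: ptime_def)
  note q = computesD[OF this]
  obtain P where P: "\<And>x. x \<in> B \<Longrightarrow> t x \<le> poly P (esize x)" using p(2) by (auto simp: pbound_def)
  obtain Q where Q: "\<And>x. x \<in> B \<Longrightarrow> B' x \<Longrightarrow> u x \<le> poly Q (esize x)" using q(2) by (auto simp: pbound_def)
  let ?D = "\<lambda>x. 26 * s x + 18 + poly P (s x)"
  let ?L = "\<lambda>x. 12 * 3 + 10 + (poly Q (s x) + ?D x) + 2"
  \<comment> \<open>The truth value of the test lies on top of the state, so that one symbol decides
    whether the loop continues.\<close>
  let ?l = "Loop 0 (\<lambda>x. x = 2) (discard ;; q ;; dup ;; p)"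
  have dup_p: "runs (dup ;; p) (st (code (repr y) @ r) w b c d) (?D x)
      (st (code (repr (B' y)) @ code (repr y) @ r) w b c d)"
    if "x \<in> A" "y \<in> B" "esize y \<le> s x" for x y r w b c d
  proof (rule runs_mono[OF runs_Seq[OF runs_dup p(3)[OF that(2)]]])
    show "26 * length (code (repr y)) + 18 + t y \<le> ?D x"
      using that(3) P[OF that(2)] poly_nat_mono[OF that(3), of P] by (simp add: esize_def)
  qed
  have loop: "runs ?l (st (code (repr (B' ((g ^^ m) x))) @ code (repr ((g ^^ m) x)) @ r) w b c d)
      ((n x - m) * ?L x + 1) (st (code (repr False) @ code (repr ((g ^^ n x) x)) @ r) w b c d)"
    if x: "x \<in> A" and "m \<le> n x" for x m r w b c d
    using that(2)
  proof (induction m rule: inc_induct)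
    case base
    have "\<not> B' ((g ^^ n x) x)" using test[OF x, of "n x"] by simp
    then show ?case
      using runs_LoopF[of "\<lambda>x. x = 2" "st (code (repr False) @ code (repr ((g ^^ n x) x)) @ r) w b c d" 0]
      by (simp add: code_repr_bool)
  next
    case (step m)
    let ?y = "(g ^^ m) x" and ?z = "(g ^^ Suc m) x"
    have y: "?y \<in> B" "esize ?y \<le> s x" "B' ?y" "?z \<in> B" "esize ?z \<le> s x"
      using inv[OF x, of m] inv[OF x, of "Suc m"] test[OF x, of m] step.hyps by auto
    have "u ?y \<le> poly Q (s x)" using Q[OF y(1,3)] poly_nat_mono[OF y(2), of Q] by simp
    then have q': "runs q (st (code (repr ?y) @ r) w b c d) (poly Q (s x)) (st (code (repr ?z) @ r) w b c d)"
      using runs_mono[OF q(3)[of ?y r w b c d]] y by simp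
    have body: "runs (discard ;; q ;; dup ;; p) (st (code (repr (B' ?y)) @ code (repr ?y) @ r) w b c d)
       (12 * length (code (repr (B' ?y))) + 10 + (poly Q (s x) + ?D x))
       (st (code (repr (B' ?z)) @ code (repr ?z) @ r) w b c d)"
      by (intro runs_Seq[OF runs_discard runs_Seq[OF q' dup_p]] x y)
    have "runs ?l (st (code (repr (B' ?y)) @ code (repr ?y) @ r) w b c d)
       (12 * length (code (repr (B' ?y))) + 10 + (poly Q (s x) + ?D x) +
          ((n x - Suc m) * ?L x + 1) + 2)
       (st (code (repr False) @ code (repr ((g ^^ n x) x)) @ r) w b c d)"
      by (rule runs_LoopT[OF _ body step.IH]) (use y(3) in \<open>simp add: code_repr_bool\<close>)
    moreover obtain k where "n x - m = Suc k" "n x - Suc m = k"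
      using step.hyps by (metis Suc_diff_Suc)
    ultimately show ?case using y(3) by (simp add: code_repr_bool[of True] algebra_simps)
  qed
  let ?T = "\<lambda>x. ?D x + (n x * ?L x + 1 + (12 * 1 + 10))"
  show ?thesis
  proof (rule ptimeI)
    show "wf_com ((dup ;; p) ;; ?l ;; discard)" using p q by simp
    show "pbound A ?T" by (intro pbound_intros n s pbound_poly)
    show "runs ((dup ;; p) ;; ?l ;; discard) (st (code (repr x) @ r) w b c d) (?T x)
      (st (code (repr ((g ^^ n x) x)) @ r) w b c d)" if x: "x \<in> A" for x r w b c d
    proof -
      have 1: "runs (dup ;; p) (st (code (repr x) @ r) w b c d) (?D x)
          (st (code (repr (B' x)) @ code (repr x) @ r) w b c d)"
        using inv[OF x, of 0] by (intro dup_p x) auto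
      have 2: "runs ?l (st (code (repr (B' x)) @ code (repr x) @ r) w b c d)
          (n x * ?L x + 1) (st (code (repr False) @ code (repr ((g ^^ n x) x)) @ r) w b c d)"
        using loop[OF x, of 0 r w b c d] by simp
      have 3: "runs discard (st (code (repr False) @ code (repr ((g ^^ n x) x)) @ r) w b c d)
          (12 * 1 + 10) (st (code (repr ((g ^^ n x) x)) @ r) w b c d)"
        using runs_discard[of "repr False" "code (repr ((g ^^ n x) x)) @ r" w b c d]
        by (simp add: code_repr_bool)
      show ?thesis by (rule runs_Seq[OF 1 runs_Seq[OF 2 3]])
    qed
  qed
qed

lemma ptime_comp_dom:
  assumes "ptime A f" "ptime B g" "\<And>x. x \<in> A \<Longrightarrow> f x \<in> B" "\<And>x. x \<in> A \<Longrightarrow> h x = g (f x)"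
  shows "ptime A h"
  by (rule ptime_cong[OF ptime_compose[OF assms(1-3)] assms(4)])

lemma ptime_foldl:
  fixes l :: "'a::encodable \<Rightarrow> 'b::encodable list" and a :: "'a \<Rightarrow> 'c::encodable"
  assumes l: "ptime A l" and a: "ptime A a"
    and h: "ptime {z. fst z \<in> A \<and> snd (snd z) \<in> set (l (fst z))}
      (\<lambda>z. h (fst z) (fst (snd z)) (snd (snd z)))"
    and s: "pbound A s" "\<And>x n. x \<in> A \<Longrightarrow> n \<le> length (l x) \<Longrightarrow>
      esize (foldl (h x) (a x) (take n (l x))) \<le> s x"
  shows "ptime A (\<lambda>x. foldl (h x) (a x) (l x))"
proof -
  \<comment> \<open>The loop state consists of the input, the accumulator and the unread part of the
    list. The input is carried along because \<open>h\<close> may depend on it, and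
    \<open>?B\<close> records that unread entries belong to the list.\<close>
  let ?B = "{z. fst z \<in> A \<and> set (snd (snd z)) \<subseteq> set (l (fst z))}"
  let ?t = "\<lambda>z. snd (snd z) \<noteq> ([] :: 'b list)"
  let ?g = "\<lambda>z. (fst z, h (fst z) (fst (snd z)) (hd (snd (snd z))), tl (snd (snd z)))"
  let ?A = "{z. fst z \<in> A \<and> snd z = (a (fst z), l (fst z))}"
  have iter: "(?g ^^ m) (x, a x, l x) = (x, foldl (h x) (a x) (take m (l x)), drop m (l x))"
    if "m \<le> length (l x)" for m x
    using that
  proof (induction m)
    case (Suc m)
    then show ?case by (simp add: take_Suc_conv_app_nth hd_drop_conv_nth drop_Suc tl_drop)
  qed simp
  have t: "ptime ?B ?t" by (intro ptime_not_Nil ptime_snd ptime_id)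
  have "ptime {z \<in> ?B. ?t z} (\<lambda>z. h (fst z) (fst (snd z)) (hd (snd (snd z))))"
    by (rule ptime_comp_dom[where f = "\<lambda>z. (fst z, fst (snd z), hd (snd (snd z)))", OF _ h])
       (auto intro!: ptime_Pair ptime_fst ptime_snd ptime_hd ptime_id)
  then have g: "ptime {z \<in> ?B. ?t z} ?g"
    by (intro ptime_Pair ptime_fst ptime_tl ptime_snd ptime_id)
  have "ptime ?A (\<lambda>z. (?g ^^ length (snd (snd z))) z)"
  proof (rule ptime_while[OF t g])
    show "pbound ?A (\<lambda>z. length (snd (snd z)))"
    proof (rule pbound_mono[OF pbound_self])
      fix z :: "'a \<times> 'c \<times> 'b list"
      show "length (snd (snd z)) \<le> esize z"
        using length_le_esize[of "snd (snd z)"] esize_snd[of z] esize_snd[of "snd z"] by linarith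
    qed
    show "pbound ?A (\<lambda>z. Suc (esize z + (Suc (s (fst z) + esize z))))"
      by (intro pbound_add pbound_Suc pbound_self pbound_fst[OF s(1)])
  next
    fix z m assume z: "z \<in> ?A" "m \<le> length (snd (snd z))"
    obtain x where x: "z = (x, a x, l x)" "x \<in> A" using z by (cases z) auto
    then have m: "m \<le> length (l x)" using z by simp
    show "?t ((?g ^^ m) z) \<longleftrightarrow> m < length (snd (snd z))"
      using iter[OF m] x m by auto
    have "esize (drop m (l x)) \<le> esize (l x)" by (rule esize_drop)
    then show "(?g ^^ m) z \<in> ?B \<and> esize ((?g ^^ m) z) \<le> Suc (esize z + (Suc (s (fst z) + esize z)))"
      using iter[OF m] x s(2)[OF x(2) m] set_drop_subset[of m "l x"] by simp
  qed
  then have "ptime ?A (\<lambda>z. fst (snd ((?g ^^ length (snd (snd z))) z)))"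
    by (intro ptime_fst ptime_snd)
  then show ?thesis
    by (rule ptime_comp_dom[where f = "\<lambda>x. (x, a x, l x)", rotated])
       (auto intro!: ptime_Pair ptime_id l a simp: iter)
qed

text \<open>Accumulators that grow by a polynomially bounded amount in each step, in a measure that is
  linearly related to the size, need no further bound.\<close>

lemma ptime_foldl_measure:
  fixes l :: "'a::encodable \<Rightarrow> 'b::encodable list" and a :: "'a \<Rightarrow> 'c::encodable"
  assumes l: "ptime A l" and a: "ptime A a"
    and h: "ptime {z. fst z \<in> A \<and> snd (snd z) \<in> set (l (fst z))}
      (\<lambda>z. h (fst z) (fst (snd z)) (snd (snd z)))"
    and k: "pbound A k" "\<And>x acc y. x \<in> A \<Longrightarrow> y \<in> set (l x) \<Longrightarrow> \<mu> (h x acc y) \<le> \<mu> acc + k x"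
    and \<mu>: "\<And>acc. \<mu> acc \<le> esize acc" "\<And>acc. esize acc \<le> C * \<mu> acc + C"
  shows "ptime A (\<lambda>x. foldl (h x) (a x) (l x))"
proof (rule ptime_foldl[OF l a h])
  show "pbound A (\<lambda>x. C * (esize (a x) + esize (l x) * k x) + C)"
    by (intro pbound_add pbound_mult pbound_const ptime_esize l a k)
  fix x n assume x: "x \<in> A" "n \<le> length (l x)"
  have "\<mu> (foldl (h x) (a x) ys) \<le> \<mu> (a x) + length ys * k x" if "set ys \<subseteq> set (l x)" for ys
    using that
  proof (induction ys rule: rev_induct)
    case (snoc y ys)
    then show ?case using k(2)[OF x(1), of y "foldl (h x) (a x) ys"] by simp
  qed simp
  from this[of "take n (l x)"] have "\<mu> (foldl (h x) (a x) (take n (l x))) \<le> \<mu> (a x) + n * k x"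
    using x(2) set_take_subset[of n "l x"] by simp
  also have "\<mu> (a x) + n * k x \<le> esize (a x) + esize (l x) * k x"
    using x(2) length_le_esize[of "l x"] \<mu>(1)[of "a x"] by (intro add_mono mult_right_mono) auto
  finally have "C * \<mu> (foldl (h x) (a x) (take n (l x))) \<le> C * (esize (a x) + esize (l x) * k x)"
    by (rule mult_left_mono) simp
  then show "esize (foldl (h x) (a x) (take n (l x))) \<le> C * (esize (a x) + esize (l x) * k x) + C"
    using \<mu>(2)[of "foldl (h x) (a x) (take n (l x))"] by linarith
qed

lemmas ptime_foldl_additive = ptime_foldl_measure[where \<mu> = esize and C = 1, simplified]

lemma foldl_Cons: "foldl (\<lambda>acc y. f y # acc) ys xs = rev (map f xs) @ ys"
  by (induction xs arbitrary: ys) auto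

text \<open>A member is no larger than its list, so a bound in terms of input and member becomes a
  bound in the input alone.\<close>

lemma pbound_member:
  assumes "ptime A l" "pbound {z. fst z \<in> A \<and> snd z \<in> set (l (fst z))} f"
  obtains k where "pbound A k" "\<And>x y. x \<in> A \<Longrightarrow> y \<in> set (l x) \<Longrightarrow> f (x, y) \<le> k x"
proof -
  obtain p where p: "\<forall>z\<in>{z. fst z \<in> A \<and> snd z \<in> set (l (fst z))}. f z \<le> poly p (esize z)"
    using assms(2) unfolding pbound_def by blast
  show thesis
  proof (rule that)
    show "pbound A (\<lambda>x. poly p (Suc (esize x + esize (l x))))"
      by (intro pbound_poly pbound_Suc pbound_add pbound_self ptime_esize assms)
    fix x y assume "x \<in> A" "y \<in> set (l x)"
    then show "f (x, y) \<le> poly p (Suc (esize x + esize (l x)))"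
      using bspec[OF p, of "(x, y)"] esize_mem[of y "l x"]
        poly_nat_mono[of "esize (x, y)" "Suc (esize x + esize (l x))" p] by simp
  qed
qed

text \<open>Pushing results onto an accumulator reverses the list; reversal, concatenation and
  \<open>map\<close> are all obtained from this form.\<close>

lemma ptime_rev_map:
  fixes h :: "'a::encodable \<Rightarrow> 'b::encodable \<Rightarrow> 'c::encodable"
  assumes "ptime A l" "ptime {z. fst z \<in> A \<and> snd z \<in> set (l (fst z))} (\<lambda>z. h (fst z) (snd z))"
    "ptime A g"
  shows "ptime A (\<lambda>x. rev (map (h x) (l x)) @ g x)"
proof -
  obtain k where k: "pbound A k" "\<And>x y. x \<in> A \<Longrightarrow> y \<in> set (l x) \<Longrightarrow> esize (h x y) \<le> k x"
    using pbound_member[OF assms(1) ptime_esize[OF assms(2)]] by auto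
  have "ptime {z. fst z \<in> A \<and> snd (snd z) \<in> set (l (fst z))} (\<lambda>z. h (fst z) (snd (snd z)))"
    by (rule ptime_comp_dom[where f = "\<lambda>z. (fst z, snd (snd z))", OF _ assms(2)])
       (auto intro!: ptime_Pair ptime_fst ptime_snd ptime_id)
  note h = this
  have "ptime A (\<lambda>x. foldl (\<lambda>acc y. h x y # acc) (g x) (l x))"
  proof (rule ptime_foldl_additive[where k = "\<lambda>x. Suc (k x)"])
    fix x acc y assume "x \<in> A" "y \<in> set (l x)"
    then show "esize (h x y # acc) \<le> esize acc + Suc (k x)" using k(2)[of x y] by simp
  qed (intro assms ptime_Cons h ptime_fst ptime_snd ptime_id pbound_Suc k(1))+
  then show ?thesis by (simp add: foldl_Cons)
qed

lemma ptime_rev: "ptime A l \<Longrightarrow> ptime A (\<lambda>x. rev (l x))"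
  using ptime_rev_map[of A l "\<lambda>x y. y" "\<lambda>x. []"] by (simp add: ptime_const ptime_snd ptime_id)

lemma ptime_append: "ptime A l \<Longrightarrow> ptime A g \<Longrightarrow> ptime A (\<lambda>x. l x @ g x)"
  using ptime_rev_map[of A "\<lambda>x. rev (l x)" "\<lambda>x y. y" g] by (simp add: ptime_rev ptime_snd ptime_id)

lemma ptime_map:
  assumes "ptime A l" "ptime {z. fst z \<in> A \<and> snd z \<in> set (l (fst z))} (\<lambda>z. h (fst z) (snd z))"
  shows "ptime A (\<lambda>x. map (h x) (l x))"
  using ptime_rev[OF ptime_rev_map[OF assms ptime_const[of A "[]"]]] by simp

lemma ptime_concat:
  assumes l: "ptime A l"
  shows "ptime A (\<lambda>x. concat (l x))"
proof -
  have "ptime A (\<lambda>x. foldl (\<lambda>acc y. y @ acc) [] (rev (l x)))"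
  proof (rule ptime_foldl_additive[where k = "\<lambda>x. esize (l x)"])
    fix x acc y assume "y \<in> set (rev (l x))"
    then show "esize (y @ acc) \<le> esize acc + esize (l x)"
      using esize_append[of y acc] esize_mem[of y "l x"] by simp
  qed (intro ptime_rev l ptime_const ptime_append ptime_fst ptime_snd ptime_id ptime_esize)+
  moreover have "foldl (\<lambda>acc y. y @ acc) ys (rev xs) = concat xs @ ys" for xs :: "'b list list" and ys
    by (induction xs arbitrary: ys) auto
  ultimately show ?thesis by simp
qed

lemma ptime_filter:
  assumes l: "ptime A l" and P: "ptime {z. fst z \<in> A \<and> snd z \<in> set (l (fst z))} (\<lambda>z. P (fst z) (snd z))"
  shows "ptime A (\<lambda>x. filter (P x) (l x))"
proof -
  have "ptime A (\<lambda>x. concat (map (\<lambda>y. if P x y then [y] else []) (l x)))"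
    by (intro ptime_concat ptime_map l ptime_If P ptime_Cons ptime_snd ptime_id ptime_const)
  moreover have "concat (map (\<lambda>y. if P x y then [y] else []) ys) = filter (P x) ys" for x ys
    by (induction ys) auto
  ultimately show ?thesis by simp
qed

lemma ptime_ball:
  assumes l: "ptime A l" and P: "ptime {z. fst z \<in> A \<and> snd z \<in> set (l (fst z))} (\<lambda>z. P (fst z) (snd z))"
  shows "ptime A (\<lambda>x. \<forall>y\<in>set (l x). P x y)"
  by (rule ptime_cong[OF ptime_is_Nil[OF ptime_filter[OF l ptime_Not[OF P]]]])
     (auto simp: filter_empty_conv)

lemma ptime_bex:
  assumes l: "ptime A l" and P: "ptime {z. fst z \<in> A \<and> snd z \<in> set (l (fst z))} (\<lambda>z. P (fst z) (snd z))"
  shows "ptime A (\<lambda>x. \<exists>y\<in>set (l x). P x y)"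
  using ptime_Not[OF ptime_ball[OF l ptime_Not[OF P]]] by simp

lemma ptime_list_case:
  assumes l: "ptime A l" and f: "ptime A f"
    and g: "ptime {z. fst z \<in> A} (\<lambda>z. g (fst z) (fst (snd z)) (snd (snd z)))"
  shows "ptime A (\<lambda>x. case l x of [] \<Rightarrow> f x | y # ys \<Rightarrow> g x y ys)"
proof -
  have "ptime {x \<in> A. \<not> l x = []} (\<lambda>x. g x (hd (l x)) (tl (l x)))"
    by (rule ptime_comp_dom[where f = "\<lambda>x. (x, hd (l x), tl (l x))", OF _ g])
       (auto intro!: ptime_Pair ptime_hd ptime_tl ptime_id ptime_subset[OF l])
  from ptime_If_dom[OF ptime_is_Nil[OF l] ptime_subset[OF f] this] show ?thesis
    by (rule ptime_cong) (auto split: list.splits)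
qed

section \<open>Binary arithmetic in polynomial time\<close>

lemma repr_nat_bits: "repr (n::nat) = repr (nat_bits n)"
  by (simp add: repr_nat_def)

lemma ptime_nat_bits: "ptime A f \<Longrightarrow> ptime A (\<lambda>x. nat_bits (f x))"
  by (erule ptime_repr_cong) (simp add: repr_nat_bits)

lemma nat_bits_eq_Nil [simp]: "nat_bits n = [] \<longleftrightarrow> n = 0"
  by (simp add: nat_bits.simps[of n])

lemma nat_bits_0 [simp]: "nat_bits 0 = []"
  by simp

lemma ptime_eq_0: "ptime A f \<Longrightarrow> ptime A (\<lambda>x. f x = (0::nat))"
  by (rule ptime_cong[OF ptime_is_Nil[OF ptime_nat_bits]]) auto

lemma ptime_odd: assumes "ptime A f" shows "ptime A (\<lambda>x. odd (f x :: nat))"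
proof (rule ptime_cong)
  show "ptime A (\<lambda>x. case nat_bits (f x) of [] \<Rightarrow> False | b # bs \<Rightarrow> b)"
    by (intro ptime_list_case ptime_nat_bits assms ptime_const ptime_fst ptime_snd ptime_id)
  fix x show "odd (f x) = (case nat_bits (f x) of [] \<Rightarrow> False | b # bs \<Rightarrow> b)"
    by (auto simp: nat_bits.simps[of "f x"])
qed

lemma ptime_div2: assumes "ptime A f" shows "ptime A (\<lambda>x. f x div 2 :: nat)"
proof (rule ptime_repr_cong[OF ptime_tl[OF ptime_nat_bits[OF assms]]])
  fix x show "repr (f x div 2) = repr (tl (nat_bits (f x)))"
    by (simp add: repr_nat_bits nat_bits.simps[of "f x"])
qed

lemma nat_bits_Cons: "nat_bits (of_bool b + 2 * n) = (if \<not> b \<and> n = 0 then [] else b # nat_bits n)"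
  by (subst nat_bits.simps) auto

lemma ptime_bit_cons:
  assumes "ptime A b" "ptime A f"
  shows "ptime A (\<lambda>x. of_bool (b x) + 2 * f x :: nat)"
proof (rule ptime_repr_cong)
  show "ptime A (\<lambda>x. if \<not> b x \<and> f x = 0 then [] else b x # nat_bits (f x))"
    by (intro ptime_If ptime_conj ptime_Not ptime_eq_0 ptime_const ptime_Cons ptime_nat_bits assms)
qed (simp add: repr_nat_bits nat_bits_Cons)

fun of_bits :: "bool list \<Rightarrow> nat" where
  "of_bits [] = 0"
| "of_bits (b # bs) = of_bool b + 2 * of_bits bs"

lemma of_bits_nat_bits [simp]: "of_bits (nat_bits n) = n"
proof (induction n rule: less_induct)
  case (less n)
  show ?case
  proof (cases "n = 0")
    case False
    then have "of_bits (nat_bits (n div 2)) = n div 2" by (intro less) simp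
    then show ?thesis using False by (subst nat_bits.simps) (auto simp: odd_two_times_div_two_nat)
  qed simp
qed

lemma length_nat_bits_less: "n < 2 ^ length (nat_bits n)"
proof (induction n rule: less_induct)
  case (less n)
  show ?case
  proof (cases "n = 0")
    case False
    then have "n div 2 < 2 ^ length (nat_bits (n div 2))" by (intro less) simp
    then show ?thesis using False by (subst nat_bits.simps) auto
  qed simp
qed

lemma length_nat_bits_le: "n < 2 ^ k \<Longrightarrow> length (nat_bits n) \<le> k"
proof (induction k arbitrary: n)
  case (Suc k)
  then have "length (nat_bits (n div 2)) \<le> k" by (intro Suc.IH) auto
  then show ?case by (subst nat_bits.simps) auto
qed auto

lemma esize_bits: "length bs \<le> esize (bs :: bool list)" "esize bs \<le> 4 * length bs + 1"
  by (induction bs) (auto simp: esize_def code_repr_bool)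

lemma esize_nat: "esize (n::nat) = esize (nat_bits n)"
  by (simp add: esize_def repr_nat_bits)

lemma esize_nat_le: "n < 2 ^ k \<Longrightarrow> esize (n::nat) \<le> 4 * k + 1"
  using length_nat_bits_le[of n k] esize_bits(2)[of "nat_bits n"] by (simp add: esize_nat)

lemma less_two_power_esize: "n < 2 ^ esize (n::nat)"
proof -
  have "n < 2 ^ length (nat_bits n)" by (rule length_nat_bits_less)
  also have "\<dots> \<le> 2 ^ esize n" using esize_bits(1)[of "nat_bits n"] by (simp add: esize_nat)
  finally show ?thesis .
qed

lemma length_nat_bits_mult: "length (nat_bits (m * n)) \<le> length (nat_bits m) + length (nat_bits n)"
proof (rule length_nat_bits_le)
  show "m * n < 2 ^ (length (nat_bits m) + length (nat_bits n))"
    unfolding power_add by (intro mult_strict_mono length_nat_bits_less) auto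
qed

lemma length_nat_bits_add: "length (nat_bits (m + n)) \<le> length (nat_bits m) + length (nat_bits n) + 1"
proof (rule length_nat_bits_le)
  have "m + n \<le> 2 * ((m + 1) * (n + 1))" by simp
  also have "(m + 1) * (n + 1) \<le> 2 ^ length (nat_bits m) * 2 ^ length (nat_bits n)"
    by (intro mult_mono) (auto simp: Suc_le_eq length_nat_bits_less)
  finally have "m + n \<le> 2 ^ (length (nat_bits m) + length (nat_bits n) + 1)"
    by (simp add: power_add)
  moreover have "m + n < 2 ^ length (nat_bits m) + 2 ^ length (nat_bits n)"
    by (intro add_strict_mono length_nat_bits_less)
  moreover have "(2::nat) ^ length (nat_bits m) + 2 ^ length (nat_bits n)
      \<le> 2 * (2 ^ length (nat_bits m) * 2 ^ length (nat_bits n))"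
    by (simp add: add_mono mult_2)
  ultimately show "m + n < 2 ^ (length (nat_bits m) + length (nat_bits n) + 1)"
    by (simp add: power_add)
qed

lemma ptime_of_bits:
  assumes "ptime A l"
  shows "ptime A (\<lambda>x. of_bits (l x))"
proof -
  have bc: "esize (of_bool b + 2 * n :: nat) \<le> esize n + 4" for b n
    by (simp only: esize_nat nat_bits_Cons) (auto simp: esize_def code_repr_bool)
  have "ptime A (\<lambda>x. foldl (\<lambda>acc b. of_bool b + 2 * acc) (0::nat) (rev (l x)))"
    by (rule ptime_foldl_additive[where k = "\<lambda>_. 4"], intro ptime_rev assms, rule ptime_const,
        intro ptime_bit_cons ptime_fst ptime_snd ptime_id, rule pbound_const, rule bc)
  moreover have "foldl (\<lambda>acc b. of_bool b + 2 * acc) 0 (rev bs) = of_bits bs" for bs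
    by (induction bs) auto
  ultimately show ?thesis by simp
qed

section \<open>Addition and comparison digit by digit\<close>

lemma foldl_funpow: "foldl (\<lambda>s _. F s) s l = (F ^^ length l) s"
  by (induction l arbitrary: s) (auto simp: funpow_swap1)

lemma of_bits_append: "of_bits (xs @ ys) = of_bits xs + 2 ^ length xs * of_bits ys"
  by (induction xs) auto

lemma esize_div2: "esize (n div 2 :: nat) \<le> esize n"
  by (simp only: esize_nat) (subst (2) nat_bits.simps, auto)

lemma esize_bool: "esize (b::bool) \<le> 3" "1 \<le> esize b"
  by (auto simp: esize_def code_repr_bool)

lemma nat_split_bit: "n = 2 * (n div 2) + of_bool (odd n)" for n :: nat
  by (cases "odd n") auto

text \<open>Ripple-carry addition from the low end. The nested equality is the exclusive or of three
  bits, the new carry is their majority, and digits are collected in reverse order.\<close>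

definition add_step :: "nat \<times> nat \<times> bool \<times> bool list \<Rightarrow> nat \<times> nat \<times> bool \<times> bool list" where
  "add_step s = (case s of (m, n, c, out) \<Rightarrow>
     (m div 2, n div 2, (odd m \<and> odd n) \<or> (c \<and> (odd m \<or> odd n)),
      (odd m = (odd n = c)) # out))"

text \<open>The digits produced so far, plus the remaining summands and the carry at their weight,
  always have the value \<open>M + N\<close>, because a full adder preserves it.\<close>

lemma add_step_inv:
  assumes "(add_step ^^ k) (M, N, False, []) = (m, n, c, out)"
  shows "m = M div 2 ^ k \<and> n = N div 2 ^ k \<and> length out = k \<and>
    of_bits (rev out) + 2 ^ k * (m + n + of_bool c) = M + N"
  using assms
proof (induction k arbitrary: m n c out)
  case (Suc k)
  obtain m' n' c' out' where s: "(add_step ^^ k) (M, N, False, []) = (m', n', c', out')"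
    by (metis prod_cases4)
  then have "add_step (m', n', c', out') = (m, n, c, out)" using Suc.prems by simp
  have IH: "m' = M div 2 ^ k" "n' = N div 2 ^ k" "length out' = k"
    "of_bits (rev out') + 2 ^ k * (m' + n' + of_bool c') = M + N"
    using Suc.IH[OF s] by auto
  have eq: "m = m' div 2" "n = n' div 2" "c = ((odd m' \<and> odd n') \<or> (c' \<and> (odd m' \<or> odd n')))"
    "out = (odd m' = (odd n' = c')) # out'"
    using \<open>add_step (m', n', c', out') = (m, n, c, out)\<close> by (auto simp: add_step_def)
  have sum: "m' + n' + of_bool c' = of_bool (odd m' = (odd n' = c')) + 2 * (m + n + of_bool c)"
  proof -
    have "m' = 2 * m + of_bool (odd m')" "n' = 2 * n + of_bool (odd n')"
      unfolding eq by (rule nat_split_bit)+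
    then show ?thesis by (cases "odd m'"; cases "odd n'"; cases c') (simp_all add: eq(3))
  qed
  have "of_bits (rev out) + 2 ^ Suc k * (m + n + of_bool c)
      = of_bits (rev out') + 2 ^ k * (of_bool (odd m' = (odd n' = c')) + 2 * (m + n + of_bool c))"
    by (simp add: eq(4) IH(3) of_bits_append algebra_simps)
  then have "of_bits (rev out) + 2 ^ Suc k * (m + n + of_bool c) = M + N"
    unfolding sum[symmetric] IH(4) .
  moreover have "m = M div 2 ^ Suc k" "n = N div 2 ^ Suc k"
    unfolding eq(1,2) IH(1,2) power_Suc2 div_mult2_eq by (rule refl)+
  ultimately show ?case using eq(4) IH(3) by simp
qed auto

lemma ptime_add:
  assumes "ptime A f" "ptime A g"
  shows "ptime A (\<lambda>x. f x + g x :: nat)"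
proof -
  have bnd: "esize (add_step s) \<le> esize s + 10" for s
    using esize_div2[of "fst s"] esize_div2[of "fst (snd s)"]
      esize_bool(1)[of "odd (fst s) = (odd (fst (snd s)) = fst (snd (snd s)))"]
      esize_bool(1)[of "(odd (fst s) \<and> odd (fst (snd s))) \<or> (fst (snd (snd s)) \<and> (odd (fst s) \<or> odd (fst (snd s))))"]
    by (cases s) (simp add: add_step_def)
  have "ptime B (\<lambda>z. add_step (h z))" if "ptime B h" for B and h :: "'c::encodable \<Rightarrow> _"
    unfolding add_step_def
    by (intro ptime_case_prod ptime_Pair ptime_div2 ptime_odd ptime_conj ptime_disj ptime_Cons ptime_iff
        ptime_fst ptime_snd that)
  note step = this
  \<comment> \<open>The digits of both numbers and one further entry serve only as a clock: the sum
    has at most that many digits, so nothing remains to be added afterwards.\<close>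
  have "ptime A (\<lambda>x. foldl (\<lambda>s _. add_step s) (f x, g x, False, []) (nat_bits (f x) @ nat_bits (g x) @ [True]))"
    by (rule ptime_foldl_additive[where k = "\<lambda>_. 10"])
       (intro ptime_append ptime_nat_bits assms ptime_Cons ptime_const ptime_Pair step ptime_fst
        ptime_snd ptime_id pbound_const bnd)+
  then have "ptime A (\<lambda>x. of_bits (rev (snd (snd (snd
      (foldl (\<lambda>s _. add_step s) (f x, g x, False, []) (nat_bits (f x) @ nat_bits (g x) @ [True])))))))"
    by (intro ptime_of_bits ptime_rev ptime_snd)
  then show ?thesis
  proof (rule ptime_cong)
    fix x
    let ?k = "length (nat_bits (f x)) + length (nat_bits (g x)) + 1"
    obtain m n c out where s: "(add_step ^^ ?k) (f x, g x, False, []) = (m, n, c, out)"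
      by (metis prod_cases4)
    have "f x + g x < 2 ^ length (nat_bits (f x + g x))" by (rule length_nat_bits_less)
    also have "\<dots> \<le> 2 ^ ?k" using length_nat_bits_add[of "f x" "g x"] by (intro power_increasing) auto
    finally have less: "f x + g x < 2 ^ ?k" .
    have inv: "of_bits (rev out) + 2 ^ ?k * (m + n + of_bool c) = f x + g x"
      using add_step_inv[OF s] by blast
    have "m + n + of_bool c = 0"
    proof (rule ccontr)
      assume "m + n + of_bool c \<noteq> 0"
      then have "2 ^ ?k * 1 \<le> 2 ^ ?k * (m + n + of_bool c)" by (intro mult_left_mono) auto
      with inv less show False by linarith
    qed
    with inv have "of_bits (rev out) = f x + g x" by simp
    moreover have "length (nat_bits (f x) @ nat_bits (g x) @ [True]) = ?k" by simp
    ultimately show "f x + g x = of_bits (rev (snd (snd (snd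
      (foldl (\<lambda>s _. add_step s) (f x, g x, False, []) (nat_bits (f x) @ nat_bits (g x) @ [True]))))))"
      by (simp only: foldl_funpow s snd_conv)
  qed
qed

text \<open>Comparison from the low end: the verdict on the lower digits is overruled whenever the
  current digits differ.\<close>

definition le_step :: "nat \<times> nat \<times> bool \<Rightarrow> nat \<times> nat \<times> bool" where
  "le_step s = (case s of (m, n, c) \<Rightarrow> (m div 2, n div 2, if odd m = odd n then c else odd n))"

lemma le_step_inv:
  assumes "(le_step ^^ k) (M, N, True) = (m, n, c)"
  shows "m = M div 2 ^ k \<and> n = N div 2 ^ k \<and> (M \<le> N \<longleftrightarrow> m < n \<or> (m = n \<and> c))"
  using assms
proof (induction k arbitrary: m n c)
  case (Suc k)
  obtain m' n' c' where s: "(le_step ^^ k) (M, N, True) = (m', n', c')" by (metis prod_cases3)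
  then have "le_step (m', n', c') = (m, n, c)" using Suc.prems by simp
  have IH: "m' = M div 2 ^ k" "n' = N div 2 ^ k" "M \<le> N \<longleftrightarrow> m' < n' \<or> (m' = n' \<and> c')"
    using Suc.IH[OF s] by auto
  have eq: "m = m' div 2" "n = n' div 2" "c = (if odd m' = odd n' then c' else odd n')"
    using \<open>le_step (m', n', c') = (m, n, c)\<close> by (auto simp: le_step_def)
  have "m' = 2 * m + of_bool (odd m')" "n' = 2 * n + of_bool (odd n')"
    unfolding eq by (rule nat_split_bit)+
  then have "m' < n' \<or> (m' = n' \<and> c') \<longleftrightarrow> m < n \<or> (m = n \<and> c)"
    by (cases "odd m'"; cases "odd n'"; auto simp: eq(3))
  moreover have "m = M div 2 ^ Suc k" "n = N div 2 ^ Suc k"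
    unfolding eq(1,2) IH(1,2) power_Suc2 div_mult2_eq by (rule refl)+
  ultimately show ?case using IH(3) by simp
qed auto

lemma ptime_le:
  assumes "ptime A f" "ptime A g"
  shows "ptime A (\<lambda>x. f x \<le> (g x :: nat))"
proof -
  have bnd: "esize (le_step s) \<le> esize s + 10" for s
    using esize_div2[of "fst s"] esize_div2[of "fst (snd s)"]
      esize_bool(1)[of "odd (fst (snd s))"]
    by (cases s) (auto simp: le_step_def)
  have "ptime B (\<lambda>z. le_step (h z))" if "ptime B h" for B and h :: "'c::encodable \<Rightarrow> _"
    unfolding le_step_def
    by (intro ptime_case_prod ptime_Pair ptime_div2 ptime_odd ptime_If ptime_iff ptime_fst ptime_snd that)
  note step = this
  have "ptime A (\<lambda>x. foldl (\<lambda>s _. le_step s) (f x, g x, True) (nat_bits (f x) @ nat_bits (g x)))"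
    by (rule ptime_foldl_additive[where k = "\<lambda>_. 10"])
       (intro ptime_append ptime_nat_bits assms ptime_Cons ptime_const ptime_Pair step ptime_fst
        ptime_snd ptime_id pbound_const bnd)+
  then have "ptime A (\<lambda>x. snd (snd (foldl (\<lambda>s _. le_step s) (f x, g x, True) (nat_bits (f x) @ nat_bits (g x)))))"
    by (intro ptime_snd)
  then show ?thesis
  proof (rule ptime_cong)
    fix x
    let ?k = "length (nat_bits (f x)) + length (nat_bits (g x))"
    obtain m n c where s: "(le_step ^^ ?k) (f x, g x, True) = (m, n, c)" by (metis prod_cases3)
    have "f x < 2 ^ ?k" "g x < 2 ^ ?k"
      using length_nat_bits_less[of "f x"] length_nat_bits_less[of "g x"]
      by (auto simp: power_add intro: less_le_trans)
    then have "m = 0" "n = 0" using le_step_inv[OF s] by auto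
    then show "(f x \<le> g x) = snd (snd (foldl (\<lambda>s _. le_step s) (f x, g x, True) (nat_bits (f x) @ nat_bits (g x))))"
      unfolding foldl_funpow using le_step_inv[OF s] s by simp
  qed
qed

lemma ptime_eq_nat: "ptime A f \<Longrightarrow> ptime A g \<Longrightarrow> ptime A (\<lambda>x. f x = (g x :: nat))"
  by (rule ptime_cong[OF ptime_conj[OF ptime_le[of A f g] ptime_le[of A g f]]]) auto

lemma ptime_less: "ptime A f \<Longrightarrow> ptime A g \<Longrightarrow> ptime A (\<lambda>x. f x < (g x :: nat))"
  by (rule ptime_cong[OF ptime_Not[OF ptime_le[of A g f]]]) auto

lemma ptime_eq_prod:
  assumes "ptime A (\<lambda>x. fst (f x) = fst (g x))" "ptime A (\<lambda>x. snd (f x) = snd (g x))"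
  shows "ptime A (\<lambda>x. f x = g x)"
  by (rule ptime_cong[OF ptime_conj[OF assms]]) (auto simp: prod_eq_iff)

text \<open>\<open>of_bits\<close> alone forgets \<open>False\<close> entries at the end; a final
  \<open>True\<close> pins down the length. Equality of bit strings thereby reduces to equality of
  numbers.\<close>

lemma of_bits_sentinel_inject: "of_bits (xs @ [True]) = of_bits (ys @ [True]) \<longleftrightarrow> xs = ys"
proof (induction xs arbitrary: ys)
  case Nil
  show ?case
  proof (cases ys)
    case (Cons y ys')
    have "of_bits (ys' @ [True]) > 0" by (simp add: of_bits_append)
    then show ?thesis using Cons by auto
  qed simp
next
  case (Cons x xs)
  show ?case
  proof (cases ys)
    case Nil
    have "of_bits (xs @ [True]) > 0" by (simp add: of_bits_append)
    then show ?thesis using Nil by auto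
  next
    case (Cons y ys')
    have "of_bool x + 2 * a = of_bool y + 2 * b \<longleftrightarrow> x = y \<and> a = b" for a b :: nat
      by (cases x; cases y; simp) presburger+
    then show ?thesis using Cons Cons.IH[of ys'] Cons by simp
  qed
qed

lemma ptime_eq_bits: "ptime A f \<Longrightarrow> ptime A g \<Longrightarrow> ptime A (\<lambda>x. f x = (g x :: bool list))"
  by (rule ptime_cong[OF ptime_eq_nat[OF ptime_of_bits[OF ptime_append[OF _ ptime_const[of A "[True]"]]]
        ptime_of_bits[OF ptime_append[OF _ ptime_const[of A "[True]"]]]]]) (simp_all add: of_bits_sentinel_inject)

text \<open>Growth of numbers is measured in digits. In \<open>esize\<close> a digit 1 takes 4
  symbols and a digit 0 only 2, so it can grow by more than the new digits when zeros turn into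
  ones.\<close>

lemma nat_measure:
  "length (nat_bits n) \<le> esize n" "esize n \<le> 4 * length (nat_bits n) + 4"
  using esize_bits[of "nat_bits n"] by (auto simp: esize_nat)

lemmas ptime_foldl_nat = ptime_foldl_measure[where \<mu> = "\<lambda>n. length (nat_bits n)" and C = 4, OF _ _ _ _ _ nat_measure]

lemma ptime_mult:
  assumes "ptime A f" "ptime A g"
  shows "ptime A (\<lambda>x. f x * g x :: nat)"
proof -
  \<comment> \<open>Horner's scheme over the binary digits of \<open>g x\<close>, most significant
    digit first.\<close>
  have "ptime A (\<lambda>x. foldl (\<lambda>acc b. (if b then f x else 0) + (acc + acc)) 0 (rev (nat_bits (g x))))"
  proof (rule ptime_foldl_nat[where k = "\<lambda>x. esize (f x) + 3"])
    have "ptime {z. fst z \<in> A \<and> snd (snd z) \<in> set (rev (nat_bits (g (fst z))))} (\<lambda>z. f (fst z))"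
      for g :: "'a \<Rightarrow> nat"
      by (rule ptime_compose[OF ptime_fst[OF ptime_id] assms(1)]) auto
    then show "ptime {z. fst z \<in> A \<and> snd (snd z) \<in> set (rev (nat_bits (g (fst z))))}
        (\<lambda>z. (if snd (snd z) then f (fst z) else 0) + (fst (snd z) + fst (snd z)))"
      by (intro ptime_add ptime_If ptime_snd ptime_fst ptime_id ptime_const)
    fix x acc b
    have "length (nat_bits (2 * acc)) \<le> length (nat_bits acc) + 1"
      using nat_bits_Cons[of False acc] by simp
    moreover have "length (nat_bits (if b then f x else 0)) \<le> esize (f x)"
      using nat_measure(1)[of "f x"] by auto
    ultimately show "length (nat_bits ((if b then f x else 0) + (acc + acc))) \<le> length (nat_bits acc) + (esize (f x) + 3)"
      using length_nat_bits_add[of "if b then f x else 0" "acc + acc"] by (simp add: mult_2[symmetric])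
  qed (intro ptime_rev ptime_nat_bits assms ptime_const pbound_add pbound_const ptime_esize)+
  moreover have "foldl (\<lambda>acc b. (if b then m else 0) + (acc + acc)) 0 (rev bs) = m * of_bits bs" for m :: nat and bs
    by (induction bs) (auto simp: algebra_simps)
  ultimately show ?thesis by simp
qed

lemma ptime_sum_list:
  assumes l: "ptime A l"
  shows "ptime A (\<lambda>x. sum_list (l x) :: nat)"
proof -
  have "ptime A (\<lambda>x. foldl (\<lambda>acc y. acc + y) 0 (l x))"
  proof (rule ptime_foldl_nat[where k = "\<lambda>x. esize (l x) + 1"])
    fix x acc y assume "y \<in> set (l x)"
    then show "length (nat_bits (acc + y)) \<le> length (nat_bits acc) + (esize (l x) + 1)"
      using length_nat_bits_add[of acc y] nat_measure(1)[of y] esize_mem[of y "l x"] by simp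
  qed (intro l ptime_add ptime_const pbound_add pbound_const ptime_esize ptime_fst ptime_snd ptime_id)+
  moreover have "foldl (\<lambda>acc y. acc + y) 0 ys = sum_list ys" for ys :: "nat list"
    by (induction ys rule: rev_induct) auto
  ultimately show ?thesis by simp
qed

lemma ptime_length:
  assumes l: "ptime A l"
  shows "ptime A (\<lambda>x. length (l x))"
proof -
  have "ptime A (\<lambda>x. sum_list (map (\<lambda>y. 1::nat) (l x)))"
    by (intro ptime_sum_list ptime_map l ptime_const)
  then show ?thesis by (simp add: sum_list_triv)
qed

lemma ptime_Suc: "ptime A f \<Longrightarrow> ptime A (\<lambda>x. Suc (f x))"
  using ptime_add[OF ptime_const[of A 1], of f] by simp

lemma ptime_poly: "ptime A f \<Longrightarrow> ptime A (\<lambda>x. poly p (f x) :: nat)"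
  by (induction p) (auto intro!: ptime_const ptime_add ptime_mult)

lemma esize_nat_linear: "esize (n::nat) \<le> 4 * n + 1"
  by (rule esize_nat_le) (rule less_exp)

text \<open>The value of \<open>f x\<close>, and not only its number of digits, must be polynomially
  bounded, because the result has \<open>f x\<close> entries. No list is at hand to fold over, hence
  the while loop.\<close>

lemma ptime_upt:
  assumes f: "ptime A f" and b: "pbound A f"
  shows "ptime A (\<lambda>x. [0..<f x])"
proof -
  let ?B = "{z. fst z \<in> A}"
  let ?t = "\<lambda>z :: 'a \<times> nat \<times> nat list. fst (snd z) < f (fst z)"
  let ?g = "\<lambda>z :: 'a \<times> nat \<times> nat list. (fst z, Suc (fst (snd z)), fst (snd z) # snd (snd z))"
  let ?A = "{z :: 'a \<times> nat \<times> nat list. fst z \<in> A \<and> snd z = (0, [])}"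
  have iter: "(?g ^^ m) (x, 0, []) = (x, m, rev [0..<m])" for m x by (induction m) auto
  have "ptime ?B (\<lambda>z :: 'a \<times> nat \<times> nat list. f (fst z))"
    by (rule ptime_compose[OF ptime_fst[OF ptime_id] f]) auto
  then have t: "ptime ?B ?t" by (intro ptime_less ptime_fst ptime_snd ptime_id)
  have g: "ptime {z \<in> ?B. ?t z} ?g"
    by (intro ptime_Pair ptime_Suc ptime_Cons ptime_fst ptime_snd ptime_id)
  have "ptime ?A (\<lambda>z. (?g ^^ f (fst z)) z)"
  proof (rule ptime_while[OF t g])
    show "pbound ?A (\<lambda>z. f (fst z))" by (rule pbound_fst[OF b])
    show "pbound ?A (\<lambda>z. esize z + (4 * f (fst z) + 10 + f (fst z) * (4 * f (fst z) + 2)))"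
      by (intro pbound_add pbound_mult pbound_const pbound_self pbound_fst[OF b])
    fix z m assume z: "z \<in> ?A" "m \<le> f (fst z)"
    obtain x where x: "z = (x, 0, [])" "x \<in> A" using z by (cases z) auto
    show "?t ((?g ^^ m) z) \<longleftrightarrow> m < f (fst z)" using iter[of m x] x by simp
    have "esize (rev [0..<m]) \<le> 1 + m * (4 * m + 2)"
    proof (induction m)
      case (Suc m)
      then show ?case using esize_nat_linear[of m] by (simp add: algebra_simps)
    qed simp
    also have "\<dots> \<le> 1 + f x * (4 * f x + 2)" using z x by (intro add_mono mult_mono) auto
    finally show "(?g ^^ m) z \<in> ?B \<and> esize ((?g ^^ m) z)
        \<le> esize z + (4 * f (fst z) + 10 + f (fst z) * (4 * f (fst z) + 2))"
      using iter[of m x] x z esize_nat_linear[of m] by simp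
  qed
  then have "ptime ?A (\<lambda>z. rev (snd (snd ((?g ^^ f (fst z)) z))))"
    by (intro ptime_rev ptime_snd)
  then show ?thesis
    by (rule ptime_comp_dom[where f = "\<lambda>x. (x, 0, [])", rotated])
       (auto intro!: ptime_Pair ptime_id ptime_const simp: iter)
qed

lemma ptime_power:
  assumes f: "ptime A f" and g: "ptime A g" "pbound A g"
  shows "ptime A (\<lambda>x. f x ^ g x :: nat)"
proof -
  have "ptime A (\<lambda>x. foldl (\<lambda>acc _. acc * f x) 1 [0..<g x])"
  proof (rule ptime_foldl_nat[where k = "\<lambda>x. esize (f x)"])
    have "ptime {z. fst z \<in> A \<and> snd (snd z) \<in> set [0..<g (fst z)]} (\<lambda>z. f (fst z))"
      for g :: "'a \<Rightarrow> nat"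
      by (rule ptime_compose[OF ptime_fst[OF ptime_id] f]) auto
    then show "ptime {z. fst z \<in> A \<and> snd (snd z) \<in> set [0..<g (fst z)]} (\<lambda>z. fst (snd z) * f (fst z))"
      by (intro ptime_mult ptime_fst ptime_snd ptime_id)
    fix x acc show "length (nat_bits (acc * f x)) \<le> length (nat_bits acc) + esize (f x)"
      using length_nat_bits_mult[of acc "f x"] nat_measure(1)[of "f x"] by simp
  qed (intro ptime_upt g f ptime_const ptime_esize)+
  moreover have "foldl (\<lambda>acc _. acc * a) 1 [0..<n] = a ^ n" for a n :: nat
    by (induction n) auto
  ultimately show ?thesis by simp
qed

text \<open>Subtraction by counting the numbers below \<open>f x\<close> that are at least
  \<open>g x\<close>; this is affordable because the minuend is polynomially bounded in
  value.\<close>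

lemma ptime_diff:
  assumes f: "ptime A f" "pbound A f" and g: "ptime A g"
  shows "ptime A (\<lambda>x. f x - g x :: nat)"
proof -
  have "ptime {z. fst z \<in> A \<and> snd z \<in> set [0..<f (fst z)]} (\<lambda>z. g (fst z))" for f :: "'a \<Rightarrow> nat"
    by (rule ptime_compose[OF ptime_fst[OF ptime_id] g]) auto
  then have "ptime A (\<lambda>x. length (filter (\<lambda>c. g x \<le> c) [0..<f x]))"
    by (intro ptime_length ptime_filter ptime_upt f ptime_le ptime_snd ptime_id)
  moreover have "length (filter (\<lambda>c. m \<le> c) [0..<n]) = n - m" for m n :: nat
    by (induction n) (auto simp: Suc_diff_le)
  ultimately show ?thesis by simp
qed

lemma ptime_mem:
  assumes "ptime A f" "ptime A l"
    "ptime {z. fst z \<in> A \<and> snd z \<in> set (l (fst z))} (\<lambda>z. snd z = f (fst z))"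
  shows "ptime A (\<lambda>x. f x \<in> set (l x))"
  using ptime_bex[OF assms(2), of "\<lambda>x y. y = f x"] assms(3) by simp

lemma ptime_distinct:
  fixes l :: "'a::encodable \<Rightarrow> 'b::encodable list"
  assumes l: "ptime A l" and E: "ptime UNIV (\<lambda>z::'b \<times> 'b. fst z = snd z)"
  shows "ptime A (\<lambda>x. distinct (l x))"
proof -
  define h :: "'b list \<times> bool \<Rightarrow> 'b \<Rightarrow> 'b list \<times> bool" where
    "h = (\<lambda>s y. (y # fst s, snd s \<and> y \<notin> set (fst s)))"
  have eq: "ptime B (\<lambda>x. f x = g x)" if "ptime B f" "ptime B g" for B and f g :: "'c::encodable \<Rightarrow> 'b"
    using ptime_compose_UNIV[OF E ptime_Pair[OF that]] by simp
  have fst': "ptime B (\<lambda>x. snd (snd (fst x)))" for B :: "(('a \<times> ('b list \<times> bool) \<times> 'b) \<times> 'b) set"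
    by (intro ptime_fst ptime_snd ptime_id)
  have "ptime A (\<lambda>x. foldl h ([], True) (l x))"
  proof (rule ptime_foldl_additive[where k = "\<lambda>x. esize (l x) + 10"])
    show "ptime {z. fst z \<in> A \<and> snd (snd z) \<in> set (l (fst z))} (\<lambda>z. h (fst (snd z)) (snd (snd z)))"
      unfolding h_def
      by (intro ptime_Pair ptime_Cons ptime_conj ptime_Not ptime_mem eq ptime_fst ptime_snd ptime_id)
    fix x acc y assume "y \<in> set (l x)"
    then show "esize (h acc y) \<le> esize acc + (esize (l x) + 10)"
      using esize_mem[of y "l x"] esize_bool(1)[of "snd acc \<and> y \<notin> set (fst acc)"]
      by (cases acc) (simp add: h_def)
  qed (intro l ptime_const pbound_add pbound_const ptime_esize)+
  moreover have "foldl h ([], True) ys = (rev ys, distinct ys)" for ys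
    by (induction ys rule: rev_induct) (auto simp: h_def)
  ultimately have "ptime A (\<lambda>x. (rev (l x), distinct (l x)))" by simp
  from ptime_snd[OF this] show ?thesis by simp
qed

lemma ptime_zip:
  fixes l :: "'a::encodable \<Rightarrow> 'b::encodable list" and g :: "'a \<Rightarrow> 'c::encodable list"
  assumes l: "ptime A l" and g: "ptime A g"
  shows "ptime A (\<lambda>x. zip (l x) (g x))"
proof -
  define h :: "('b \<times> 'c) list \<times> 'c list \<Rightarrow> 'b \<Rightarrow> ('b \<times> 'c) list \<times> 'c list" where
    "h = (\<lambda>s y. case snd s of [] \<Rightarrow> (fst s, []) | c # cs \<Rightarrow> ((y, c) # fst s, cs))"
  have "ptime A (\<lambda>x. foldl h ([], g x) (l x))"
  proof (rule ptime_foldl_additive[where k = "\<lambda>x. esize (l x) + 10"])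
    show "ptime {z. fst z \<in> A \<and> snd (snd z) \<in> set (l (fst z))} (\<lambda>z. h (fst (snd z)) (snd (snd z)))"
      unfolding h_def
      by (intro ptime_list_case ptime_Pair ptime_Cons ptime_fst ptime_snd ptime_id ptime_const)
    fix x acc y assume "y \<in> set (l x)"
    then show "esize (h acc y) \<le> esize acc + (esize (l x) + 10)"
      using esize_mem[of y "l x"] by (cases acc) (auto simp: h_def split: list.splits)
  qed (intro l g ptime_const ptime_Pair pbound_add pbound_const ptime_esize)+
  moreover have "fst (foldl h (acc, cs) ys) = rev (zip ys cs) @ acc" for acc ys cs
    by (induction ys arbitrary: acc cs) (auto simp: h_def split: list.splits)
  moreover have "fst (foldl h ([], cs) ys) = rev (zip ys cs)" for ys cs
    using calculation(2)[of "[]" cs ys] by simp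
  ultimately have "ptime A (\<lambda>x. rev (zip (l x) (g x)))" using ptime_fst[of A "\<lambda>x. foldl h ([], g x) (l x)"] by simp
  from ptime_rev[OF this] show ?thesis by simp
qed

text \<open>The length \<open>k\<close> is a constant, so the number of lists is a fixed power of
  the length of \<open>l x\<close>. In the tableau \<open>k\<close> is the number of tapes.\<close>

lemma ptime_n_lists:
  assumes l: "ptime A l"
  shows "ptime A (\<lambda>x. List.n_lists k (l x))"
proof (induction k)
  case 0
  show ?case by (simp add: ptime_const)
next
  case (Suc k)
  have *: "ptime {z. fst z \<in> A \<and> P z} (\<lambda>z. l (fst z))" for P
    by (rule ptime_compose[OF ptime_fst[OF ptime_id] l]) auto
  show ?case
    unfolding List.n_lists.simps
    by (intro ptime_concat ptime_map Suc ptime_Cons ptime_fst ptime_snd ptime_id *)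
qed

section \<open>From \<open>ptime\<close> to Turing machines\<close>

text \<open>The tree of a list has to be built from its end, so the string is first reversed onto
  stack \<open>2\<close>. The \<open>0\<close> shown by an empty stack, not the mark
  \<open>3\<close>, ends these loops.\<close>

definition load :: com where
  "load = Loop 0 (\<lambda>x. x \<noteq> 0) (PushTop 2 0 ;; Pop 0) ;; Push 0 1 ;;
     Loop 2 (\<lambda>x. x \<noteq> 0) (Cond 2 (\<lambda>x. x = 2)
       (Push 0 1 ;; Push 0 1 ;; Push 0 2 ;; Push 0 2) (Push 0 1 ;; Push 0 2) ;; Pop 2)"

definition unload :: com where
  "unload = Loop 0 (\<lambda>x. x = 2)
     (Pop 0 ;; Cond 0 (\<lambda>x. x = 1) (Pop 0 ;; Push 1 1) (Pop 0 ;; Pop 0 ;; Pop 0 ;; Push 1 2))"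

lemma bits_symbols_simps [simp]:
  "bits_symbols [] = []" "bits_symbols (b # bs) = (if b then 2 else 1) # bits_symbols bs"
  "bits_symbols (xs @ ys) = bits_symbols xs @ bits_symbols ys"
  "length (bits_symbols bs) = length bs" "0 \<notin> set (bits_symbols bs)"
  by (auto simp: bits_symbols_def)

lemma runs_load_1:
  assumes "0 \<notin> set xs"
  shows "runs (Loop 0 (\<lambda>x. x \<noteq> 0) (PushTop 2 0 ;; Pop 0)) (st xs w b c d) (5 * length xs + 1)
    (st [] w (rev xs @ b) c d)"
  using assms
proof (induction xs arbitrary: b)
  case Nil
  show ?case using runs_LoopF[of "\<lambda>x. x \<noteq> 0" "st [] w b c d" 0] by simp
next
  case (Cons x xs)
  have "runs (PushTop 2 0 ;; Pop 0) (st (x # xs) w b c d) (2 + 1) (st xs w (x # b) c d)"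
    by (rule runs_Seq runs_basic)+
  from runs_LoopT[where P = "\<lambda>x. x \<noteq> 0" and i = 0, OF _ this Cons.IH] Cons.prems
  show ?case by (simp add: runs_mono)
qed

lemma runs_load_2:
  "runs (Loop 2 (\<lambda>x. x \<noteq> 0) (Cond 2 (\<lambda>x. x = 2)
      (Push 0 1 ;; Push 0 1 ;; Push 0 2 ;; Push 0 2) (Push 0 1 ;; Push 0 2) ;; Pop 2))
    (st (code (repr ys)) w (rev (bits_symbols xs)) c d) (13 * length xs + 1)
    (st (code (repr (xs @ ys))) w [] c d)"
proof (induction xs arbitrary: ys rule: rev_induct)
  case Nil
  show ?case using runs_LoopF[of "\<lambda>x. x \<noteq> 0" "st (code (repr ys)) w [] c d" 2] by simp
next
  case (snoc x xs)
  let ?c = "Cond 2 (\<lambda>x. x = 2) (Push 0 1 ;; Push 0 1 ;; Push 0 2 ;; Push 0 2) (Push 0 1 ;; Push 0 2)"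
  let ?b = "rev (bits_symbols xs)"
  have "runs ?c (st (code (repr ys)) w ((if x then 2 else 1) # ?b) c d) 10
      (st (code (repr (x # ys))) w ((if x then 2 else 1) # ?b) c d)"
  proof (cases x)
    case True
    have "runs ?c (st (code (repr ys)) w (2 # ?b) c d) (2 + (2 + (2 + 2)) + 2)
      (st (2 # 2 # 1 # 1 # code (repr ys)) w (2 # ?b) c d)"
      by (rule runs_CondT, simp, (rule runs_Seq runs_basic)+)
    with True show ?thesis by (simp add: code_repr_bool)
  next
    case False
    have "runs ?c (st (code (repr ys)) w (1 # ?b) c d) (2 + 2 + 2)
      (st (2 # 1 # code (repr ys)) w (1 # ?b) c d)"
      by (rule runs_CondF, simp, (rule runs_Seq runs_basic)+)
    with False show ?thesis by (simp add: code_repr_bool runs_mono)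
  qed
  from runs_LoopT[where P = "\<lambda>x. x \<noteq> 0" and i = 2, OF _ runs_Seq[OF this runs_basic(8)] snoc.IH]
  show ?case by (simp add: runs_mono)
qed

lemma runs_load:
  "runs load (st (bits_symbols x) w [] c d) (18 * length x + 4) (st (code (repr x)) w [] c d)"
proof -
  have "runs load (st (bits_symbols x) w [] c d) (5 * length (bits_symbols x) + 1 + (2 + (13 * length x + 1)))
     (st (code (repr (x @ []))) w [] c d)"
    unfolding load_def
    by (rule runs_Seq[OF runs_load_1 runs_Seq])
       (use runs_load_2[of "[]" w x c d] runs_basic(2)[of 1 "[]"] in \<open>simp_all\<close>)
  then show ?thesis by (simp add: runs_mono)
qed

lemma runs_unload:
  "runs unload (st (code (repr y)) w b c d) (11 * length y + 1) (st [1] (rev (bits_symbols y) @ w) b c d)"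
proof (induction y arbitrary: w)
  case Nil
  show ?case using runs_LoopF[of "\<lambda>x. x = 2" "st [1] w b c d" 0] by (simp add: unload_def)
next
  case (Cons a y)
  let ?c = "Cond 0 (\<lambda>x. x = 1) (Pop 0 ;; Push 1 1) (Pop 0 ;; Pop 0 ;; Pop 0 ;; Push 1 2)"
  have "runs ?c (st (code (repr a) @ code (repr y)) w b c d) 7
      (st (code (repr y)) ((if a then 2 else 1) # w) b c d)"
  proof (cases a)
    case True
    have "runs ?c (st (2 # 1 # 1 # code (repr y)) w b c d) (1 + (1 + (1 + 2)) + 2)
      (st (code (repr y)) (2 # w) b c d)"
      by (rule runs_CondF, simp, (rule runs_Seq runs_basic)+)
    with True show ?thesis by (simp add: code_repr_bool runs_mono)
  next
    case False
    have "runs ?c (st (1 # code (repr y)) w b c d) (1 + 2 + 2)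
      (st (code (repr y)) (1 # w) b c d)"
      by (rule runs_CondT, simp, (rule runs_Seq runs_basic)+)
    with False show ?thesis by (simp add: code_repr_bool runs_mono)
  qed
  from runs_LoopT[where P = "\<lambda>x. x = 2" and i = 0, OF _ runs_Seq[OF runs_basic(7) this]
      Cons.IH[unfolded unload_def]]
  show ?case by (simp add: unload_def runs_mono)
qed

lemma pbound_bits:
  assumes "pbound (UNIV :: bool list set) T"
  obtains p :: "nat poly" where "\<And>x. T x \<le> poly p (length x)"
proof -
  obtain q where q: "\<And>x. T x \<le> poly q (esize x)" using assms by (auto simp: pbound_def)
  \<comment> \<open>A Boolean list of length \<open>n\<close> has size at most
    \<open>4 * n + 1\<close>; substituting this turns a bound in the size into one in the
    length.\<close>
  have "T x \<le> poly (pcompose q [:1, 4:]) (length x)" for x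
    using q[of x] poly_nat_mono[OF esize_bits(2)[of x], of q]
    by (simp add: poly_pcompose algebra_simps)
  then show thesis by (rule that)
qed

theorem polytime_if_ptime:
  assumes "ptime UNIV f"
  shows "polytime f"
proof -
  obtain q t where "computes q UNIV t f" using assms by (auto simp: ptime_def)
  note q = computesD[OF this]
  let ?c = "load ;; q ;; unload"
  let ?T = "\<lambda>x. 18 * esize x + 4 + (t x + (11 * esize (f x) + 1))"
  have "pbound UNIV ?T" by (intro pbound_intros q ptime_esize assms)
  then obtain p :: "nat poly" where p: "\<And>x. ?T x \<le> poly p (length x)" by (rule pbound_bits) blast
  have wf: "wf_com ?c" using q(1) by (simp add: load_def unload_def)
  have sz: "0 < csize ?c" by (simp add: load_def)
  have "outputs_within (compile ?c) x (f x) (poly p (length x))" for x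
  proof -
    have "runs ?c (st (bits_symbols x) [] [] [] []) (18 * length x + 4 + (t x + (11 * length (f x) + 1)))
       (st [1] (rev (bits_symbols (f x)) @ []) [] [] [])"
      by (rule runs_Seq[OF runs_load runs_Seq[OF _ runs_unload]])
         (use q(3)[of x "[]" "[]" "[]" "[]" "[]"] in simp)
    then obtain n where n: "n \<le> 18 * length x + 4 + (t x + (11 * length (f x) + 1))"
      "exec ?c (st (bits_symbols x) [] [] [] []) n (st [1] (rev (bits_symbols (f x)) @ []) [] [] [])"
      by (auto simp: runs_def)
    have "n \<le> poly p (length x)"
      using n(1) p[of x] esize_bits(1)[of x] esize_bits(1)[of "f x"] by linarith
    moreover have "st (bits_symbols x) [] [] [] [] = (\<lambda>_. [])(0 := bits_symbols x)"
      by (auto simp: st_def fun_eq_iff)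
    ultimately show ?thesis
      using n(2) by (intro exec_outputs_within[OF _ wf sz, where s' = "st [1] (rev (bits_symbols (f x)) @ []) [] [] []"])
        (simp_all only: st_simps append_Nil2)
  qed
  then show ?thesis unfolding polytime_def using wf_compile[OF wf sz] by blast
qed

lemma in_P_if_ptime: "ptime UNIV (\<lambda>x. x \<in> B) \<Longrightarrow> in_P B"
  unfolding in_P_def by (intro polytime_if_ptime ptime_Cons ptime_const)

section \<open>Encoding and decoding in polynomial time\<close>

lemma ptime_enc_list:
  assumes "ptime A l" "ptime UNIV c"
  shows "ptime A (\<lambda>x. enc_list c (l x))"
  unfolding enc_list_def
  by (intro ptime_append ptime_concat ptime_map assms(1) ptime_Cons ptime_const
      ptime_compose_UNIV[OF assms(2)] ptime_snd ptime_id)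

lemma ptime_enc_bits: "ptime A l \<Longrightarrow> ptime A (\<lambda>x. enc_bits (l x))"
  unfolding enc_bits_def by (intro ptime_enc_list ptime_Cons ptime_const ptime_id)

lemma ptime_enc_nat: "ptime A l \<Longrightarrow> ptime A (\<lambda>x. enc_nat (l x))"
  unfolding enc_nat_def by (intro ptime_enc_bits ptime_nat_bits)

text \<open>With nested tuples in place of the record, the instances for pairs, lists and numbers
  supply the tree of an instance.\<close>

type_synonym inst_tuple =
  "nat list \<times> ((nat \<times> nat) \<times> nat \<times> nat) list \<times> nat \<times> nat \<times> nat \<times> nat"

definition mk_inst :: "inst_tuple \<Rightarrow> mmd_instance" where
  "mk_inst I = (case I of (vs, es, s, t, R, D) \<Rightarrow>
     \<lparr>vertices = vs, edges = es, source = s, sink = t, rate = R, delay_bound = D\<rparr>)"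

lemma mk_inst_sel [simp]:
  "vertices (mk_inst I) = fst I" "edges (mk_inst I) = fst (snd I)"
  "source (mk_inst I) = fst (snd (snd I))" "sink (mk_inst I) = fst (snd (snd (snd I)))"
  "rate (mk_inst I) = fst (snd (snd (snd (snd I))))"
  "delay_bound (mk_inst I) = snd (snd (snd (snd (snd I))))"
  by (auto simp: mk_inst_def split: prod.splits)

lemma mk_inst_surj: "\<exists>I. J = mk_inst I"
  by (rule exI[of _ "(vertices J, edges J, source J, sink J, rate J, delay_bound J)"])
     (simp add: mk_inst_def)

lemma ptime_enc_edge: "ptime A f \<Longrightarrow> ptime A (\<lambda>x. enc_edge (f x))"
proof -
  have "enc_edge e = enc_nat (fst (fst e)) @ enc_nat (snd (fst e)) @ enc_nat (fst (snd e)) @ enc_nat (snd (snd e))" for e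
    by (cases e rule: enc_edge.cases) simp
  then show "ptime A f \<Longrightarrow> ptime A (\<lambda>x. enc_edge (f x))"
    by (simp only:) (intro ptime_append ptime_enc_nat ptime_fst ptime_snd)
qed

lemma ptime_encode: "ptime A f \<Longrightarrow> ptime A (\<lambda>x. encode (mk_inst (f x)))"
  unfolding encode_def mk_inst_sel
  by (intro ptime_append ptime_enc_list ptime_enc_nat ptime_enc_edge ptime_fst ptime_snd ptime_id)

text \<open>An automaton over the marked code: \<open>fin\<close> holds once the end mark has been
  read, and \<open>bt\<close> when the next symbol is an entry and not a mark.\<close>

definition unpair_step ::
  "bool \<times> bool \<times> bool list \<times> bool list \<Rightarrow> bool \<Rightarrow> bool \<times> bool \<times> bool list \<times> bool list" where
  "unpair_step s b = (case s of (fin, bt, xs, us) \<Rightarrow>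
     if fin then (True, False, xs, b # us)
     else if bt then (False, False, b # xs, us)
     else if b then (False, True, xs, us) else (True, False, xs, us))"

definition unpair :: "bool list \<Rightarrow> bool list \<times> bool list" where
  "unpair z = (case foldl unpair_step (False, False, [], []) z of (_, _, xs, us) \<Rightarrow> (rev xs, rev us))"

lemma unpair_pair_string [simp]: "unpair (pair_string x u) = (x, u)"
proof -
  have 1: "foldl unpair_step (True, False, xs, us) u = (True, False, xs, rev u @ us)" for xs us
    by (induction u arbitrary: us) (auto simp: unpair_step_def)
  have "foldl unpair_step (False, False, xs, []) (enc_bits x @ u) = (True, False, rev x @ xs, rev u)" for xs
    by (induction x arbitrary: xs) (auto simp: enc_bits_def enc_list_def unpair_step_def 1)
  then show ?thesis by (simp add: unpair_def pair_string_def)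
qed

lemma ptime_unpair: assumes f: "ptime A f" shows "ptime A (\<lambda>x. unpair (f x))"
proof -
  have "ptime A (\<lambda>x. foldl unpair_step (False, False, [], []) (f x))"
  proof (rule ptime_foldl_additive[where k = "\<lambda>_. 10"])
    show "ptime {z. fst z \<in> A \<and> snd (snd z) \<in> set (f (fst z))} (\<lambda>z. unpair_step (fst (snd z)) (snd (snd z)))"
      unfolding unpair_step_def
      by (intro ptime_case_prod ptime_If ptime_Pair ptime_Cons ptime_const ptime_fst ptime_snd ptime_id)
    fix x acc y
    show "esize (unpair_step acc y) \<le> esize acc + 10"
      using esize_bool[of y] esize_bool[of True] esize_bool[of False] esize_bool[of "fst acc"]
        esize_bool[of "fst (snd acc)"]
      by (cases acc) (auto simp: unpair_step_def)
  qed (intro f ptime_const pbound_const)+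
  then show ?thesis unfolding unpair_def by (intro ptime_case_prod ptime_Pair ptime_rev ptime_fst ptime_snd)
qed

section \<open>Certificates as bit strings and their decoding\<close>

fun val_bits :: "val \<Rightarrow> bool list" where
  "val_bits Lf = [False]"
| "val_bits (Nd a b) = True # val_bits a @ val_bits b"

lemma length_val_bits: "length (val_bits (repr x)) = esize x"
proof -
  have "length (val_bits v) = length (code v)" for v by (induction v) auto
  then show ?thesis by (simp add: esize_def)
qed

text \<open>Reads a preorder from its end: a leaf is pushed, a node joins the two topmost trees.
  Malformed strings also yield some tree, so every string is a candidate certificate that the
  verifier can judge by its content.\<close>

definition bits_val_step :: "val list \<Rightarrow> bool \<Rightarrow> val list" where
  "bits_val_step vs b = (if b then (case vs of [] \<Rightarrow> [] | v # ws \<Rightarrow> (case ws of [] \<Rightarrow> [] | w # us \<Rightarrow> Nd v w # us))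
     else Lf # vs)"

definition bits_val :: "bool list \<Rightarrow> val" where
  "bits_val bs = (case foldl bits_val_step [] (rev bs) of [] \<Rightarrow> Lf | v # _ \<Rightarrow> v)"

lemma bits_val_bits [simp]: "bits_val (val_bits v) = v"
proof -
  have "foldl bits_val_step vs (rev (val_bits v)) = v # vs" for vs
    by (induction v arbitrary: vs) (auto simp: bits_val_step_def)
  then show ?thesis by (simp add: bits_val_def)
qed

lemma ptime_Nd: "ptime A f \<Longrightarrow> ptime A g \<Longrightarrow> ptime A (\<lambda>x. Nd (f x) (g x))"
  by (rule ptime_repr_cong[OF ptime_Pair[of A f g]]) auto

lemma ptime_bits_val: assumes f: "ptime A f" shows "ptime A (\<lambda>x. bits_val (f x))"
proof -
  have "ptime A (\<lambda>x. foldl bits_val_step [] (rev (f x)))"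
  proof (rule ptime_foldl_additive[where k = "\<lambda>_. 10"])
    show "ptime {z. fst z \<in> A \<and> snd (snd z) \<in> set (rev (f (fst z)))} (\<lambda>z. bits_val_step (fst (snd z)) (snd (snd z)))"
      unfolding bits_val_step_def
      by (intro ptime_list_case ptime_If ptime_Cons ptime_Nd ptime_const ptime_fst ptime_snd ptime_id)
    fix x acc y
    show "esize (bits_val_step acc y) \<le> esize acc + 10"
      by (auto simp: bits_val_step_def esize_def split: list.splits)
  qed (intro f ptime_const ptime_rev pbound_const)+
  then show ?thesis
    unfolding bits_val_def by (intro ptime_list_case ptime_const ptime_fst ptime_snd ptime_id)
qed

text \<open>Every tree represents the list of left subtrees along its right spine; on
  representations this function is the identity.\<close>

fun vlist :: "val \<Rightarrow> val list" where
  "vlist Lf = []"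
| "vlist (Nd a b) = a # vlist b"

lemma repr_vlist: "repr (vlist v) = v"
  by (induction v) auto

lemma vlist_repr [simp]: "vlist (repr xs) = map repr xs"
  by (induction xs) auto

lemma ptime_vlist: "ptime A f \<Longrightarrow> ptime A (\<lambda>x. vlist (f x))"
  by (erule ptime_repr_cong) (simp add: repr_vlist)

definition vbool :: "val \<Rightarrow> bool" where "vbool v \<longleftrightarrow> v \<noteq> Lf"
definition vnat :: "val \<Rightarrow> nat" where "vnat v = of_bits (map vbool (vlist v))"

lemma vnat_repr [simp]: "vnat (repr n) = n"
proof -
  have "map (vbool \<circ> repr) bs = bs" for bs by (induction bs) (auto simp: vbool_def repr_bool_def)
  then show ?thesis by (simp add: vnat_def repr_nat_bits)
qed

lemma ptime_vbool: "ptime A f \<Longrightarrow> ptime A (\<lambda>x. vbool (f x))"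
  unfolding vbool_def using ptime_not_Lf[of A f] by simp

lemma ptime_vnat: "ptime A f \<Longrightarrow> ptime A (\<lambda>x. vnat (f x))"
  unfolding vnat_def by (intro ptime_of_bits ptime_map ptime_vbool ptime_vlist ptime_snd ptime_id)

lemma ptime_vfst: "ptime A f \<Longrightarrow> ptime A (\<lambda>x. vcar (f x))"
  using ptime_vcar[of A f] by simp

lemma ptime_vsnd: "ptime A f \<Longrightarrow> ptime A (\<lambda>x. vcdr (f x))"
  using ptime_vcdr[of A f] by simp

section \<open>From subset sum to minimum maximum delay\<close>

definition stage_edges :: "nat \<Rightarrow> nat \<times> nat \<Rightarrow> ((nat \<times> nat) \<times> nat \<times> nat) list" where
  "stage_edges j xy = [((2 * j, 2 * j + 1), 1, fst xy), ((2 * j + 1, 2 * j + 2), 1, 0),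
     ((2 * j, 2 * j + 2), 1, snd xy)]"

definition chain_edges :: "(nat \<times> nat) list \<Rightarrow> ((nat \<times> nat) \<times> nat \<times> nat) list" where
  "chain_edges xys = concat (map (\<lambda>z. stage_edges (fst z) (snd z)) (zip [0..<length xys] xys))"

text \<open>Stage \<open>j\<close> leads from vertex \<open>2 j\<close> to \<open>2 j + 2\<close>, either directly or through \<open>2 j + 1\<close>;
  the detour makes the two parallel edges distinct pairs.\<close>

definition chain_inst :: "(nat \<times> nat) list \<Rightarrow> nat \<Rightarrow> inst_tuple" where
  "chain_inst xys D = ([0..<Suc (2 * length xys)], chain_edges xys, 0, 2 * length xys, 2, D)"

lemma chain_edges_snoc: "chain_edges (xys @ [xy]) = chain_edges xys @ stage_edges (length xys) xy"
  by (simp add: chain_edges_def)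

lemma chain_edges_fst_less: "e \<in> set (chain_edges xys) \<Longrightarrow> fst (fst e) < 2 * length xys \<and>
    snd (fst e) \<le> 2 * length xys \<and> fst (fst e) < snd (fst e)"
proof (induction xys rule: rev_induct)
  case (snoc xy xys)
  then show ?case by (auto simp: chain_edges_snoc stage_edges_def)
qed (simp add: chain_edges_def)

lemma distinct_chain_edges: "distinct (map fst (chain_edges xys))"
proof (induction xys rule: rev_induct)
  case (snoc xy xys)
  have "fst e < 2 * length xys" if "e \<in> fst ` set (chain_edges xys)" for e
    using that chain_edges_fst_less by force
  then have "set (map fst (chain_edges xys)) \<inter> set (map fst (stage_edges (length xys) xy)) = {}"
    by (fastforce simp: stage_edges_def)
  with snoc show ?case by (simp add: chain_edges_snoc) (simp add: stage_edges_def)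
qed (simp add: chain_edges_def)

lemma set_chain_edges: "set (chain_edges xys) = (\<Union>j<length xys. set (stage_edges j (xys ! j)))"
proof (induction xys rule: rev_induct)
  case (snoc xy xys)
  then show ?case by (auto simp: chain_edges_snoc lessThan_Suc nth_append)
qed (simp add: chain_edges_def)

context
  fixes xys :: "(nat \<times> nat) list" and D :: nat
begin

private abbreviation "N \<equiv> length xys"
private abbreviation "I \<equiv> mk_inst (chain_inst xys D)"
private abbreviation "G \<equiv> inst_graph I"

text \<open>\<open>J\<close> is the set of stages that are passed by the detour.\<close>

private definition seg :: "nat set \<Rightarrow> nat \<Rightarrow> (nat \<times> nat) list" where
  "seg J j = (if j \<in> J then [(2 * j, 2 * j + 1), (2 * j + 1, 2 * j + 2)] else [(2 * j, 2 * j + 2)])"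

private definition path :: "nat set \<Rightarrow> nat \<Rightarrow> (nat \<times> nat) list" where
  "path J i = concat (map (seg J) [i..<N])"

lemma chain_arcs: "arcs G = (\<Union>j<N. {(2 * j, 2 * j + 1), (2 * j + 1, 2 * j + 2), (2 * j, 2 * j + 2)})"
  by (auto simp: inst_graph_def chain_inst_def set_chain_edges stage_edges_def image_UN)

lemma chain_verts: "verts G = {..2 * N}"
  by (auto simp: inst_graph_def chain_inst_def)

lemma chain_sel: "tail G = fst" "head G = snd" "source I = 0" "sink I = 2 * N" "rate I = 2"
    "delay_bound I = D"
  by (auto simp: inst_graph_def chain_inst_def)

lemma chain_edge_values:
  assumes "j < N"
  shows "inst_delay I (2 * j, 2 * j + 1) = fst (xys ! j)" "inst_delay I (2 * j + 1, 2 * j + 2) = 0"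
    "inst_delay I (2 * j, 2 * j + 2) = snd (xys ! j)"
    "e \<in> arcs G \<Longrightarrow> inst_capacity I e = 1"
proof -
  have edges: "edges I = chain_edges xys" by (simp add: chain_inst_def)
  have map_of: "map_of (edges I) k = Some v" if "(k, v) \<in> set (chain_edges xys)" for k v
    using that distinct_chain_edges unfolding edges by (intro map_of_is_SomeI)
  have mem: "z \<in> set (stage_edges j (xys ! j)) \<Longrightarrow> z \<in> set (chain_edges xys)" for z
    using assms by (auto simp: set_chain_edges)
  show "inst_delay I (2 * j, 2 * j + 1) = fst (xys ! j)" "inst_delay I (2 * j + 1, 2 * j + 2) = 0"
    "inst_delay I (2 * j, 2 * j + 2) = snd (xys ! j)"
    using map_of[OF mem, of "(2 * j, 2 * j + 1)" "(1, fst (xys ! j))"]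
      map_of[OF mem, of "(2 * j + 1, 2 * j + 2)" "(1, 0)"]
      map_of[OF mem, of "(2 * j, 2 * j + 2)" "(1, snd (xys ! j))"]
    by (simp_all only: inst_delay_def option.sel snd_conv stage_edges_def list.set insertI1 insertI2)
  assume "e \<in> arcs G"
  then obtain c where "(e, 1, c) \<in> set (chain_edges xys)"
    by (fastforce simp: inst_graph_def chain_inst_def set_chain_edges stage_edges_def)
  from map_of[OF this] show "inst_capacity I e = 1" by (simp add: inst_capacity_def)
qed

lemma wf_chain: "0 < N \<Longrightarrow> wf_instance I"
proof -
  assume "0 < N"
  moreover have "wf_digraph G"
    by unfold_locales (auto simp: chain_arcs chain_verts chain_sel)
  ultimately show "wf_instance I"
    using distinct_chain_edges by (auto simp: wf_instance_def chain_inst_def)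
qed

private lemma path_cong: "J \<inter> {i..<N} = J' \<inter> {i..<N} \<Longrightarrow> path J i = path J' i"
proof -
  assume eq: "J \<inter> {i..<N} = J' \<inter> {i..<N}"
  have "seg J j = seg J' j" if "j \<in> set [i..<N]" for j
  proof -
    have "j \<in> J \<longleftrightarrow> j \<in> J'" using eq that by (metis Int_iff set_upt)
    then show ?thesis by (simp add: seg_def)
  qed
  then have "map (seg J) [i..<N] = map (seg J') [i..<N]" by (rule map_cong[OF refl])
  then show ?thesis unfolding path_def by (rule arg_cong)
qed

private lemma path_rec: "i < N \<Longrightarrow> path J i = seg J i @ path J (Suc i)"
  by (simp add: path_def upt_conv_Cons)

text \<open>At vertex \<open>2 * i\<close> a walk has only the two alternatives of stage
  \<open>i\<close>, and on the detour the second edge is forced. The remaining path does not depend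
  on whether \<open>i\<close> belongs to the set, so the set from the induction hypothesis may be
  adjusted at \<open>i\<close>.\<close>

private lemma walk_is_path:
  assumes "pre_digraph.cas G (2 * i) p (2 * N)" "set p \<subseteq> arcs G" "i \<le> N"
  shows "\<exists>J. p = path J i"
  using assms
proof (induction "N - i" arbitrary: i p)
  case 0
  then have "i = N" by simp
  moreover have "p = []"
  proof (cases p)
    case (Cons e p')
    then have "fst e = 2 * N" "e \<in> arcs G"
      using 0 \<open>i = N\<close> by (auto simp: pre_digraph.cas.simps chain_sel)
    then show ?thesis by (auto simp: chain_arcs)
  qed simp
  ultimately show ?case by (auto simp: path_def)
next
  case (Suc n)
  then have i: "i < N" and n: "n = N - Suc i" by simp_all
  obtain e p' where p: "p = e # p'"
    using Suc.prems i by (cases p) (auto simp: pre_digraph.cas.simps)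
  have e: "fst e = 2 * i" "e \<in> arcs G" "pre_digraph.cas G (snd e) p' (2 * N)" "set p' \<subseteq> arcs G"
    using Suc.prems by (auto simp: pre_digraph.cas.simps chain_sel p)
  then consider "e = (2 * i, 2 * i + 1)" | "e = (2 * i, 2 * i + 2)"
    by (auto simp: chain_arcs)
  then show ?case
  proof cases
    case 1
    obtain e' p'' where p': "p' = e' # p''"
      using e 1 by (cases p') (auto simp: pre_digraph.cas.simps, presburger)
    have e': "fst e' = 2 * i + 1" "e' \<in> arcs G" "pre_digraph.cas G (snd e') p'' (2 * N)" "set p'' \<subseteq> arcs G"
      using e 1 by (auto simp: pre_digraph.cas.simps chain_sel p')
    then have e'': "e' = (2 * i + 1, 2 * i + 2)" by (auto simp: chain_arcs) presburger
    obtain J where "p'' = path J (Suc i)"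
      using Suc.hyps(1)[OF n, of p''] e' e'' i by auto
    moreover have "path J (Suc i) = path (insert i J) (Suc i)" by (rule path_cong) auto
    ultimately have "p = path (insert i J) i"
      using 1 e'' path_rec[OF i, of "insert i J"]
      by (simp add: p p' seg_def)
    then show ?thesis by blast
  next
    case 2
    obtain J where "p' = path J (Suc i)"
      using Suc.hyps(1)[OF n, of p'] e 2 i by auto
    moreover have "path J (Suc i) = path (J - {i}) (Suc i)" by (rule path_cong) auto
    ultimately have "p = path (J - {i}) i"
      using 2 path_rec[OF i, of "J - {i}"]
      by (simp add: p seg_def)
    then show ?thesis by blast
  qed
qed

private lemma set_path: "set (path J i) = (\<Union>j\<in>{i..<N}. set (seg J j))"
  by (auto simp: path_def)

private lemma cas_path: "i \<le> N \<Longrightarrow> pre_digraph.cas G (2 * i) (path J i) (2 * N)"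
proof (induction "N - i" arbitrary: i)
  case 0
  then show ?case by (simp add: path_def pre_digraph.cas.simps)
next
  case (Suc n)
  have i: "i < N" using Suc.hyps(2) by simp
  have "pre_digraph.cas G (2 * Suc i) (path J (Suc i)) (2 * N)"
    using Suc.hyps(2) i by (intro Suc.hyps(1)) auto
  then show ?case unfolding path_rec[OF i, of J]
    by (simp add: seg_def pre_digraph.cas.simps chain_sel)
qed

text \<open>Arcs lead to larger vertices, so a walk cannot revisit a vertex, and all walks to the
  sink count as paths.\<close>

private lemma increasing_verts:
  assumes "\<forall>e\<in>set p. fst e < snd e" "pre_digraph.cas G u p v"
  shows "distinct (pre_digraph.awalk_verts G u p) \<and> (\<forall>w\<in>set (pre_digraph.awalk_verts G u p). u \<le> w)"
  using assms
proof (induction p arbitrary: u)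
  case (Cons e p)
  have e: "fst e = u" "fst e < snd e" "pre_digraph.cas G (snd e) p v"
    using Cons.prems by (simp_all add: pre_digraph.cas.simps chain_sel)
  have IH: "distinct (pre_digraph.awalk_verts G (snd e) p)"
    "\<forall>w\<in>set (pre_digraph.awalk_verts G (snd e) p). snd e \<le> w"
    using Cons.IH[OF _ e(3)] Cons.prems(1) by simp_all
  have "pre_digraph.awalk_verts G u (e # p) = u # pre_digraph.awalk_verts G (snd e) p"
    using e(1) by (simp add: pre_digraph.awalk_verts.simps chain_sel)
  moreover have "u \<notin> set (pre_digraph.awalk_verts G (snd e) p)" using IH(2) e(1,2) by force
  moreover have "\<forall>w\<in>set (pre_digraph.awalk_verts G (snd e) p). u \<le> w" using IH(2) e(1,2) by force
  ultimately show ?case using IH(1) by simp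
qed (simp add: pre_digraph.awalk_verts.simps)

lemma chain_paths: "st_paths G 0 (2 * N) = range (\<lambda>J. path J 0)"
proof (intro equalityI subsetI)
  fix p assume "p \<in> st_paths G 0 (2 * N)"
  then have "pre_digraph.cas G (2 * 0) p (2 * N)" "set p \<subseteq> arcs G"
    unfolding st_paths_def mem_Collect_eq pre_digraph.apath_def pre_digraph.awalk_def by simp_all
  from walk_is_path[OF this] show "p \<in> range (\<lambda>J. path J 0)" by blast
next
  fix p assume "p \<in> range (\<lambda>J. path J 0)"
  then obtain J where p: "p = path J 0" by blast
  have sub: "set p \<subseteq> arcs G"
  proof
    fix e assume "e \<in> set p"
    then obtain j where "j < N" "e \<in> set (seg J j)" unfolding p set_path by auto
    then show "e \<in> arcs G" unfolding chain_arcs seg_def by (auto split: if_splits)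
  qed
  have cas: "pre_digraph.cas G 0 p (2 * N)" using cas_path[of 0 J] unfolding p by simp
  have "\<forall>e\<in>set p. fst e < snd e" using sub unfolding chain_arcs by fastforce
  then have "distinct (pre_digraph.awalk_verts G 0 p)" using increasing_verts[OF _ cas] by blast
  moreover have "0 \<in> verts G" unfolding chain_verts by simp
  ultimately show "p \<in> st_paths G 0 (2 * N)"
    unfolding st_paths_def mem_Collect_eq pre_digraph.apath_def pre_digraph.awalk_def
    using sub cas by blast
qed

private lemma finite_paths: "finite (st_paths G 0 (2 * N))"
proof -
  have "range (\<lambda>J. path J 0) \<subseteq> (\<lambda>J. path J 0) ` Pow {0..<N}"
  proof
    fix p assume "p \<in> range (\<lambda>J. path J 0)"
    then obtain J where p: "p = path J 0" by blast
    have "path J 0 = path (J \<inter> {0..<N}) 0" by (rule path_cong) auto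
    then show "p \<in> (\<lambda>J. path J 0) ` Pow {0..<N}" unfolding p by (intro image_eqI[of _ _ "J \<inter> {0..<N}"]) auto
  qed
  then show ?thesis unfolding chain_paths by (rule finite_subset) simp
qed

private lemma mem_path:
  assumes "j < N"
  shows "(2 * j, 2 * j + 1) \<in> set (path J 0) \<longleftrightarrow> j \<in> J"
    "(2 * j, 2 * j + 2) \<in> set (path J 0) \<longleftrightarrow> j \<notin> J"
    "(2 * j + 1, 2 * j + 2) \<in> set (path J 0) \<longleftrightarrow> j \<in> J"
proof -
  \<comment> \<open>The edges of stage \<open>i\<close> start at \<open>2 * i\<close> or
    \<open>2 * i + 1\<close>, so halving the tail recovers the stage.\<close>
  have d: "fst e div 2 = i" if "e \<in> set (seg J i)" for e i
    using that by (auto simp: seg_def split: if_splits)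
  have "e \<in> set (path J 0) \<longleftrightarrow> fst e div 2 < N \<and> e \<in> set (seg J (fst e div 2))" for e
  proof
    assume "e \<in> set (path J 0)"
    then obtain i where "i < N" "e \<in> set (seg J i)" unfolding set_path by auto
    then show "fst e div 2 < N \<and> e \<in> set (seg J (fst e div 2))" using d by simp
  next
    assume "fst e div 2 < N \<and> e \<in> set (seg J (fst e div 2))"
    then show "e \<in> set (path J 0)" unfolding set_path by (intro UN_I[of "fst e div 2"]) auto
  qed
  then show "(2 * j, 2 * j + 1) \<in> set (path J 0) \<longleftrightarrow> j \<in> J"
    "(2 * j, 2 * j + 2) \<in> set (path J 0) \<longleftrightarrow> j \<notin> J"
    "(2 * j + 1, 2 * j + 2) \<in> set (path J 0) \<longleftrightarrow> j \<in> J"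
    using assms by (simp_all add: seg_def)
qed

private lemma delay_path:
  "path_delay (inst_delay I) (path J 0) = (\<Sum>j<N. if j \<in> J then fst (xys ! j) else snd (xys ! j))"
proof -
  have "path_delay (inst_delay I) (path J 0) = (\<Sum>j\<in>{0..<N}. \<Sum>e\<in>set (seg J j). inst_delay I e)"
    unfolding path_delay_def set_path
    by (rule sum.UNION_disjoint) (auto simp: seg_def split: if_splits)
  also have "\<dots> = (\<Sum>j\<in>{0..<N}. if j \<in> J then fst (xys ! j) else snd (xys ! j))"
  proof (rule sum.cong[OF refl])
    fix j assume "j \<in> {0..<N}"
    then have j: "j < N" by simp
    show "(\<Sum>e\<in>set (seg J j). inst_delay I e) = (if j \<in> J then fst (xys ! j) else snd (xys ! j))"
      using chain_edge_values(1-3)[OF j] by (simp add: seg_def)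
  qed
  finally show ?thesis by (simp add: lessThan_atLeast0)
qed

lemma chain_yes:
  assumes "0 < N" and total: "(\<Sum>j<N. fst (xys ! j) + snd (xys ! j)) = 2 * D"
  shows "mmd_yes I \<longleftrightarrow> (\<exists>J. (\<Sum>j<N. if j \<in> J then fst (xys ! j) else snd (xys ! j)) = D)"
proof
  let ?P = "st_paths G 0 (2 * N)"
  let ?d = "path_delay (inst_delay I)"
  assume "mmd_yes I"
  then obtain f where ff: "feasible_flow G (inst_capacity I) 0 (2 * N) 2 f"
    and md: "max_delay G (inst_delay I) 0 (2 * N) f \<le> D"
    unfolding mmd_yes_def chain_sel by blast
  have f: "\<And>p. p \<in> ?P \<Longrightarrow> 0 \<le> f p" "(\<Sum>p\<in>?P. f p) = 2"
    "\<And>e. e \<in> arcs G \<Longrightarrow> edge_rate G 0 (2 * N) f e \<le> 1"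
  proof -
    show "0 \<le> f p" if "p \<in> ?P" for p using ff that unfolding feasible_flow_def by blast
    show "(\<Sum>p\<in>?P. f p) = 2" using ff unfolding feasible_flow_def by (metis of_nat_numeral)
    show "edge_rate G 0 (2 * N) f e \<le> 1" if e: "e \<in> arcs G" for e
    proof -
      have "edge_rate G 0 (2 * N) f e \<le> real (inst_capacity I e)"
        using ff e unfolding feasible_flow_def by blast
      also have "\<dots> = 1" unfolding chain_edge_values(4)[OF assms(1) e] by (rule of_nat_1)
      finally show ?thesis .
    qed
  qed
  have delay: "?d p \<le> D" if "p \<in> ?P" "0 < f p" for p
  proof -
    have "?d p \<le> Max (?d ` {p \<in> ?P. 0 < f p})"
      using that finite_paths by (intro Max_ge) auto
    then show ?thesis using md unfolding max_delay_def by linarith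
  qed
  \<comment> \<open>Every path uses exactly one of the two edges; their capacities are 1 and the
    total rate is 2, so both are full.\<close>
  have rates: "edge_rate G 0 (2 * N) f (2 * j, 2 * j + 1) = 1 \<and> edge_rate G 0 (2 * N) f (2 * j, 2 * j + 2) = 1"
    if j: "j < N" for j
  proof -
    let ?A = "{p \<in> ?P. (2 * j, 2 * j + 1) \<in> set p}" and ?B = "{p \<in> ?P. (2 * j, 2 * j + 2) \<in> set p}"
    have excl: "(2 * j, 2 * j + 1) \<in> set p \<longleftrightarrow> (2 * j, 2 * j + 2) \<notin> set p" if p: "p \<in> ?P" for p
    proof -
      obtain J where "p = path J 0" using p unfolding chain_paths by blast
      then show ?thesis using mem_path(1,2)[OF j, of J] by simp
    qed
    have un: "?P = ?A \<union> ?B" and disj: "?A \<inter> ?B = {}"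
      using excl by blast+
    have "sum f ?P = sum f (?A \<union> ?B)" by (rule arg_cong[OF un])
    also have "\<dots> = sum f ?A + sum f ?B"
      by (rule sum.union_disjoint[OF _ _ disj]) (simp_all add: finite_paths)
    finally have "(\<Sum>p\<in>?P. f p) = edge_rate G 0 (2 * N) f (2 * j, 2 * j + 1) + edge_rate G 0 (2 * N) f (2 * j, 2 * j + 2)"
      unfolding edge_rate_def .
    moreover have "(2 * j, 2 * j + 1) \<in> arcs G" "(2 * j, 2 * j + 2) \<in> arcs G"
      using j by (auto simp: chain_arcs)
    ultimately show ?thesis using f(2) f(3)[of "(2 * j, 2 * j + 1)"] f(3)[of "(2 * j, 2 * j + 2)"] by simp
  qed
  have d_eq: "real (?d p) = (\<Sum>j<N. (if (2 * j, 2 * j + 1) \<in> set p then real (fst (xys ! j)) else 0) +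
      (if (2 * j, 2 * j + 2) \<in> set p then real (snd (xys ! j)) else 0))" if p: "p \<in> ?P" for p
  proof -
    obtain J where J: "p = path J 0" using p unfolding chain_paths by blast
    show ?thesis unfolding J delay_path of_nat_sum
    proof (rule sum.cong[OF refl])
      fix j assume "j \<in> {..<N}"
      then have "j < N" by simp
      from mem_path(1,2)[OF this, of J]
      show "real (if j \<in> J then fst (xys ! j) else snd (xys ! j)) =
        (if (2 * j, 2 * j + 1) \<in> set (path J 0) then real (fst (xys ! j)) else 0) +
        (if (2 * j, 2 * j + 2) \<in> set (path J 0) then real (snd (xys ! j)) else 0)" by simp
    qed
  qed
  let ?r1 = "\<lambda>j. edge_rate G 0 (2 * N) f (2 * j, 2 * j + 1)"
  let ?r2 = "\<lambda>j. edge_rate G 0 (2 * N) f (2 * j, 2 * j + 2)"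
  \<comment> \<open>The following equations exchange the sums over paths and over stages. As all
    these edges are full, the rate-weighted delay is the sum of all delays, whichever feasible flow
    was given.\<close>
  have 1: "(\<Sum>p\<in>?P. f p * real (?d p)) = (\<Sum>p\<in>?P. \<Sum>j<N.
      (if (2 * j, 2 * j + 1) \<in> set p then f p else 0) * real (fst (xys ! j)) +
      (if (2 * j, 2 * j + 2) \<in> set p then f p else 0) * real (snd (xys ! j)))"
  proof (rule sum.cong[OF refl])
    fix p assume "p \<in> ?P"
    show "f p * real (?d p) = (\<Sum>j<N.
      (if (2 * j, 2 * j + 1) \<in> set p then f p else 0) * real (fst (xys ! j)) +
      (if (2 * j, 2 * j + 2) \<in> set p then f p else 0) * real (snd (xys ! j)))"
      unfolding d_eq[OF \<open>p \<in> ?P\<close>] sum_distrib_left by (rule sum.cong) (simp_all add: distrib_left)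
  qed
  have 2: "(\<Sum>p\<in>?P. \<Sum>j<N.
      (if (2 * j, 2 * j + 1) \<in> set p then f p else 0) * real (fst (xys ! j)) +
      (if (2 * j, 2 * j + 2) \<in> set p then f p else 0) * real (snd (xys ! j))) = (\<Sum>j<N. (\<Sum>p\<in>?P. if (2 * j, 2 * j + 1) \<in> set p then f p else 0) * real (fst (xys ! j)) +
      (\<Sum>p\<in>?P. if (2 * j, 2 * j + 2) \<in> set p then f p else 0) * real (snd (xys ! j)))"
    by (subst sum.swap) (simp add: sum.distrib sum_distrib_right)
  have 3: "(\<Sum>j<N. (\<Sum>p\<in>?P. if (2 * j, 2 * j + 1) \<in> set p then f p else 0) * real (fst (xys ! j)) +
      (\<Sum>p\<in>?P. if (2 * j, 2 * j + 2) \<in> set p then f p else 0) * real (snd (xys ! j))) = (\<Sum>j<N. ?r1 j * real (fst (xys ! j)) + ?r2 j * real (snd (xys ! j)))"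
    unfolding edge_rate_def sum.inter_filter[OF finite_paths] by (rule refl)
  have 4: "(\<Sum>j<N. ?r1 j * real (fst (xys ! j)) + ?r2 j * real (snd (xys ! j))) = (\<Sum>j<N. real (fst (xys ! j) + snd (xys ! j)))"
    by (rule sum.cong) (use rates in auto)
  have 5: "(\<Sum>j<N. real (fst (xys ! j) + snd (xys ! j))) = 2 * real D"
    using arg_cong[OF total, of real] by simp
  have "(\<Sum>p\<in>?P. f p * real (?d p)) = 2 * real D"
    by (rule trans[OF 1 trans[OF 2 trans[OF 3 trans[OF 4 5]]]])
  \<comment> \<open>With total rate 2 the deviations from \<open>D\<close>, weighted by the rates,
    add up to zero; none is negative, so each vanishes.\<close>
  then have "(\<Sum>p\<in>?P. f p * (real D - real (?d p))) = 0"
    using f(2) by (simp add: right_diff_distrib sum_subtractf flip: sum_distrib_right)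
  moreover have nonneg: "0 \<le> f p * (real D - real (?d p))" if "p \<in> ?P" for p
    using f(1)[OF that] delay[OF that] by (cases "f p = 0") auto
  ultimately have zero: "\<forall>p\<in>?P. f p * (real D - real (?d p)) = 0"
    using sum_nonneg_eq_0_iff[OF finite_paths nonneg] by simp
  obtain p where p: "p \<in> ?P" "f p \<noteq> 0"
    using f(2) sum.neutral[of ?P f] by fastforce
  then have "?d p = D" using zero by auto
  then show "\<exists>J. (\<Sum>j<N. if j \<in> J then fst (xys ! j) else snd (xys ! j)) = D"
    using p(1) delay_path unfolding chain_paths by auto
next
  let ?P = "st_paths G 0 (2 * N)"
  assume "\<exists>J. (\<Sum>j<N. if j \<in> J then fst (xys ! j) else snd (xys ! j)) = D"
  then obtain J where J: "(\<Sum>j<N. if j \<in> J then fst (xys ! j) else snd (xys ! j)) = D" by blast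
  have "(\<Sum>j<N. if j \<in> J then fst (xys ! j) else snd (xys ! j)) +
      (\<Sum>j<N. if j \<in> - J then fst (xys ! j) else snd (xys ! j)) = 2 * D"
    unfolding sum.distrib[symmetric] total[symmetric] by (rule sum.cong) auto
  with J have J': "(\<Sum>j<N. if j \<in> - J then fst (xys ! j) else snd (xys ! j)) = D" by simp
  let ?p = "path J 0" and ?q = "path (- J) 0"
  \<comment> \<open>As a sum of two indicators this has total rate 2 whether or not the two paths
    are compared.\<close>
  define f :: "(nat \<times> nat) list \<Rightarrow> real" where "f = (\<lambda>p. (if p = ?p then 1 else 0) + (if p = ?q then 1 else 0))"
  have mem: "?p \<in> ?P" "?q \<in> ?P" by (auto simp: chain_paths)
  have sum_f: "(\<Sum>p\<in>{p \<in> ?P. Q p}. f p) = of_bool (Q ?p) + of_bool (Q ?q)" for Q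
    using mem finite_paths by (simp add: f_def sum.distrib)
  have rate: "edge_rate G 0 (2 * N) f e \<le> 1" if "e \<in> arcs G" for e
  proof -
    obtain j where j: "j < N" "e \<in> {(2 * j, 2 * j + 1), (2 * j + 1, 2 * j + 2), (2 * j, 2 * j + 2)}"
      using \<open>e \<in> arcs G\<close> unfolding chain_arcs by blast
    \<comment> \<open>\<open>J\<close> and its complement lead the two paths over different edges in
      every stage.\<close>
    have "e \<notin> set ?p \<or> e \<notin> set ?q"
      using j(2) by (auto simp only: insert_iff empty_iff mem_path[OF j(1)] Compl_iff)
    then show ?thesis unfolding edge_rate_def sum_f by auto
  qed
  have sum2: "(\<Sum>p\<in>?P. f p) = real 2" using sum_f[of "\<lambda>_. True"] by simp
  have nonneg: "0 \<le> f p" for p by (simp add: f_def)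
  have cap: "edge_rate G 0 (2 * N) f e \<le> real (inst_capacity I e)" if e: "e \<in> arcs G" for e
    using rate[OF e] chain_edge_values(4)[OF assms(1) e] by linarith
  have "feasible_flow G (inst_capacity I) 0 (2 * N) 2 f"
    unfolding feasible_flow_def using nonneg sum2 cap by blast
  moreover have "max_delay G (inst_delay I) 0 (2 * N) f \<le> D"
    unfolding max_delay_def
  proof (subst Max_le_iff)
    show "finite (path_delay (inst_delay I) ` {p \<in> ?P. 0 < f p})" using finite_paths by simp
    show "path_delay (inst_delay I) ` {p \<in> ?P. 0 < f p} \<noteq> {}" using mem(1) by (auto simp: f_def)
    show "\<forall>a\<in>path_delay (inst_delay I) ` {p \<in> ?P. 0 < f p}. a \<le> D"
    proof
      fix a assume "a \<in> path_delay (inst_delay I) ` {p \<in> ?P. 0 < f p}"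
      then obtain p where p: "0 < f p" "a = path_delay (inst_delay I) p" by blast
      have "p = ?p \<or> p = ?q"
      proof (rule ccontr)
        assume "\<not> (p = ?p \<or> p = ?q)"
        then have "f p = 0" unfolding f_def by simp
        with p(1) show False by simp
      qed
      then show "a \<le> D" using J J' delay_path[of J] delay_path[of "- J"] unfolding p(2) by (elim disjE) simp_all
    qed
  qed
  ultimately show "mmd_yes I" unfolding mmd_yes_def chain_sel by blast
qed

end

definition subset_sum :: "nat list \<Rightarrow> nat \<Rightarrow> bool" where
  "subset_sum as S \<longleftrightarrow> (\<exists>J\<subseteq>{..<length as}. (\<Sum>j\<in>J. as ! j) = S)"

text \<open>The last stage makes both sides of the partition equally long exactly if one of them
  sums to \<open>S\<close>.\<close>

definition subset_sum_inst :: "nat list \<Rightarrow> nat \<Rightarrow> inst_tuple" where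
  "subset_sum_inst as S =
     chain_inst (map (\<lambda>a. (a, 0)) as @ [(sum_list as, 2 * S)]) (sum_list as + S)"

theorem subset_sum_inst_correct:
  "encode (mk_inst (subset_sum_inst as S)) \<in> Min_Max_Delay \<longleftrightarrow> subset_sum as S"
proof -
  let ?x = "map (\<lambda>a. (a, 0)) as @ [(sum_list as, 2 * S)]"
  let ?A = "sum_list as" and ?n = "length as"
  have nth: "?x ! j = (as ! j, 0)" if "j < ?n" for j using that by (simp add: nth_append)
  have last: "?x ! ?n = (?A, 2 * S)" by (simp add: nth_append)
  have A: "(\<Sum>j<?n. as ! j) = ?A" by (simp add: sum_list_sum_nth lessThan_atLeast0)
  have tot: "(\<Sum>j<length ?x. fst (?x ! j) + snd (?x ! j)) = 2 * (?A + S)"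
    using A by (simp add: last nth)
  have split: "(\<Sum>j<length ?x. if j \<in> J then fst (?x ! j) else snd (?x ! j)) =
      (\<Sum>j\<in>J \<inter> {..<?n}. as ! j) + (if ?n \<in> J then ?A else 2 * S)" for J
  proof -
    have "(\<Sum>j<?n. if j \<in> J then fst (?x ! j) else snd (?x ! j)) = (\<Sum>j<?n. if j \<in> J then as ! j else 0)"
      by (rule sum.cong) (simp_all add: nth)
    also have "\<dots> = (\<Sum>j\<in>J \<inter> {..<?n}. as ! j)"
      by (simp add: sum.inter_restrict[symmetric] Int_commute)
    finally show ?thesis by (simp add: last)
  qed
  have yes: "mmd_yes (mk_inst (chain_inst ?x (?A + S))) \<longleftrightarrow>
      (\<exists>J. (\<Sum>j<length ?x. if j \<in> J then fst (?x ! j) else snd (?x ! j)) = ?A + S)"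
    by (rule chain_yes[of ?x "?A + S", OF _ tot]) simp
  have "encode (mk_inst (subset_sum_inst as S)) \<in> Min_Max_Delay \<longleftrightarrow> mmd_yes (mk_inst (subset_sum_inst as S))"
    using wf_chain[of ?x] by (auto simp: Min_Max_Delay_def encode_inject subset_sum_inst_def)
  also have "\<dots> \<longleftrightarrow> (\<exists>J. (\<Sum>j\<in>J \<inter> {..<?n}. as ! j) + (if ?n \<in> J then ?A else 2 * S) = ?A + S)"
    unfolding subset_sum_inst_def yes split by (rule refl)
  also have "\<dots> \<longleftrightarrow> subset_sum as S"
  proof
    assume "\<exists>J. (\<Sum>j\<in>J \<inter> {..<?n}. as ! j) + (if ?n \<in> J then ?A else 2 * S) = ?A + S"
    then obtain J where J: "(\<Sum>j\<in>J \<inter> {..<?n}. as ! j) + (if ?n \<in> J then ?A else 2 * S) = ?A + S" by blast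
    show "subset_sum as S"
    proof (cases "?n \<in> J")
      case True
      then show ?thesis using J unfolding subset_sum_def by (intro exI[of _ "J \<inter> {..<?n}"]) auto
    next
      \<comment> \<open>Here the chosen numbers add up to \<open>?A - S\<close>, so the others add
        up to \<open>S\<close>.\<close>
      case False
      have "(\<Sum>j\<in>J \<inter> {..<?n}. as ! j) + (\<Sum>j\<in>{..<?n} - J. as ! j) = ?A"
        unfolding A[symmetric] by (subst sum.union_disjoint[symmetric]) (auto intro!: sum.cong)
      with J False have "(\<Sum>j\<in>{..<?n} - J. as ! j) = S" by simp
      then show ?thesis unfolding subset_sum_def by (intro exI[of _ "{..<?n} - J"]) auto
    qed
  next
    assume "subset_sum as S"
    then obtain J where "J \<subseteq> {..<?n}" "(\<Sum>j\<in>J. as ! j) = S" by (auto simp: subset_sum_def)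
    then show "\<exists>J. (\<Sum>j\<in>J \<inter> {..<?n}. as ! j) + (if ?n \<in> J then ?A else 2 * S) = ?A + S"
      by (intro exI[of _ "insert ?n J"]) (auto simp: Int_absorb2 insert_Diff_if)
  qed
  finally show ?thesis .
qed

lemma ptime_subset_sum_inst:
  assumes "ptime A as" "ptime A S"
  shows "ptime A (\<lambda>x. encode (mk_inst (subset_sum_inst (as x) (S x))))"
proof -
  let ?x = "\<lambda>x. map (\<lambda>a. (a, 0)) (as x) @ [(sum_list (as x), 2 * S x)]"
  have x: "ptime A ?x"
    by (intro ptime_append ptime_map ptime_Cons ptime_Pair ptime_sum_list ptime_mult assms ptime_const
        ptime_snd ptime_id)
  have len: "ptime A (\<lambda>x. length (?x x))" by (intro ptime_length x)
  have b: "pbound A (\<lambda>x. length (?x x))"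
    by (rule pbound_mono[OF ptime_esize[OF x]]) (rule length_le_esize)
  have e: "ptime A (\<lambda>x. chain_edges (?x x))"
    unfolding chain_edges_def stage_edges_def
    by (intro ptime_concat ptime_map ptime_zip ptime_upt len b x ptime_Cons ptime_Pair ptime_add
        ptime_mult ptime_fst ptime_snd ptime_id ptime_const)
  show ?thesis
    unfolding subset_sum_inst_def chain_inst_def
    by (intro ptime_encode ptime_Pair ptime_upt ptime_Suc ptime_mult ptime_add ptime_const len e
        ptime_sum_list assms pbound_Suc pbound_mult pbound_const b)
qed

section \<open>Vectors as numbers\<close>

text \<open>Entries at the same position add up, so that concatenation of lists is addition of
  vectors.\<close>

definition vec :: "('p \<times> nat) list \<Rightarrow> 'p \<Rightarrow> nat" where
  "vec l p = sum_list (map (\<lambda>z. if fst z = p then snd z else 0) l)"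

lemma vec_simps [simp]:
  "vec [] p = 0" "vec (z # l) p = (if fst z = p then snd z else 0) + vec l p"
  "vec (l @ l') p = vec l p + vec l' p"
  by (simp_all add: vec_def)

lemma vec_concat_upt: "vec (concat (map F [0..<n])) p = (\<Sum>j<n. vec (F j) p)"
  by (induction n) auto

lemma vec_eq_0: "p \<notin> fst ` set l \<Longrightarrow> vec l p = 0"
  by (induction l) auto

lemma vec_map_distinct: "distinct ps \<Longrightarrow> vec (map (\<lambda>p. (p, f p)) ps) p = (if p \<in> set ps then f p else 0)"
  by (induction ps) auto

lemma vec_le_sum: "vec l p \<le> sum_list (map snd l)"
  by (induction l) auto

definition numeral_of :: "nat \<Rightarrow> (nat \<times> nat) list \<Rightarrow> nat" where
  "numeral_of B l = sum_list (map (\<lambda>z. snd z * B ^ fst z) l)"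

lemma numeral_of_vec:
  assumes "\<forall>z\<in>set l. fst z < n"
  shows "numeral_of B l = (\<Sum>k<n. vec l k * B ^ k)"
  using assms
proof (induction l)
  case (Cons z l)
  have "(\<Sum>k<n. vec (z # l) k * B ^ k) = (\<Sum>k<n. if k = fst z then snd z * B ^ k else 0) + (\<Sum>k<n. vec l k * B ^ k)"
    unfolding sum.distrib[symmetric] by (rule sum.cong) (auto simp: algebra_simps)
  then show ?case using Cons by (simp add: numeral_of_def)
qed (simp add: numeral_of_def)

lemma digits_unique:
  fixes a b :: "nat \<Rightarrow> nat"
  assumes "\<forall>k<n. a k < B" "\<forall>k<n. b k < B" "(\<Sum>k<n. a k * B ^ k) = (\<Sum>k<n. b k * B ^ k)"
  shows "\<forall>k<n. a k = b k"
  using assms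
proof (induction n arbitrary: a b)
  case (Suc n)
  have shift: "(\<Sum>k<Suc n. c k * B ^ k) = c 0 + B * (\<Sum>k<n. c (Suc k) * B ^ k)" for c :: "nat \<Rightarrow> nat"
    unfolding sum.lessThan_Suc_shift by (simp add: sum_distrib_left ac_simps)
  have B: "a 0 < B" "b 0 < B" using Suc.prems by auto
  have eq: "a 0 + B * (\<Sum>k<n. a (Suc k) * B ^ k) = b 0 + B * (\<Sum>k<n. b (Suc k) * B ^ k)"
    using Suc.prems(3) unfolding shift .
  from arg_cong[OF eq, of "\<lambda>x. x mod B"] have "a 0 = b 0" using B by simp
  moreover from this eq B have "(\<Sum>k<n. a (Suc k) * B ^ k) = (\<Sum>k<n. b (Suc k) * B ^ k)" by simp
  then have "\<forall>k<n. a (Suc k) = b (Suc k)"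
    using Suc.prems by (intro Suc.IH) auto
  ultimately show ?case using less_Suc_eq_0_disj by auto
qed simp

text \<open>The base exceeds the sum of all entries, so no selection causes a carry, and two numbers
  agree exactly if all their digits do.\<close>

lemma subset_sum_numerals:
  assumes B: "sum_list (map (\<lambda>l. sum_list (map snd l)) ls) < B" "sum_list (map snd tgt) < B"
  shows "subset_sum (map (numeral_of B) ls) (numeral_of B tgt) \<longleftrightarrow>
    (\<exists>J\<subseteq>{..<length ls}. \<forall>k. (\<Sum>j\<in>J. vec (ls ! j) k) = vec tgt k)"
proof -
  have "(\<Sum>j\<in>J. map (numeral_of B) ls ! j) = numeral_of B tgt \<longleftrightarrow>
      (\<forall>k. (\<Sum>j\<in>J. vec (ls ! j) k) = vec tgt k)" if J: "J \<subseteq> {..<length ls}" for J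
  proof -
    have fin: "finite J" using J finite_subset by blast
    let ?F = "fst ` (set tgt \<union> (\<Union>l\<in>set ls. set l))"
    \<comment> \<open>All positions that occur anywhere lie below \<open>n\<close>, so only the
      first \<open>n\<close> digits matter.\<close>
    obtain n where n: "\<forall>k\<in>?F. k < n"
      using finite_nat_set_iff_bounded[of ?F] by auto
    have n1: "\<forall>z\<in>set (ls ! j). fst z < n" if "j \<in> J" for j
    proof
      fix z assume "z \<in> set (ls ! j)"
      moreover have "ls ! j \<in> set ls" using that J by auto
      ultimately show "fst z < n" using n by blast
    qed
    have n2: "\<forall>z\<in>set tgt. fst z < n" using n by blast
    have "(\<Sum>j\<in>J. map (numeral_of B) ls ! j) = (\<Sum>j\<in>J. \<Sum>k<n. vec (ls ! j) k * B ^ k)"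
      using J n1 by (intro sum.cong) (auto simp: numeral_of_vec)
    also have "\<dots> = (\<Sum>k<n. (\<Sum>j\<in>J. vec (ls ! j) k) * B ^ k)"
      by (subst sum.swap) (simp add: sum_distrib_right)
    finally have 1: "(\<Sum>j\<in>J. map (numeral_of B) ls ! j) = (\<Sum>k<n. (\<Sum>j\<in>J. vec (ls ! j) k) * B ^ k)" .
    have 2: "numeral_of B tgt = (\<Sum>k<n. vec tgt k * B ^ k)" by (rule numeral_of_vec[OF n2])
    have b1: "(\<Sum>j\<in>J. vec (ls ! j) k) < B" for k
    proof -
      have "(\<Sum>j\<in>J. vec (ls ! j) k) \<le> (\<Sum>j<length ls. vec (ls ! j) k)"
        using J by (intro sum_mono2) auto
      also have "\<dots> \<le> (\<Sum>j<length ls. sum_list (map snd (ls ! j)))"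
        by (intro sum_mono vec_le_sum)
      also have "\<dots> = sum_list (map (\<lambda>l. sum_list (map snd l)) ls)"
        by (simp add: sum_list_sum_nth lessThan_atLeast0)
      finally show ?thesis using B(1) by simp
    qed
    have b2: "vec tgt k < B" for k using vec_le_sum[of tgt k] B(2) by simp
    have out: "(\<Sum>j\<in>J. vec (ls ! j) k) = 0 \<and> vec tgt k = 0" if "\<not> k < n" for k
      using n1 n2 that by (auto intro!: vec_eq_0 sum.neutral)
    show ?thesis
    proof
      assume "(\<Sum>j\<in>J. map (numeral_of B) ls ! j) = numeral_of B tgt"
      then have *: "\<forall>k<n. (\<Sum>j\<in>J. vec (ls ! j) k) = vec tgt k"
        unfolding 1 2 using b1 b2 by (intro digits_unique) auto
      show "\<forall>k. (\<Sum>j\<in>J. vec (ls ! j) k) = vec tgt k"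
      proof
        fix k show "(\<Sum>j\<in>J. vec (ls ! j) k) = vec tgt k"
          using * out[of k] by (cases "k < n") simp_all
      qed
    qed (simp only: 1 2)
  qed
  then show ?thesis unfolding subset_sum_def by auto
qed

type_synonym pos = "nat \<times> nat \<times> nat \<times> nat"

text \<open>Mixed radix: inside the box a position becomes a digit index that is polynomial in
  \<open>N\<close>.\<close>

definition pos_index :: "nat \<Rightarrow> pos \<Rightarrow> nat" where
  "pos_index N p = fst p + N * (fst (snd p) + N * (fst (snd (snd p)) + N * snd (snd (snd p))))"

definition pos_box :: "nat \<Rightarrow> pos set" where
  "pos_box N = {..<N} \<times> {..<N} \<times> {..<N} \<times> {..<N}"

lemma mixed_radix_inject:
  fixes a b x y N :: nat
  assumes "a < N" "b < N" shows "a + N * x = b + N * y \<longleftrightarrow> a = b \<and> x = y"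
proof
  assume eq: "a + N * x = b + N * y"
  from arg_cong[OF eq, of "\<lambda>x. x mod N"] have "a = b" using assms by simp
  with eq assms show "a = b \<and> x = y" by auto
qed simp

lemma inj_on_pos_index: "inj_on (pos_index N) (pos_box N)"
  by (rule inj_onI) (auto simp: pos_index_def pos_box_def mixed_radix_inject)

definition index_vec :: "nat \<Rightarrow> (pos \<times> nat) list \<Rightarrow> (nat \<times> nat) list" where
  "index_vec N l = map (\<lambda>z. (pos_index N (fst z), snd z)) l"

lemma vec_index_vec:
  assumes "fst ` set l \<subseteq> pos_box N" "p \<in> pos_box N"
  shows "vec (index_vec N l) (pos_index N p) = vec l p"
  using assms
proof (induction l)
  case (Cons z l)
  then have "pos_index N (fst z) = pos_index N p \<longleftrightarrow> fst z = p"
    using inj_on_pos_index[of N] by (auto simp: inj_on_def)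
  with Cons show ?case by (auto simp: index_vec_def)
qed (simp add: index_vec_def)

definition vectors_base :: "(pos \<times> nat) list list \<Rightarrow> (pos \<times> nat) list \<Rightarrow> nat" where
  "vectors_base ls tgt = Suc (sum_list (map (\<lambda>l. sum_list (map snd l)) ls) + sum_list (map snd tgt))"

theorem subset_sum_vectors:
  fixes ls :: "(pos \<times> nat) list list" and f :: "pos \<Rightarrow> nat" and ps :: "pos list"
  defines "B \<equiv> vectors_base ls (map (\<lambda>p. (p, f p)) ps)"
  assumes ps: "distinct ps" "set ps \<subseteq> pos_box N" "\<forall>l\<in>set ls. fst ` set l \<subseteq> set ps"
  shows "subset_sum (map (\<lambda>l. numeral_of B (index_vec N l)) ls) (numeral_of B (index_vec N (map (\<lambda>p. (p, f p)) ps)))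
    \<longleftrightarrow> (\<exists>J\<subseteq>{..<length ls}. \<forall>p\<in>set ps. (\<Sum>j\<in>J. vec (ls ! j) p) = f p)"
proof -
  let ?t = "map (\<lambda>p. (p, f p)) ps"
  have snd_index: "map snd (index_vec N l) = map snd l" for l by (simp add: index_vec_def)
  have "sum_list (map (\<lambda>l. sum_list (map snd l)) (map (index_vec N) ls)) < B" "sum_list (map snd (index_vec N ?t)) < B"
    unfolding map_map comp_def snd_index B_def vectors_base_def by simp_all
  note * = subset_sum_numerals[OF this]
  have "subset_sum (map (\<lambda>l. numeral_of B (index_vec N l)) ls) (numeral_of B (index_vec N ?t)) \<longleftrightarrow>
    (\<exists>J\<subseteq>{..<length ls}. \<forall>k. (\<Sum>j\<in>J. vec (map (index_vec N) ls ! j) k) = vec (index_vec N ?t) k)"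
    using * unfolding map_map comp_def length_map .
  also have "\<dots> \<longleftrightarrow> (\<exists>J\<subseteq>{..<length ls}. \<forall>p\<in>set ps. (\<Sum>j\<in>J. vec (ls ! j) p) = f p)"
  proof (intro arg_cong[of _ _ Ex] ext conj_cong refl)
    fix J assume J: "J \<subseteq> {..<length ls}"
    have box: "fst ` set (ls ! j) \<subseteq> set ps" "map (index_vec N) ls ! j = index_vec N (ls ! j)" if "j \<in> J" for j
      using that J ps(3) nth_mem[of j ls] by (blast, simp add: subset_eq)
    have inside: "(\<Sum>j\<in>J. vec (map (index_vec N) ls ! j) (pos_index N p)) = (\<Sum>j\<in>J. vec (ls ! j) p) \<and>
        vec (index_vec N ?t) (pos_index N p) = f p" if p: "p \<in> set ps" for p
    proof -
      have "fst ` set ?t \<subseteq> pos_box N" using ps(2) by (auto simp: image_image)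
      then have "vec (index_vec N ?t) (pos_index N p) = vec ?t p"
        using p ps(2) by (intro vec_index_vec) auto
      moreover have "vec (map (index_vec N) ls ! j) (pos_index N p) = vec (ls ! j) p" if "j \<in> J" for j
        unfolding box(2)[OF that] using p ps(2) box(1)[OF that] by (intro vec_index_vec) blast+
      ultimately show ?thesis using vec_map_distinct[OF ps(1), of f p] p by simp
    qed
    \<comment> \<open>No entry reaches an index that comes from no position in \<open>ps\<close>, so
      such digits constrain nothing.\<close>
    have outside: "(\<Sum>j\<in>J. vec (map (index_vec N) ls ! j) k) = 0 \<and> vec (index_vec N ?t) k = 0"
      if "k \<notin> pos_index N ` set ps" for k
    proof
      have "vec (map (index_vec N) ls ! j) k = 0" if "j \<in> J" for j
        unfolding box(2)[OF that] using box(1)[OF that] \<open>k \<notin> pos_index N ` set ps\<close>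
        by (intro vec_eq_0) (force simp: index_vec_def)
      then show "(\<Sum>j\<in>J. vec (map (index_vec N) ls ! j) k) = 0" by simp
      show "vec (index_vec N ?t) k = 0"
        using that by (intro vec_eq_0) (auto simp: index_vec_def)
    qed
    show "(\<forall>k. (\<Sum>j\<in>J. vec (map (index_vec N) ls ! j) k) = vec (index_vec N ?t) k) \<longleftrightarrow>
      (\<forall>p\<in>set ps. (\<Sum>j\<in>J. vec (ls ! j) p) = f p)" (is "?L \<longleftrightarrow> ?R")
    proof
      assume L: ?L
      show ?R
      proof
        fix p assume "p \<in> set ps"
        with inside[of p] spec[OF L, of "pos_index N p"] show "(\<Sum>j\<in>J. vec (ls ! j) p) = f p" by simp
      qed
    next
      assume R: ?R
      show ?L
      proof
        fix k show "(\<Sum>j\<in>J. vec (map (index_vec N) ls ! j) k) = vec (index_vec N ?t) k"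
          using R inside outside[of k] by (cases "k \<in> pos_index N ` set ps") auto
      qed
    qed
  qed
  finally show ?thesis .
qed

lemma pos_index_less:
  assumes "p \<in> pos_box N" shows "pos_index N p < N * N * N * N"
proof -
  obtain a b c d where p: "p = (a, b, c, d)" by (cases p)
  have *: "a < N \<Longrightarrow> x < m \<Longrightarrow> a + N * x < m * N" for a x m :: nat
  proof -
    assume "a < N" "x < m"
    then have "a + N * x < N * Suc x" by simp
    also have "\<dots> \<le> N * m" using \<open>x < m\<close> by (intro mult_left_mono) auto
    finally show ?thesis by (simp add: mult.commute)
  qed
  show ?thesis using assms by (auto simp: p pos_box_def pos_index_def intro!: *)
qed

text \<open>The exponents are indices of positions in the box and hence at most \<open>N ^ 4\<close>
  in value; the powers can therefore be written out in full.\<close>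

lemma ptime_numeral_of:
  assumes B: "ptime A B" and l: "ptime A l" and N: "ptime A N" "pbound A N"
    and box: "\<And>x. x \<in> A \<Longrightarrow> fst ` set (l x) \<subseteq> pos_box (N x)"
  shows "ptime A (\<lambda>x. numeral_of (B x) (index_vec (N x) (l x)))"
proof -
  let ?S = "{z. fst z \<in> A \<and> snd z \<in> set (l (fst z))}"
  have B': "ptime ?S (\<lambda>z. B (fst z))" and N': "ptime ?S (\<lambda>z. N (fst z))"
    by (rule ptime_compose[OF ptime_fst[OF ptime_id] B], simp) (rule ptime_compose[OF ptime_fst[OF ptime_id] N(1)], simp)
  have "ptime ?S (\<lambda>z. pos_index (N (fst z)) (fst (snd z)))"
    unfolding pos_index_def by (intro ptime_add ptime_mult N' ptime_fst ptime_snd ptime_id)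
  moreover have "pbound ?S (\<lambda>z. pos_index (N (fst z)) (fst (snd z)))"
  proof (rule pbound_mono)
    show "pbound ?S (\<lambda>z. N (fst z) * N (fst z) * N (fst z) * N (fst z))"
      by (intro pbound_mult pbound_fst[OF N(2)])
    fix z assume "z \<in> ?S"
    then show "pos_index (N (fst z)) (fst (snd z)) \<le> N (fst z) * N (fst z) * N (fst z) * N (fst z)"
      using box[of "fst z"] by (intro less_imp_le pos_index_less) auto
  qed
  ultimately have "ptime A (\<lambda>x. sum_list (map (\<lambda>z. snd z * B x ^ pos_index (N x) (fst z)) (l x)))"
    by (intro ptime_sum_list ptime_map l ptime_mult ptime_power B' ptime_snd ptime_id)
  then show ?thesis by (simp add: numeral_of_def index_vec_def comp_def)
qed

section \<open>Turing machine computations as sums of vectors\<close>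

text \<open>Unlike \<^const>\<open>tm_delta\<close>, this also covers the halting state, which idles.\<close>

definition full_delta :: "tm \<Rightarrow> nat \<Rightarrow> nat list \<Rightarrow> nat \<times> (nat \<times> dir) list" where
  "full_delta M q ys = (if q < tm_states M then tm_delta M q ys else (q, noop ys))"

fun dir_code :: "dir \<Rightarrow> nat" where
  "dir_code Lft = 0"
| "dir_code Stay = 1"
| "dir_code Rgt = 2"

lemma shift_dir_code: "shift d = int (dir_code d) - 1"
  by (cases d) auto

definition conf :: "tm \<Rightarrow> bool list \<Rightarrow> nat \<Rightarrow> config" where
  "conf M z t = (step M ^^ t) (start M z)"

definition cell :: "tm \<Rightarrow> bool list \<Rightarrow> nat \<Rightarrow> nat \<Rightarrow> int \<Rightarrow> nat" where
  "cell M z t j i = fst (snd (conf M z t) ! j) i"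

definition hpos :: "tm \<Rightarrow> bool list \<Rightarrow> nat \<Rightarrow> nat \<Rightarrow> int" where
  "hpos M z t j = snd (snd (conf M z t) ! j)"

definition scan :: "tm \<Rightarrow> bool list \<Rightarrow> nat \<Rightarrow> nat list" where
  "scan M z t = map (\<lambda>T. fst T (snd T)) (snd (conf M z t))"

definition next_step :: "tm \<Rightarrow> bool list \<Rightarrow> nat \<Rightarrow> nat \<times> (nat \<times> dir) list" where
  "next_step M z t = full_delta M (fst (conf M z t)) (scan M z t)"

lemma full_delta_wf:
  assumes "wf_tm M" "q \<le> tm_states M" "length ys = tm_tapes M" "set ys \<subseteq> {..<tm_symbols M}"
  shows "fst (full_delta M q ys) \<le> tm_states M" "length (snd (full_delta M q ys)) = tm_tapes M"
    "j < tm_tapes M \<Longrightarrow> fst (snd (full_delta M q ys) ! j) < tm_symbols M"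
proof -
  show "fst (full_delta M q ys) \<le> tm_states M"
    using assms by (auto simp: full_delta_def wf_tm_def)
  show len: "length (snd (full_delta M q ys)) = tm_tapes M"
    using assms by (auto simp: full_delta_def wf_tm_def)
  assume j: "j < tm_tapes M"
  have "fst ` set (snd (full_delta M q ys)) \<subseteq> {..<tm_symbols M}"
    using assms by (auto simp: full_delta_def wf_tm_def noop_def)
  then show "fst (snd (full_delta M q ys) ! j) < tm_symbols M"
    using j len by (auto simp: image_subset_iff)
qed

lemma conf_step:
  assumes "length (snd (conf M z t)) = tm_tapes M" "length (snd (next_step M z t)) = tm_tapes M"
  shows "fst (conf M z (Suc t)) = fst (next_step M z t)"
    "length (snd (conf M z (Suc t))) = tm_tapes M"
    "j < tm_tapes M \<Longrightarrow> cell M z (Suc t) j i =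
       (if i = hpos M z t j then fst (snd (next_step M z t) ! j) else cell M z t j i)"
    "j < tm_tapes M \<Longrightarrow> hpos M z (Suc t) j = hpos M z t j + shift (snd (snd (next_step M z t) ! j))"
proof -
  have *: "conf M z (Suc t) = (fst (next_step M z t), map2 act (snd (conf M z t)) (snd (next_step M z t)))"
    using map2_act_noop[of "snd (conf M z t)"]
    by (cases "conf M z t")
       (simp add: conf_def step_def next_step_def full_delta_def scan_def Let_def)
  show "fst (conf M z (Suc t)) = fst (next_step M z t)"
    "length (snd (conf M z (Suc t))) = tm_tapes M"
    "j < tm_tapes M \<Longrightarrow> cell M z (Suc t) j i =
       (if i = hpos M z t j then fst (snd (next_step M z t) ! j) else cell M z t j i)"
    "j < tm_tapes M \<Longrightarrow> hpos M z (Suc t) j = hpos M z t j + shift (snd (snd (next_step M z t) ! j))"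
    using assms by (auto simp: * cell_def hpos_def act_def)
qed

lemma scan_symbols:
  assumes "length (snd (conf M z t)) = k" "\<And>j i. j < k \<Longrightarrow> cell M z t j i < c"
  shows "set (scan M z t) \<subseteq> {..<c}"
proof
  fix x assume "x \<in> set (scan M z t)"
  then obtain T where "T \<in> set (snd (conf M z t))" "x = fst T (snd T)" unfolding scan_def by auto
  then obtain j where "j < k" "x = fst (snd (conf M z t) ! j) (snd T)"
    using assms(1) by (metis in_set_conv_nth)
  then show "x \<in> {..<c}" using assms(2)[of j "snd T"] by (simp add: cell_def)
qed

text \<open>A head moves at most one cell per step. Hence the cells from \<open>-T\<close> to
  \<open>T\<close> suffice for \<open>T\<close> steps, which is the origin of
  \<open>width\<close>.\<close>

lemma conf_inv:
  assumes "wf_tm M"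
  shows "length (snd (conf M z t)) = tm_tapes M \<and> fst (conf M z t) \<le> tm_states M \<and>
    (\<forall>j<tm_tapes M. (\<forall>i. cell M z t j i < tm_symbols M) \<and> \<bar>hpos M z t j\<bar> \<le> int t)"
proof (induction t)
  case 0
  have k: "2 \<le> tm_tapes M" "3 \<le> tm_symbols M" using assms by (auto simp: wf_tm_def)
  have nth: "snd (conf M z 0) ! j = (contents (if j = 0 then z else []), 0)" if "j < tm_tapes M" for j
    using that by (cases j) (simp_all add: conf_def start_def)
  have "contents x i < 3" for x i by (simp add: contents_def)
  then have "cell M z 0 j i < tm_symbols M" if "j < tm_tapes M" for j i
    using nth[OF that] k(2) by (metis cell_def fst_conv less_le_trans)
  then show ?case using k nth by (simp add: hpos_def) (simp add: conf_def start_def)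
next
  case (Suc t)
  have IH: "length (snd (conf M z t)) = tm_tapes M" "fst (conf M z t) \<le> tm_states M"
    "\<And>j i. j < tm_tapes M \<Longrightarrow> cell M z t j i < tm_symbols M"
    "\<And>j. j < tm_tapes M \<Longrightarrow> \<bar>hpos M z t j\<bar> \<le> int t"
    using Suc by blast+
  have sl: "length (scan M z t) = tm_tapes M" unfolding scan_def length_map by (rule IH(1))
  have ss: "set (scan M z t) \<subseteq> {..<tm_symbols M}"
    by (rule scan_symbols[OF IH(1)]) (rule IH(3))
  note wf = full_delta_wf[OF assms IH(2) sl ss, folded next_step_def]
  note len = IH(1) wf(2)
  have shift: "\<bar>shift d\<bar> \<le> 1" for d by (cases d) auto
  show ?case
  proof (intro conjI allI impI)
    show "length (snd (conf M z (Suc t))) = tm_tapes M" by (rule conf_step(2)[OF len])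
    show "fst (conf M z (Suc t)) \<le> tm_states M" unfolding conf_step(1)[OF len] by (rule wf(1))
    fix j assume j: "j < tm_tapes M"
    show "cell M z (Suc t) j i < tm_symbols M" for i
      unfolding conf_step(3)[OF len j] using wf(3)[OF j] IH(3)[OF j] by simp
    show "\<bar>hpos M z (Suc t) j\<bar> \<le> int (Suc t)"
      unfolding conf_step(4)[OF len j]
      using IH(4)[OF j] shift[of "snd (snd (next_step M z t) ! j)"] by linarith
  qed
qed

type_synonym entry = "nat \<times> nat \<times> (nat \<times> nat \<times> nat) list"

definition entry_of :: "tm \<Rightarrow> nat \<Rightarrow> nat list \<Rightarrow> entry" where
  "entry_of M q ys = (q, fst (full_delta M q ys),
     map (\<lambda>z. (fst z, fst (snd z), dir_code (snd (snd z)))) (zip ys (snd (full_delta M q ys))))"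

text \<open>For a fixed machine this finite table is a constant of the reduction, whatever function
  \<open>tm_delta\<close> is.\<close>

definition delta_table :: "tm \<Rightarrow> entry list" where
  "delta_table M = map (\<lambda>z. entry_of M (fst z) (snd z))
     (List.product [0..<Suc (tm_states M)] (List.n_lists (tm_tapes M) [0..<tm_symbols M]))"

text \<open>
  A position \<open>(tag, t, j, i)\<close> names a linear constraint: exactly one control item at time \<open>t\<close> (tag \<open>0\<close>);
  agreement at time \<open>t\<close> of the position of head \<open>j\<close>, or of the state if \<open>j\<close> is the number of tapes
  (tag \<open>1\<close>); agreement at time \<open>t\<close> of the symbol in cell \<open>i\<close> of tape \<open>j\<close> (tag \<open>2\<close>); exactly one item
  handling this cell at time \<open>t\<close> (tag \<open>3\<close>); exactly one item for the \<open>i\<close>-th certificate cell (tag \<open>4\<close>);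
  exactly one start item (tag \<open>5\<close>). An item reading a value \<open>v\<close> contributes \<open>K - v\<close>, an item producing
  \<open>v\<close> contributes \<open>v\<close> (\<open>v + 1\<close> at tag \<open>1\<close>, to avoid subtraction for left moves), so that agreement
  means that the contributions add up to \<open>K\<close> (or \<open>K + 1\<close>).
\<close>

definition ctl_vec :: "nat \<Rightarrow> nat \<Rightarrow> nat \<Rightarrow> entry \<Rightarrow> nat list \<Rightarrow> (pos \<times> nat) list" where
  "ctl_vec k K t e hs =
     ((0, t, 0, 0), 1) # ((1, t, k, 0), K - fst e) # ((1, Suc t, k, 0), Suc (fst (snd e))) #
     concat (map (\<lambda>z. [((1, t, fst z, 0), K - fst (snd z)),
         ((1, Suc t, fst z, 0), fst (snd z) + snd (snd (snd (snd z)))),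
         ((3, t, fst z, fst (snd z)), 1),
         ((2, t, fst z, fst (snd z)), K - fst (snd (snd z))),
         ((2, Suc t, fst z, fst (snd z)), fst (snd (snd (snd z))))])
       (zip [0..<k] (zip hs (snd (snd e)))))"

text \<open>The item for a cell away from the head: the symbol it reads at time \<open>t\<close> is
  the one it produces for the next time.\<close>

definition keep_vec :: "nat \<Rightarrow> nat \<Rightarrow> nat \<Rightarrow> nat \<Rightarrow> nat \<Rightarrow> (pos \<times> nat) list" where
  "keep_vec K t j i a = [((3, t, j, i), 1), ((2, t, j, i), K - a), ((2, Suc t, j, i), a)]"

text \<open>The parameter \<open>l\<close> is the certificate length: the item itself satisfies the
  constraints of tag 4 from \<open>l\<close> on, which leaves those cells blank, so each of the
  first \<open>l\<close> cells needs a bit item. Cell \<open>0\<close> has coordinate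
  \<open>T\<close>, whence the head value \<open>Suc T\<close> with the offset of tag 1.\<close>

definition start_vec :: "nat \<Rightarrow> nat \<Rightarrow> nat \<Rightarrow> bool list \<Rightarrow> nat \<Rightarrow> (pos \<times> nat) list" where
  "start_vec k T P X l = ((5, 0, 0, 0), 1) # ((1, 0, k, 0), 1) #
     map (\<lambda>j. ((1, 0, j, 0), Suc T)) [0..<k] @
     map (\<lambda>z. ((2, 0, 0, T + fst z), if snd z then 2 else 1)) (zip [0..<length X] X) @
     map (\<lambda>i. ((4, 0, 0, i), 1)) (filter (\<lambda>i. l \<le> i) [0..<P])"

definition bit_vec :: "nat \<Rightarrow> nat \<Rightarrow> nat \<Rightarrow> (pos \<times> nat) list" where
  "bit_vec c i s = [((4, 0, 0, i), 1), ((2, 0, 0, c + i), s)]"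

definition positions :: "nat \<Rightarrow> nat \<Rightarrow> nat \<Rightarrow> nat \<Rightarrow> pos list" where
  "positions k T W P =
     map (\<lambda>t. (0, t, 0, 0)) [0..<T] @
     map (\<lambda>z. (1, fst z, snd z, 0)) (List.product [0..<Suc T] [0..<Suc k]) @
     map (\<lambda>z. (2, z)) (List.product [0..<Suc T] (List.product [0..<k] [0..<W])) @
     map (\<lambda>z. (3, z)) (List.product [0..<T] (List.product [0..<k] [0..<W])) @
     map (\<lambda>i. (4, 0, 0, i)) [0..<P] @ [(5, 0, 0, 0)]"

text \<open>The exception is the first output cell at time \<open>T\<close>, where exactly the
  symbol of \<open>True\<close> must have been produced; acceptance is one entry of the target
  vector.\<close>

definition target :: "nat \<Rightarrow> nat \<Rightarrow> pos \<Rightarrow> nat" where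
  "target K T p = (if fst p = 1 then Suc K
     else if fst p = 2 then (if fst (snd p) = T \<and> fst (snd (snd p)) = 1 \<and> snd (snd (snd p)) = T then 2 else K)
     else 1)"

text \<open>At time \<open>T\<close> no item reads any more, so the complements are missing there;
  slack items supply them, except at the output cell.\<close>

definition is_slack_pos :: "nat \<Rightarrow> pos \<Rightarrow> bool" where
  "is_slack_pos T p \<longleftrightarrow> (fst p = 1 \<or> fst p = 2) \<and> fst (snd p) = T \<and>
     \<not> (fst p = 2 \<and> fst (snd (snd p)) = 1 \<and> snd (snd (snd p)) = T)"

definition width :: "nat \<Rightarrow> nat" where "width T = 2 * T + 1"
text \<open>Exceeds every state, symbol and head coordinate, so that the complements
  \<open>K - v\<close> never truncate.\<close>

definition cap :: "tm \<Rightarrow> nat \<Rightarrow> nat" where "cap M T = width T + tm_states M + tm_symbols M + 3"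

datatype item =
    Ctl nat entry "nat list"
  | Keep nat nat nat nat
  | Start nat
  | Bit nat nat
  | Slack pos nat

context
  fixes M :: tm and T P :: nat and X :: "bool list"
begin

abbreviation "tab_k \<equiv> tm_tapes M"
abbreviation "tab_W \<equiv> width T"
abbreviation "tab_K \<equiv> cap M T"

fun item_vec :: "item \<Rightarrow> (pos \<times> nat) list" where
  "item_vec (Ctl t e hs) = ctl_vec tab_k tab_K t e hs"
| "item_vec (Keep t j i a) = keep_vec tab_K t j i a"
| "item_vec (Start l) = start_vec tab_k T P X l"
| "item_vec (Bit i s) = bit_vec (T + length X) i s"
| "item_vec (Slack p a) = [(p, a)]"

definition items :: "item list" where
  "items =
     map (\<lambda>z. Ctl (fst z) (fst (snd z)) (snd (snd z)))
       (List.product [0..<T] (List.product (delta_table M) (List.n_lists tab_k [0..<tab_W]))) @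
     map (\<lambda>z. Keep (fst z) (fst (snd z)) (fst (snd (snd z))) (snd (snd (snd z))))
       (List.product [0..<T] (List.product [0..<tab_k] (List.product [0..<tab_W] [0..<tm_symbols M]))) @
     map Start [0..<Suc P] @
     map (\<lambda>z. Bit (fst z) (snd z)) (List.product [0..<P] [1, 2]) @
     map (\<lambda>z. Slack (fst z) (snd z))
       (List.product (filter (is_slack_pos T) (positions tab_k T tab_W P)) [0..<tab_K + 2])"

end

section \<open>Contributions of the items at each kind of position\<close>

lemma ctl_vec_nth:
  assumes "length hs = k" "length (snd (snd e)) = k"
  shows "ctl_vec k K t e hs =
     ((0, t, 0, 0), 1) # ((1, t, k, 0), K - fst e) # ((1, Suc t, k, 0), Suc (fst (snd e))) #
     concat (map (\<lambda>j. [((1, t, j, 0), K - hs ! j), ((1, Suc t, j, 0), hs ! j + snd (snd (snd (snd e) ! j))),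
         ((3, t, j, hs ! j), 1), ((2, t, j, hs ! j), K - fst (snd (snd e) ! j)),
         ((2, Suc t, j, hs ! j), fst (snd (snd (snd e) ! j)))]) [0..<k])"
proof -
  have *: "map F (zip [0..<k] (zip hs (snd (snd e)))) = map (\<lambda>j. F (j, hs ! j, snd (snd e) ! j)) [0..<k]" for F
    using assms by (intro nth_equalityI) auto
  show ?thesis unfolding ctl_vec_def * fst_conv snd_conv by (rule refl)
qed

lemma sum_only: "(\<And>j'. j' \<noteq> j \<Longrightarrow> f j' = 0) \<Longrightarrow> (\<Sum>j'<k. f j') = (if j < k then f j else 0)"
  for f :: "nat \<Rightarrow> nat"
  by (induction k) (auto simp: less_Suc_eq)

lemma vec_ctl_vec:
  assumes "length hs = k" "length (snd (snd e)) = k"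
  shows "vec (ctl_vec k K t e hs) (0, t', j, i) = (if t' = t \<and> j = 0 \<and> i = 0 then 1 else 0)"
    "j \<le> k \<Longrightarrow> vec (ctl_vec k K t e hs) (Suc 0, t', j, 0) =
       (if t' = t then K - (if j = k then fst e else hs ! j) else 0) +
       (if t' = Suc t then (if j = k then Suc (fst (snd e)) else hs ! j + snd (snd (snd (snd e) ! j))) else 0)"
    "j < k \<Longrightarrow> vec (ctl_vec k K t e hs) (2, t', j, i) =
       (if t' = t \<and> i = hs ! j then K - fst (snd (snd e) ! j) else 0) +
       (if t' = Suc t \<and> i = hs ! j then fst (snd (snd (snd e) ! j)) else 0)"
    "j < k \<Longrightarrow> vec (ctl_vec k K t e hs) (3, t', j, i) = (if t' = t \<and> i = hs ! j then 1 else 0)"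
    "4 \<le> c \<Longrightarrow> vec (ctl_vec k K t e hs) (c, t', j, i) = 0"
proof -
  note [simp] = vec_concat_upt
  show "vec (ctl_vec k K t e hs) (0, t', j, i) = (if t' = t \<and> j = 0 \<and> i = 0 then 1 else 0)"
    "4 \<le> c \<Longrightarrow> vec (ctl_vec k K t e hs) (c, t', j, i) = 0"
    unfolding ctl_vec_nth[OF assms] by auto
  show "vec (ctl_vec k K t e hs) (Suc 0, t', j, 0) =
       (if t' = t then K - (if j = k then fst e else hs ! j) else 0) +
       (if t' = Suc t then (if j = k then Suc (fst (snd e)) else hs ! j + snd (snd (snd (snd e) ! j))) else 0)"
    if "j \<le> k"
    unfolding ctl_vec_nth[OF assms] using that by (simp add: sum_only[of j])
  show "vec (ctl_vec k K t e hs) (2, t', j, i) =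
       (if t' = t \<and> i = hs ! j then K - fst (snd (snd e) ! j) else 0) +
       (if t' = Suc t \<and> i = hs ! j then fst (snd (snd (snd e) ! j)) else 0)"
    "vec (ctl_vec k K t e hs) (3, t', j, i) = (if t' = t \<and> i = hs ! j then 1 else 0)" if "j < k"
    unfolding ctl_vec_nth[OF assms] using that by (simp_all add: sum_only[of j])
qed

lemma vec_map_upt: "vec (map F [0..<n]) p = (\<Sum>j<n. if fst (F j) = p then snd (F j) else 0)"
  by (induction n) auto

lemma vec_map_filter_upt:
  "vec (map F (filter Q [0..<n])) p = (\<Sum>j<n. if Q j \<and> fst (F j) = p then snd (F j) else 0)"
  by (induction n) auto

lemma vec_start_vec:
  "vec (start_vec k T P X l) (0, t, j, i) = 0"
  "j \<le> k \<Longrightarrow> vec (start_vec k T P X l) (Suc 0, t, j, 0) = (if t = 0 then (if j = k then 1 else Suc T) else 0)"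
  "vec (start_vec k T P X l) (2, t, j, i) =
     (if t = 0 \<and> j = 0 \<and> T \<le> i \<and> i < T + length X then (if X ! (i - T) then 2 else 1) else 0)"
  "vec (start_vec k T P X l) (3, t, j, i) = 0"
  "i < P \<Longrightarrow> vec (start_vec k T P X l) (4, 0, 0, i) = (if l \<le> i then 1 else 0)"
  "vec (start_vec k T P X l) (5, 0, 0, 0) = 1"
proof -
  have zip: "map F (zip [0..<length X] X) = map (\<lambda>i. F (i, X ! i)) [0..<length X]" for F
    by (intro nth_equalityI) auto
  have e: "vec (start_vec k T P X l) p = (if (5, 0, 0, 0) = p then 1 else 0) + ((if (Suc 0, 0, k, 0) = p then 1 else 0) +
      ((\<Sum>j<k. if (Suc 0, 0, j, 0) = p then Suc T else 0) +
      ((\<Sum>i<length X. if (2, 0, 0, T + i) = p then (if X ! i then 2 else 1) else 0) +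
      (\<Sum>i<P. if l \<le> i \<and> (4, 0, 0, i) = p then 1 else 0))))" for p
    by (simp only: start_vec_def vec_simps vec_map_upt vec_map_filter_upt zip fst_conv snd_conv One_nat_def)
  show "vec (start_vec k T P X l) (0, t, j, i) = 0"
    "vec (start_vec k T P X l) (3, t, j, i) = 0"
    "vec (start_vec k T P X l) (5, 0, 0, 0) = 1"
    by (simp_all add: e)
  show "vec (start_vec k T P X l) (Suc 0, t, j, 0) = (if t = 0 then (if j = k then 1 else Suc T) else 0)" if "j \<le> k"
  proof (cases "t = 0")
    case True
    have "(\<Sum>j'<k. if j' = j then Suc T else 0) = (if j < k then Suc T else 0)" by (rule trans[OF sum_only[of j]]) auto
    then show ?thesis using that True by (simp add: e)
  qed (simp add: e)
  show "vec (start_vec k T P X l) (4, 0, 0, i) = (if l \<le> i then 1 else 0)" if "i < P"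
  proof -
    have "(\<Sum>i'<P. if l \<le> i' \<and> i' = i then 1 else 0) = (if l \<le> i then 1 else 0 :: nat)"
      by (rule trans[OF sum_only[of i]]) (use that in auto)
    then show ?thesis by (simp add: e)
  qed
  show "vec (start_vec k T P X l) (2, t, j, i) =
     (if t = 0 \<and> j = 0 \<and> T \<le> i \<and> i < T + length X then (if X ! (i - T) then 2 else 1) else 0)"
  proof (cases "t = 0 \<and> j = 0 \<and> T \<le> i")
    case True
    have "(\<Sum>i'<length X. if T + i' = i then (if X ! i' then 2 else 1) else 0) =
        (if i - T < length X then (if X ! (i - T) then 2 else 1) else 0 :: nat)"
      by (rule trans[OF sum_only[of "i - T"]]) (use True in auto)
    moreover have "i - T < length X \<longleftrightarrow> i < T + length X" using True by auto
    ultimately show ?thesis using True by (simp add: e)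
  next
    case False
    then have *: "(\<Sum>i'<length X. if (2, 0, 0, T + i') = (2::nat, t, j, i) then (if X ! i' then 2 else 1) else 0) = (0::nat)"
      by (intro sum.neutral) auto
    have "vec (start_vec k T P X l) (2, t, j, i) = 0" unfolding e * by simp
    with False show ?thesis by auto
  qed
qed

lemma positions_distinct: "distinct (positions k T W P)"
proof -
  have inj: "inj_on (\<lambda>t. (0::nat, t, 0::nat, 0::nat)) A" "inj_on (\<lambda>z. (1::nat, fst z, snd z, 0::nat)) B"
    "inj_on (\<lambda>z. (c::nat, z)) C" "inj_on (\<lambda>i. (4::nat, 0::nat, 0::nat, i)) D"
    for A :: "nat set" and B :: "(nat \<times> nat) set" and C :: "(nat \<times> nat \<times> nat) set" and D :: "nat set" and c
    by (auto intro!: inj_onI)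
  show ?thesis
    unfolding positions_def distinct_append distinct_map
    by (intro conjI distinct_product distinct_upt inj) auto
qed

lemma set_positions:
  "(c, t, j, i) \<in> set (positions k T W P) \<longleftrightarrow>
     (c = 0 \<and> t < T \<and> j = 0 \<and> i = 0) \<or> (c = 1 \<and> t \<le> T \<and> j \<le> k \<and> i = 0) \<or>
     (c = 2 \<and> t \<le> T \<and> j < k \<and> i < W) \<or> (c = 3 \<and> t < T \<and> j < k \<and> i < W) \<or>
     (c = 4 \<and> t = 0 \<and> j = 0 \<and> i < P) \<or> (c = 5 \<and> t = 0 \<and> j = 0 \<and> i = 0)"
proof -
  have "(c, t, j, i) \<in> set (map (\<lambda>t. (0, t, 0, 0)) [0..<T]) \<longleftrightarrow> c = 0 \<and> t < T \<and> j = 0 \<and> i = 0"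
    "(c, t, j, i) \<in> set (map (\<lambda>z. (1, fst z, snd z, 0)) (List.product [0..<Suc T] [0..<Suc k])) \<longleftrightarrow>
       c = 1 \<and> t \<le> T \<and> j \<le> k \<and> i = 0"
    "(c, t, j, i) \<in> set (map (\<lambda>z. (2, z)) (List.product [0..<Suc T] (List.product [0..<k] [0..<W]))) \<longleftrightarrow>
       c = 2 \<and> t \<le> T \<and> j < k \<and> i < W"
    "(c, t, j, i) \<in> set (map (\<lambda>z. (3, z)) (List.product [0..<T] (List.product [0..<k] [0..<W]))) \<longleftrightarrow>
       c = 3 \<and> t < T \<and> j < k \<and> i < W"
    "(c, t, j, i) \<in> set (map (\<lambda>i. (4, 0, 0, i)) [0..<P]) \<longleftrightarrow> c = 4 \<and> t = 0 \<and> j = 0 \<and> i < P"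
    "(c, t, j, i) \<in> set [(5, 0, 0, 0)] \<longleftrightarrow> c = 5 \<and> t = 0 \<and> j = 0 \<and> i = 0"
    by (auto simp: set_product less_Suc_eq_le image_iff simp del: upt_Suc)
  then show ?thesis unfolding positions_def set_append Un_iff by (simp only:)
qed

lemma positions_box: "T + W + k + P + 10 \<le> N \<Longrightarrow> set (positions k T W P) \<subseteq> pos_box N"
  by (auto simp: set_positions pos_box_def)

lemma set_n_lists_upt: "hs \<in> set (List.n_lists k [0..<W]) \<longleftrightarrow> length hs = k \<and> (\<forall>j<k. hs ! j < W)"
proof -
  have "set hs \<subseteq> set [0..<W] \<longleftrightarrow> (\<forall>x\<in>set hs. x < W)" by auto
  then show ?thesis by (auto simp: set_n_lists all_set_conv_all_nth)
qed

lemma delta_tableD: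
  assumes "wf_tm M" "e \<in> set (delta_table M)"
  shows "length (snd (snd e)) = tm_tapes M" "fst e \<le> tm_states M"
    "\<exists>ys. e = entry_of M (fst e) ys \<and> length ys = tm_tapes M \<and> set ys \<subseteq> {..<tm_symbols M} \<and>
      (\<forall>j<tm_tapes M. fst (snd (snd e) ! j) = ys ! j)"
proof -
  obtain q ys where e: "e = entry_of M q ys" "q \<le> tm_states M" "length ys = tm_tapes M" "set ys \<subseteq> {..<tm_symbols M}"
    using assms(2) by (auto simp: delta_table_def set_product set_n_lists less_Suc_eq_le atLeast0LessThan)
  note wf = full_delta_wf[OF assms(1) e(2-4)]
  show "length (snd (snd e)) = tm_tapes M" "fst e \<le> tm_states M"
    "\<exists>ys. e = entry_of M (fst e) ys \<and> length ys = tm_tapes M \<and> set ys \<subseteq> {..<tm_symbols M} \<and>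
      (\<forall>j<tm_tapes M. fst (snd (snd e) ! j) = ys ! j)"
  proof -
    show "length (snd (snd e)) = tm_tapes M" "fst e \<le> tm_states M" using wf e by (simp_all add: entry_of_def)
    have "fst e = q" using e(1) by (simp add: entry_of_def)
    moreover have "\<forall>j<tm_tapes M. fst (snd (snd e) ! j) = ys ! j" using wf(2) e(1,3) by (simp add: entry_of_def)
    ultimately show "\<exists>ys. e = entry_of M (fst e) ys \<and> length ys = tm_tapes M \<and> set ys \<subseteq> {..<tm_symbols M} \<and>
      (\<forall>j<tm_tapes M. fst (snd (snd e) ! j) = ys ! j)" using e by blast
  qed
qed

lemma entry_of_nth:
  assumes "length ys = k" "length (snd (full_delta M q ys)) = k" "j < k"
  shows "snd (snd (entry_of M q ys)) ! j =
    (ys ! j, fst (snd (full_delta M q ys) ! j), dir_code (snd (snd (full_delta M q ys) ! j)))"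
  using assms by (simp add: entry_of_def)

definition is_ctl :: "item \<Rightarrow> nat \<Rightarrow> bool" where
  "is_ctl x t \<longleftrightarrow> (\<exists>e hs. x = Ctl t e hs)"

definition covers :: "item \<Rightarrow> nat \<Rightarrow> nat \<Rightarrow> nat \<Rightarrow> bool" where
  "covers x t j i \<longleftrightarrow> (\<exists>e hs. x = Ctl t e hs \<and> hs ! j = i) \<or> (\<exists>a. x = Keep t j i a)"

definition is_start :: "item \<Rightarrow> bool" where
  "is_start x \<longleftrightarrow> (\<exists>l. x = Start l)"

definition is_bit :: "item \<Rightarrow> nat \<Rightarrow> bool" where
  "is_bit x i \<longleftrightarrow> (\<exists>s. x = Bit i s)"

fun start_len :: "item \<Rightarrow> nat" where "start_len (Start l) = l" | "start_len _ = 0"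

text \<open>Index \<open>k\<close> stands for the state, smaller ones for the heads.
  \<open>val_out\<close> includes the offset 1 of tag 1: explicitly for the state, and through
  \<open>dir_code\<close>, which is the shift plus 1, for the heads.\<close>

fun val_in :: "nat \<Rightarrow> item \<Rightarrow> nat \<Rightarrow> nat" where
  "val_in k (Ctl t e hs) j = (if j = k then fst e else hs ! j)"
| "val_in k _ j = 0"

fun val_out :: "nat \<Rightarrow> item \<Rightarrow> nat \<Rightarrow> nat" where
  "val_out k (Ctl t e hs) j =
     (if j = k then Suc (fst (snd e)) else hs ! j + snd (snd (snd (snd e) ! j)))"
| "val_out k _ j = 0"

fun rd :: "item \<Rightarrow> nat \<Rightarrow> nat" where
  "rd (Ctl t e hs) j = fst (snd (snd e) ! j)"
| "rd (Keep t j' i a) j = a"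
| "rd _ j = 0"

fun wr :: "item \<Rightarrow> nat \<Rightarrow> nat" where
  "wr (Ctl t e hs) j = fst (snd (snd (snd e) ! j))"
| "wr (Keep t j' i a) j = a"
| "wr _ j = 0"

fun bit_val :: "nat \<Rightarrow> item \<Rightarrow> nat \<Rightarrow> nat" where
  "bit_val c (Bit i' s) i = (if i = c + i' then s else 0)"
| "bit_val c _ i = 0"

fun slack_val :: "item \<Rightarrow> pos \<Rightarrow> nat" where
  "slack_val (Slack p a) p' = (if p = p' then a else 0)"
| "slack_val _ p' = 0"

lemma is_ctl_simps [simp]:
  "is_ctl (Ctl t' e hs) t \<longleftrightarrow> t = t'" "\<not> is_ctl (Keep t' j i a) t" "\<not> is_ctl (Start l) t"
  "\<not> is_ctl (Bit i a) t" "\<not> is_ctl (Slack p a) t"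
  by (auto simp: is_ctl_def simp del: split_paired_Ex)

lemma covers_simps [simp]:
  "covers (Ctl t' e hs) t j i \<longleftrightarrow> t = t' \<and> i = hs ! j"
  "covers (Keep t' j' i' a) t j i \<longleftrightarrow> t = t' \<and> j = j' \<and> i = i'"
  "\<not> covers (Start l) t j i" "\<not> covers (Bit i' a) t j i" "\<not> covers (Slack p a) t j i"
  by (auto simp: covers_def simp del: split_paired_Ex)

lemma is_start_simps [simp]:
  "\<not> is_start (Ctl t' e hs)" "\<not> is_start (Keep t' j i a)" "is_start (Start l)"
  "\<not> is_start (Bit i a)" "\<not> is_start (Slack p a)"
  by (auto simp: is_start_def)

lemma is_bit_simps [simp]:
  "\<not> is_bit (Ctl t' e hs) i'" "\<not> is_bit (Keep t' j i a) i'" "\<not> is_bit (Start l) i'"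
  "is_bit (Bit i a) i' \<longleftrightarrow> i' = i" "\<not> is_bit (Slack p a) i'"
  by (auto simp: is_bit_def)

lemma bex_pair: "(\<exists>z\<in>S. a = fst z \<and> b = snd z) \<longleftrightarrow> (a, b) \<in> S"
  and bex_triple: "(\<exists>z\<in>S'. a = fst z \<and> b = fst (snd z) \<and> c = snd (snd z)) \<longleftrightarrow> (a, b, c) \<in> S'"
  and bex_quadruple: "(\<exists>z\<in>S''. a = fst z \<and> b = fst (snd z) \<and> c = fst (snd (snd z)) \<and> d = snd (snd (snd z)))
    \<longleftrightarrow> (a, b, c, d) \<in> S''"
  by (metis fst_conv snd_conv prod.collapse)+

text \<open>The input occupies the coordinates from \<open>T\<close> on; \<open>fit\<close> keeps it
  and the longest certificate inside the window.\<close>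

context
  fixes M :: tm and T P :: nat and X :: "bool list"
  assumes wf: "wf_tm M" and fit: "length X + P \<le> T" and T: "0 < T"
begin

private abbreviation "k \<equiv> tm_tapes M"
private abbreviation "W \<equiv> width T"
private abbreviation "K \<equiv> cap M T"
private abbreviation "its \<equiv> items M T P"
private abbreviation "ivec \<equiv> item_vec M T P X"
private abbreviation "ps \<equiv> positions k T W P"
private abbreviation "c0 \<equiv> T + length X"

private lemma k2: "2 \<le> k" and sym3: "3 \<le> tm_symbols M"
  using wf by (auto simp: wf_tm_def)

private lemma set_its:
  "Ctl t e hs \<in> set its \<longleftrightarrow> t < T \<and> e \<in> set (delta_table M) \<and> length hs = k \<and> (\<forall>j<k. hs ! j < W)"
  "Keep t j i a \<in> set its \<longleftrightarrow> t < T \<and> j < k \<and> i < W \<and> a < tm_symbols M"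
  "Start l \<in> set its \<longleftrightarrow> l \<le> P"
  "Bit i s \<in> set its \<longleftrightarrow> i < P \<and> (s = 1 \<or> s = 2)"
  "Slack p a \<in> set its \<longleftrightarrow> is_slack_pos T p \<and> p \<in> set ps \<and> a < K + 2"
proof -
  note [simp] = items_def set_append set_map Un_iff image_iff set_product bex_pair bex_triple bex_quadruple
    set_n_lists_upt less_Suc_eq_le
  note [simp del] = upt_Suc split_paired_Ex
  show "Ctl t e hs \<in> set its \<longleftrightarrow> t < T \<and> e \<in> set (delta_table M) \<and> length hs = k \<and> (\<forall>j<k. hs ! j < W)"
    by simp
  show "Keep t j i a \<in> set its \<longleftrightarrow> t < T \<and> j < k \<and> i < W \<and> a < tm_symbols M" by simp
  show "Start l \<in> set its \<longleftrightarrow> l \<le> P" by auto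
  show "Bit i s \<in> set its \<longleftrightarrow> i < P \<and> (s = 1 \<or> s = 2)" by simp
  show "Slack p a \<in> set its \<longleftrightarrow> is_slack_pos T p \<and> p \<in> set ps \<and> a < K + 2" by auto
qed

private lemma slack_posE:
  assumes "Slack p a \<in> set its"
  obtains j where "p = (1, T, j, 0)" "j \<le> k" | j i where "p = (2, T, j, i)" "j < k" "i < W" "(j, i) \<noteq> (1, T)"
proof -
  obtain c t j i where p: "p = (c, t, j, i)" by (cases p)
  have "is_slack_pos T p" "p \<in> set ps" using assms by (simp_all add: set_its)
  then consider "c = 1" "t = T" "j \<le> k" "i = 0" | "c = 2" "t = T" "j < k" "i < W" "\<not> (j = 1 \<and> i = T)"
    unfolding p is_slack_pos_def set_positions by auto
  then show thesis
  proof cases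
    case 1
    then show thesis using that(1) p by simp
  next
    case 2
    then show thesis using that(2)[of j i] p by simp
  qed
qed

private lemma covers_time: "x \<in> set its \<Longrightarrow> covers x t j i \<Longrightarrow> t < T"
  by (cases x) (simp_all add: set_its)

private lemma vec_ctl:
  assumes "Ctl t' e hs \<in> set its"
  shows "length hs = k" "length (snd (snd e)) = k"
  using assms delta_tableD(1)[OF wf, of e] by (simp_all add: set_its)

private lemma vec_0:
  assumes "x \<in> set its"
  shows "vec (ivec x) (0, t, 0, 0) = (if is_ctl x t then 1 else 0)"
proof (cases x)
  case (Ctl t' e hs)
  have "Ctl t' e hs \<in> set its" using assms(1) unfolding Ctl .
  note len = vec_ctl[OF this]
  show ?thesis unfolding Ctl item_vec.simps by (simp add: vec_ctl_vec[OF len])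
next
  case (Slack p a)
  have "Slack p a \<in> set its" using assms(1) unfolding Slack .
  then show ?thesis by (rule slack_posE) (simp_all add: Slack)
qed (auto simp: keep_vec_def vec_start_vec bit_vec_def)

private lemma vec_1:
  assumes "x \<in> set its" "j \<le> k"
  shows "vec (ivec x) (1, t, j, 0) =
     (if is_ctl x t then K - val_in k x j else 0) + (if 0 < t \<and> is_ctl x (t - 1) then val_out k x j else 0) +
     (if t = 0 \<and> is_start x then (if j = k then 1 else Suc T) else 0) + slack_val x (1, t, j, 0)"
proof (cases x)
  case (Ctl t' e hs)
  have "Ctl t' e hs \<in> set its" using assms(1) unfolding Ctl .
  note len = vec_ctl[OF this]
  show ?thesis using vec_ctl_vec(2)[OF len assms(2)] by (cases t) (simp_all add: Ctl)
next
  case (Slack p a)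
  then show ?thesis by simp
qed (use assms in \<open>simp_all add: keep_vec_def vec_start_vec bit_vec_def\<close>)

private lemma vec_2:
  assumes "x \<in> set its" "j < k"
  shows "vec (ivec x) (2, t, j, i) =
     (if covers x t j i then K - rd x j else 0) + (if 0 < t \<and> covers x (t - 1) j i then wr x j else 0) +
     (if t = 0 \<and> j = 0 \<and> is_start x then
        (if T \<le> i \<and> i < T + length X then (if X ! (i - T) then 2 else 1) else 0) else 0) +
     (if t = 0 \<and> j = 0 then bit_val c0 x i else 0) + slack_val x (2, t, j, i)"
proof (cases x)
  case (Ctl t' e hs)
  have "Ctl t' e hs \<in> set its" using assms(1) unfolding Ctl .
  note len = vec_ctl[OF this]
  show ?thesis using vec_ctl_vec(3)[OF len assms(2)] by (cases t) (auto simp: Ctl)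
next
  case (Keep t' j' i' a)
  show ?thesis by (cases t) (auto simp: Keep keep_vec_def)
next
  case (Start l)
  then show ?thesis by (simp add: vec_start_vec)
next
  case (Bit i' v)
  then show ?thesis by (auto simp: bit_vec_def)
next
  case (Slack p a)
  then show ?thesis by simp
qed

private lemma vec_3:
  assumes "x \<in> set its" "j < k" shows "vec (ivec x) (3, t, j, i) = (if covers x t j i then 1 else 0)"
proof (cases x)
  case (Ctl t' e hs)
  have "Ctl t' e hs \<in> set its" using assms(1) unfolding Ctl .
  note len = vec_ctl[OF this]
  show ?thesis unfolding Ctl item_vec.simps using assms by (simp add: vec_ctl_vec[OF len])
next
  case (Slack p a)
  have "Slack p a \<in> set its" using assms(1) unfolding Slack .
  then show ?thesis by (rule slack_posE) (simp_all add: Slack)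
qed (auto simp: keep_vec_def vec_start_vec bit_vec_def)

private lemma vec_4:
  assumes "x \<in> set its" "i < P"
  shows "vec (ivec x) (4, 0, 0, i) =
     (if is_start x \<and> start_len x \<le> i then 1 else 0) + (if is_bit x i then 1 else 0)"
proof (cases x)
  case (Ctl t' e hs)
  have "Ctl t' e hs \<in> set its" using assms(1) unfolding Ctl .
  note len = vec_ctl[OF this]
  show ?thesis unfolding Ctl item_vec.simps by (simp add: vec_ctl_vec[OF len])
next
  case (Slack p a)
  have "Slack p a \<in> set its" using assms(1) unfolding Slack .
  then show ?thesis by (rule slack_posE) (simp_all add: Slack)
qed (use assms in \<open>auto simp: keep_vec_def vec_start_vec bit_vec_def\<close>)

private lemma vec_5:
  assumes "x \<in> set its" shows "vec (ivec x) (5, 0, 0, 0) = (if is_start x then 1 else 0)"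
proof (cases x)
  case (Ctl t' e hs)
  have "Ctl t' e hs \<in> set its" using assms(1) unfolding Ctl .
  note len = vec_ctl[OF this]
  show ?thesis unfolding Ctl item_vec.simps by (simp add: vec_ctl_vec[OF len])
next
  case (Slack p a)
  have "Slack p a \<in> set its" using assms(1) unfolding Slack .
  then show ?thesis by (rule slack_posE) (simp_all add: Slack)
qed (auto simp: keep_vec_def vec_start_vec bit_vec_def)

lemma item_positions: "x \<in> set its \<Longrightarrow> fst ` set (ivec x) \<subseteq> set ps"
proof (cases x)
  case (Ctl t e hs)
  assume "x \<in> set its"
  then have m: "Ctl t e hs \<in> set its" unfolding Ctl .
  then have x: "t < T" "length hs = k" "\<forall>j<k. hs ! j < W" "length (snd (snd e)) = k"
    unfolding set_its(1) using vec_ctl[OF m] by blast+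
  show ?thesis
    unfolding Ctl item_vec.simps ctl_vec_nth[OF x(2,4)] using x(1,3) by (auto simp: set_positions)
next
  case (Start l)
  have "fst ` set (map (\<lambda>z. ((2, 0, 0, T + fst z), if snd z then 2 else 1 :: nat)) (zip [0..<length X] X)) \<subseteq> set ps"
  proof
    fix p :: pos assume "p \<in> fst ` set (map (\<lambda>z. ((2, 0, 0, T + fst z), if snd z then 2 else 1 :: nat)) (zip [0..<length X] X))"
    then obtain i b where "p = (2, 0, 0, T + i)" "(i, b) \<in> set (zip [0..<length X] X)" by auto
    then show "p \<in> set ps" using set_zip_leftD[of i b "[0..<length X]" X] fit k2 by (simp add: set_positions width_def)
  qed
  moreover have "fst ` set (map (\<lambda>j. ((1, 0, j, 0), Suc T)) [0..<k]) \<subseteq> set ps"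
    "fst ` set (map (\<lambda>i. ((4, 0, 0, i), 1)) (filter ((\<le>) l) [0..<P])) \<subseteq> set ps"
    "(5, 0, 0, 0) \<in> set ps" "(1, 0, k, 0) \<in> set ps" by (auto simp: set_positions)
  ultimately show ?thesis
    unfolding Start item_vec.simps start_vec_def set_append list.set image_Un image_insert fst_conv by blast
next
  case (Keep t j i a)
  assume "x \<in> set its"
  then show ?thesis using Keep by (simp add: set_its keep_vec_def set_positions)
next
  case (Bit i a)
  assume "x \<in> set its"
  then show ?thesis using Bit fit k2 by (simp add: set_its bit_vec_def set_positions width_def)
next
  case (Slack p a)
  assume "x \<in> set its"
  then show ?thesis using Slack by (simp add: set_its)
qed

text \<open>Stated for an indexed family because the selection consists of list indices in the
  soundness proof and of the items themselves in the completeness proof.\<close>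

private lemma sum_vecs:
  assumes "finite J" "\<forall>m\<in>J. it m \<in> set its"
  shows "(\<Sum>m\<in>J. vec (ivec (it m)) (0, t, 0, 0)) = card {m \<in> J. is_ctl (it m) t}"
    "j \<le> k \<Longrightarrow> (\<Sum>m\<in>J. vec (ivec (it m)) (1, t, j, 0)) =
      (\<Sum>m\<in>{m \<in> J. is_ctl (it m) t}. K - val_in k (it m) j) +
      (if 0 < t then \<Sum>m\<in>{m \<in> J. is_ctl (it m) (t - 1)}. val_out k (it m) j else 0) +
      (if t = 0 then card {m \<in> J. is_start (it m)} * (if j = k then 1 else Suc T) else 0) +
      (\<Sum>m\<in>J. slack_val (it m) (1, t, j, 0))"
    "j < k \<Longrightarrow> (\<Sum>m\<in>J. vec (ivec (it m)) (2, t, j, i)) =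
      (\<Sum>m\<in>{m \<in> J. covers (it m) t j i}. K - rd (it m) j) +
      (if 0 < t then \<Sum>m\<in>{m \<in> J. covers (it m) (t - 1) j i}. wr (it m) j else 0) +
      (if t = 0 \<and> j = 0 then card {m \<in> J. is_start (it m)} *
         (if T \<le> i \<and> i < T + length X then (if X ! (i - T) then 2 else 1) else 0) else 0) +
      (if t = 0 \<and> j = 0 then \<Sum>m\<in>J. bit_val c0 (it m) i else 0) +
      (\<Sum>m\<in>J. slack_val (it m) (2, t, j, i))"
    "j < k \<Longrightarrow> (\<Sum>m\<in>J. vec (ivec (it m)) (3, t, j, i)) = card {m \<in> J. covers (it m) t j i}"
    "i < P \<Longrightarrow> (\<Sum>m\<in>J. vec (ivec (it m)) (4, 0, 0, i)) =
      card {m \<in> J. is_start (it m) \<and> start_len (it m) \<le> i} + card {m \<in> J. is_bit (it m) i}"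
    "(\<Sum>m\<in>J. vec (ivec (it m)) (5, 0, 0, 0)) = card {m \<in> J. is_start (it m)}"
proof -
  have its: "it m \<in> set its" if "m \<in> J" for m using assms(2) that by blast
  have cond: "(\<Sum>m\<in>J. if Q m then f m else 0) = (\<Sum>m\<in>{m \<in> J. Q m}. f m)" for Q and f :: "_ \<Rightarrow> nat"
    using assms(1) by (simp add: sum.inter_filter)
  have cond_const: "(\<Sum>m\<in>J. if Q m then c else 0) = card {m \<in> J. Q m} * c" for Q and c :: nat
    using cond[of Q "\<lambda>_. c"] by simp
  show "(\<Sum>m\<in>J. vec (ivec (it m)) (0, t, 0, 0)) = card {m \<in> J. is_ctl (it m) t}"
    using cond_const[of "\<lambda>m. is_ctl (it m) t" 1] by (simp add: vec_0[OF its])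
  show "(\<Sum>m\<in>J. vec (ivec (it m)) (3, t, j, i)) = card {m \<in> J. covers (it m) t j i}" if "j < k"
    using cond_const[of "\<lambda>m. covers (it m) t j i" 1] by (simp add: vec_3[OF its that])
  show "(\<Sum>m\<in>J. vec (ivec (it m)) (5, 0, 0, 0)) = card {m \<in> J. is_start (it m)}"
    using cond_const[of "\<lambda>m. is_start (it m)" 1] by (simp add: vec_5[OF its])
  show "(\<Sum>m\<in>J. vec (ivec (it m)) (4, 0, 0, i)) =
      card {m \<in> J. is_start (it m) \<and> start_len (it m) \<le> i} + card {m \<in> J. is_bit (it m) i}" if "i < P"
    using cond_const[of "\<lambda>m. is_start (it m) \<and> start_len (it m) \<le> i" 1] cond_const[of "\<lambda>m. is_bit (it m) i" 1]
    by (simp add: vec_4[OF its that] sum.distrib)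
  show "(\<Sum>m\<in>J. vec (ivec (it m)) (1, t, j, 0)) =
      (\<Sum>m\<in>{m \<in> J. is_ctl (it m) t}. K - val_in k (it m) j) +
      (if 0 < t then \<Sum>m\<in>{m \<in> J. is_ctl (it m) (t - 1)}. val_out k (it m) j else 0) +
      (if t = 0 then card {m \<in> J. is_start (it m)} * (if j = k then 1 else Suc T) else 0) +
      (\<Sum>m\<in>J. slack_val (it m) (1, t, j, 0))" if "j \<le> k"
  proof -
    have a: "(\<Sum>m\<in>J. if 0 < t \<and> is_ctl (it m) (t - 1) then val_out k (it m) j else 0) =
        (if 0 < t then \<Sum>m\<in>{m \<in> J. is_ctl (it m) (t - 1)}. val_out k (it m) j else 0)"
      using cond[of "\<lambda>m. is_ctl (it m) (t - 1)" "\<lambda>m. val_out k (it m) j"] by (cases "0 < t") simp_all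
    have b: "(\<Sum>m\<in>J. if t = 0 \<and> is_start (it m) then (if j = k then 1 else Suc T) else 0) =
        (if t = 0 then card {m \<in> J. is_start (it m)} * (if j = k then 1 else Suc T) else 0)"
      using cond_const[of "\<lambda>m. is_start (it m)" "if j = k then 1 else Suc T"] by (cases "t = 0") simp_all
    have e: "(\<Sum>m\<in>J. vec (ivec (it m)) (1, t, j, 0)) = (\<Sum>m\<in>J. (if is_ctl (it m) t then K - val_in k (it m) j else 0) + (if 0 < t \<and> is_ctl (it m) (t - 1) then val_out k (it m) j else 0) +
        (if t = 0 \<and> is_start (it m) then (if j = k then 1 else Suc T) else 0) + slack_val (it m) (1, t, j, 0))"
      by (rule sum.cong[OF refl]) (rule vec_1[OF its that])
    show ?thesis
      unfolding e sum.distrib a b cond by (rule refl)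
  qed
  show "(\<Sum>m\<in>J. vec (ivec (it m)) (2, t, j, i)) =
      (\<Sum>m\<in>{m \<in> J. covers (it m) t j i}. K - rd (it m) j) +
      (if 0 < t then \<Sum>m\<in>{m \<in> J. covers (it m) (t - 1) j i}. wr (it m) j else 0) +
      (if t = 0 \<and> j = 0 then card {m \<in> J. is_start (it m)} *
         (if T \<le> i \<and> i < T + length X then (if X ! (i - T) then 2 else 1) else 0) else 0) +
      (if t = 0 \<and> j = 0 then \<Sum>m\<in>J. bit_val c0 (it m) i else 0) +
      (\<Sum>m\<in>J. slack_val (it m) (2, t, j, i))" if "j < k"
  proof -
    have a: "(\<Sum>m\<in>J. if 0 < t \<and> covers (it m) (t - 1) j i then wr (it m) j else 0) =
        (if 0 < t then \<Sum>m\<in>{m \<in> J. covers (it m) (t - 1) j i}. wr (it m) j else 0)"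
      using cond[of "\<lambda>m. covers (it m) (t - 1) j i" "\<lambda>m. wr (it m) j"] by (cases "0 < t") simp_all
    define c :: nat where "c = (if T \<le> i \<and> i < T + length X then (if X ! (i - T) then 2 else 1) else 0)"
    have b: "(\<Sum>m\<in>J. if t = 0 \<and> j = 0 \<and> is_start (it m) then c else 0) =
        (if t = 0 \<and> j = 0 then card {m \<in> J. is_start (it m)} * c else 0)"
      using cond_const[of "\<lambda>m. is_start (it m)" c] by (cases "t = 0 \<and> j = 0") auto
    have d: "(\<Sum>m\<in>J. if t = 0 \<and> j = 0 then bit_val c0 (it m) i else 0) =
        (if t = 0 \<and> j = 0 then \<Sum>m\<in>J. bit_val c0 (it m) i else 0)"
      by simp
    have e: "(\<Sum>m\<in>J. vec (ivec (it m)) (2, t, j, i)) = (\<Sum>m\<in>J. (if covers (it m) t j i then K - rd (it m) j else 0) + (if 0 < t \<and> covers (it m) (t - 1) j i then wr (it m) j else 0) +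
        (if t = 0 \<and> j = 0 \<and> is_start (it m) then
          (if T \<le> i \<and> i < T + length X then (if X ! (i - T) then 2 else 1) else 0) else 0) +
        (if t = 0 \<and> j = 0 then bit_val c0 (it m) i else 0) + slack_val (it m) (2, t, j, i))"
      by (rule sum.cong[OF refl]) (rule vec_2[OF its that])
    show ?thesis
      unfolding e c_def[symmetric] sum.distrib a b d cond by (rule refl)
  qed
qed

section \<open>Selections that meet the target correspond to accepting runs\<close>

private lemma contents_at: "contents z (int n) = (if n < length z then (if z ! n then 2 else 1) else 0)"
  by (simp add: contents_def)

private lemma conf_0:
  "fst (conf M z 0) = 0" "j < k \<Longrightarrow> hpos M z 0 j = 0"
  "j < k \<Longrightarrow> cell M z 0 j i = (if j = 0 then contents z i else 0)"
  by (auto simp: conf_def start_def hpos_def cell_def nth_Cons contents_def split: nat.splits)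

private lemma scan_nth: "j < k \<Longrightarrow> scan M z t ! j = cell M z t j (hpos M z t j)"
  "length (scan M z t) = k" "set (scan M z t) \<subseteq> {..<tm_symbols M}"
proof -
  have len: "length (snd (conf M z t)) = k" and c: "\<And>j i. j < k \<Longrightarrow> cell M z t j i < tm_symbols M"
    using conf_inv[OF wf, of z t] by blast+
  show "j < k \<Longrightarrow> scan M z t ! j = cell M z t j (hpos M z t j)" "length (scan M z t) = k"
    using len by (simp_all add: scan_def cell_def hpos_def)
  show "set (scan M z t) \<subseteq> {..<tm_symbols M}" by (rule scan_symbols[OF len]) (rule c)
qed

private lemma next_step_wf: "length (snd (next_step M z t)) = k"
proof -
  have "fst (conf M z t) \<le> tm_states M" using conf_inv[OF wf, of z t] by blast
  from full_delta_wf(2)[OF wf this scan_nth(2,3)] show ?thesis unfolding next_step_def .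
qed

private lemmas conf_Suc = conf_step[OF conjunct1[OF conf_inv[OF wf]] next_step_wf]

text \<open>Tags 0 and 3 make the chosen item a function of the time and of the cell, and tag 5 does
  so for the start. Tags 1 and 2 then say that an item reads what the previous time produced, and
  induction on time identifies this with the run on \<open>X @ u\<close>.\<close>

lemma tableau_sound:
  assumes J: "J \<subseteq> {..<length its}"
    and sums: "\<And>p. p \<in> set ps \<Longrightarrow> (\<Sum>m\<in>J. vec (ivec (its ! m)) p) = target K T p"
  shows "\<exists>u. length u \<le> P \<and> cell M (X @ u) T 1 0 = 2"
proof -
  define it where "it m = its ! m" for m
  have fin: "finite J" using J finite_subset by blast
  have it: "it m \<in> set its" if "m \<in> J" for m using that J by (auto simp: it_def)
  have "\<forall>m\<in>J. it m \<in> set its" using it by blast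
  note S = sum_vecs[OF fin this]
  note sums = sums[folded it_def]
  have "card {m \<in> J. is_start (it m)} = 1"
    using sums[of "(5, 0, 0, 0)"] S(6) by (simp add: set_positions target_def)
  then obtain s where s: "{m \<in> J. is_start (it m)} = {s}" by (rule card_1_singletonE)
  then have "is_start (it s)" "s \<in> J" by auto
  then obtain l where l: "it s = Start l" "l \<le> P" using it[of s] by (auto simp: is_start_def set_its)
  \<comment> \<open>The symbol that the chosen bit items put at coordinate \<open>i\<close> of the
    input tape.\<close>
  define bsum where "bsum i = (\<Sum>m\<in>J. bit_val c0 (it m) i)" for i
  have bsum: "if i < l then bsum (c0 + i) = 1 \<or> bsum (c0 + i) = 2 else bsum (c0 + i) = 0" if i: "i < P" for i
  proof -
    have sD: "s \<in> J" "is_start (it s)" "start_len (it s) = l" using \<open>s \<in> J\<close> \<open>is_start (it s)\<close> l(1) by simp_all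
    have sU: "m = s" if "m \<in> J" "is_start (it m)" for m using s that by blast
    have st: "{m \<in> J. is_start (it m) \<and> start_len (it m) \<le> i} = (if l \<le> i then {s} else {})"
    proof (cases "l \<le> i")
      case True
      then show ?thesis unfolding if_P[OF True] using sU sD by blast
    next
      case False
      have "\<not> start_len (it m) \<le> i" if "m \<in> J" "is_start (it m)" for m
        using sU[OF that] sD(3) False by simp
      then show ?thesis unfolding if_not_P[OF False] by blast
    qed
    have "card {m \<in> J. is_start (it m) \<and> start_len (it m) \<le> i} + card {m \<in> J. is_bit (it m) i} = 1"
      using sums[of "(4, 0, 0, i)"] S(5)[OF i] i by (simp add: set_positions target_def)
    then have card: "card {m \<in> J. is_bit (it m) i} = (if i < l then 1 else 0)"
      unfolding st by (auto split: if_splits)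
    have b: "bsum (c0 + i) = (\<Sum>m\<in>{m \<in> J. is_bit (it m) i}. bit_val c0 (it m) (c0 + i))"
      unfolding bsum_def
    proof (rule sum.mono_neutral_right[OF fin])
      show "\<forall>m\<in>J - {m \<in> J. is_bit (it m) i}. bit_val c0 (it m) (c0 + i) = 0"
      proof
        fix m assume "m \<in> J - {m \<in> J. is_bit (it m) i}"
        then show "bit_val c0 (it m) (c0 + i) = 0" by (cases "it m") auto
      qed
    qed auto
    show ?thesis
    proof (cases "i < l")
      case True
      then obtain m where m: "{m \<in> J. is_bit (it m) i} = {m}" using card by (metis card_1_singletonE)
      then have "m \<in> J" "is_bit (it m) i" by auto
      then obtain v where "it m = Bit i v" "v = 1 \<or> v = 2" using it[of m] by (auto simp: is_bit_def set_its)
      then show ?thesis using b m True by auto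
    next
      case False
      then have e: "{m \<in> J. is_bit (it m) i} = {}" using card fin by simp
      have "bsum (c0 + i) = 0" unfolding b e by simp
      then show ?thesis using False by simp
    qed
  qed
  have bsum0: "bsum i = 0" if "\<not> (c0 \<le> i \<and> i < c0 + P)" for i
    unfolding bsum_def
  proof (rule sum.neutral, rule ballI)
    fix m assume "m \<in> J"
    then show "bit_val c0 (it m) i = 0" using that it[of m] by (cases "it m") (auto simp: set_its)
  qed
  \<comment> \<open>The certificate is read off the chosen bit items; its length is the parameter of
    the chosen start item.\<close>
  define u where "u = map (\<lambda>i. bsum (c0 + i) = 2) [0..<l]"
  define z where "z = X @ u"
  have u: "length u = l" "length u \<le> P" using l by (auto simp: u_def)
  have init: "(if T \<le> i \<and> i < T + length X then (if X ! (i - T) then 2 else 1) else 0) + bsum i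
      = contents z (int i - int T)" for i
  proof -
    consider "i < T" | "T \<le> i" "i < c0" | "c0 \<le> i" "i < c0 + P" | "c0 + P \<le> i" by linarith
    then show ?thesis
    proof cases
      case 1
      then show ?thesis using bsum0[of i] by (simp add: contents_def)
    next
      case 2
      then have "nat (int i - int T) = i - T" by simp
      then show ?thesis using 2 bsum0[of i] by (auto simp: contents_def z_def nth_append)
    next
      case 3
      define d where "d = i - c0"
      have d: "i = c0 + d" "d < P" using 3 by (auto simp: d_def)
      have lz: "length z = length X + l" unfolding z_def using u(1) by simp
      have eq: "int i - int T = int (length X + d)" using d(1) by simp
      have "\<not> (T \<le> i \<and> i < T + length X)" using d(1) by simp
      then have i0: "(if T \<le> i \<and> i < T + length X then (if X ! (i - T) then 2 else 1) else 0) = (0::nat)"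
        by (rule if_not_P)
      have bi: "bsum i = bsum (c0 + d)" by (rule arg_cong[OF d(1)])
      have sum0: "(if T \<le> i \<and> i < T + length X then (if X ! (i - T) then 2 else 1) else 0) + bsum i = 0 + bsum (c0 + d)"
        by (rule arg_cong2[where f = "(+)", OF i0 bi])
      have "contents z (int (length X + d)) = bsum (c0 + d)"
      proof (cases "d < l")
        case True
        have one: "bsum (c0 + d) = 1 \<or> bsum (c0 + d) = 2" using bsum[OF d(2)] unfolding if_P[OF True] .
        have zn: "z ! (length X + d) \<longleftrightarrow> bsum (c0 + d) = 2"
          unfolding z_def nth_append using True by (simp add: u_def)
        have ln: "length X + d < length z" using lz True by simp
        have g: "b = 1 \<or> b = 2 \<Longrightarrow> (if b = 2 then 2 else 1) = b" for b :: nat by auto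
        show ?thesis unfolding contents_at if_P[OF ln] zn by (rule g[OF one])
      next
        case False
        have "bsum (c0 + d) = 0" using bsum[OF d(2)] unfolding if_not_P[OF False] .
        moreover have "\<not> length X + d < length z" using lz False by simp
        then have "contents z (int (length X + d)) = 0" unfolding contents_at by (rule if_not_P)
        ultimately show ?thesis by (simp only:)
      qed
      then show ?thesis
        by (intro trans[OF sum0 trans[OF add_0 trans[OF _ arg_cong[where f = "contents z", OF eq[symmetric]]]]]) (rule sym)
    next
      case 4
      then show ?thesis using bsum0[of i] u by (auto simp: contents_def z_def)
    qed
  qed
  \<comment> \<open>From here, \<open>mc t\<close> is the only control item chosen for time
    \<open>t\<close>, and \<open>cv t j i\<close> the only chosen item in charge of cell
    \<open>i\<close> of tape \<open>j\<close> at that time.\<close>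
  have "\<exists>m. {m \<in> J. is_ctl (it m) t} = {m}" if "t < T" for t
    using sums[of "(0, t, 0, 0)"] S(1)[of t] that
    by (auto simp: set_positions target_def card_1_singleton_iff)
  then obtain mc where mc: "\<And>t. t < T \<Longrightarrow> {m \<in> J. is_ctl (it m) t} = {mc t}" by metis
  have "\<exists>m. {m \<in> J. covers (it m) t j i} = {m}" if "t < T" "j < k" "i < W" for t j i
    using sums[of "(3, t, j, i)"] S(4)[of j t i] that
    by (auto simp: set_positions target_def card_1_singleton_iff)
  then obtain cv where cv: "\<And>t j i. t < T \<Longrightarrow> j < k \<Longrightarrow> i < W \<Longrightarrow> {m \<in> J. covers (it m) t j i} = {cv t j i}"
    by metis
  have slack1: "(\<Sum>m\<in>J. slack_val (it m) p) = 0" if "\<And>a. Slack p a \<notin> set its" for p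
  proof (rule sum.neutral, rule ballI)
    fix m assume "m \<in> J"
    then show "slack_val (it m) p = 0" using that it[of m] by (cases "it m") auto
  qed
  \<comment> \<open>Before time \<open>T\<close> there is no slack, so the equations there are
    exact.\<close>
  have slackT: "Slack (c, t, j, i) a \<notin> set its" if "t < T" for c t j i a
  proof
    assume "Slack (c, t, j, i) a \<in> set its"
    then show False by (rule slack_posE) (use that in auto)
  qed
  have IF0: "(K - val_in k (it (mc 0)) j) + (if j = k then 1 else Suc T) = Suc K" if "j \<le> k" for j
    using sums[of "(1, 0, j, 0)"] S(2)[OF that, of 0] slack1[OF slackT[OF T]] mc[OF T] s that
    by (simp add: set_positions target_def)
  have IF: "(K - val_in k (it (mc (Suc t))) j) + val_out k (it (mc t)) j = Suc K" if "j \<le> k" "Suc t < T" for t j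
    using sums[of "(1, Suc t, j, 0)"] S(2)[OF that(1), of "Suc t"] slack1[OF slackT[OF that(2)]]
      mc[OF that(2)] mc[of t] that
    by (simp add: set_positions target_def)
  have SY0: "(K - rd (it (cv 0 j i)) j) + (if j = 0 then contents z (int i - int T) else 0) = K"
    if "j < k" "i < W" for j i
    using sums[of "(2, 0, j, i)"] S(3)[OF that(1), of 0 i] slack1[OF slackT[OF T]] cv[OF T that] s that T
      init[of i]
    by (simp add: set_positions target_def bsum_def split: if_splits)
  have SY: "(K - rd (it (cv (Suc t) j i)) j) + wr (it (cv t j i)) j = K"
    if "j < k" "i < W" "Suc t < T" for t j i
    using sums[of "(2, Suc t, j, i)"] S(3)[OF that(1), of "Suc t" i] slack1[OF slackT[OF that(3)]]
      cv[OF that(3,1,2)] cv[of t j i] that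
    by (simp add: set_positions target_def)
  have TW: "T < W" by (simp add: width_def)
  \<comment> \<open>At the output cell at time \<open>T\<close> neither a reader nor a slack item
    contributes; the item of the preceding time has to produce the \<open>2\<close> by
    itself.\<close>
  have acc: "wr (it (cv (T - 1) 1 T)) 1 = 2"
  proof -
    have emp: "{m \<in> J. covers (it m) T 1 T} = {}"
      using covers_time[OF it, of _ T 1 T] by blast
    have "Slack (2, T, 1, T) a \<notin> set its" for a
    proof
      assume "Slack (2, T, 1, T) a \<in> set its"
      then show False by (rule slack_posE) auto
    qed
    note sl = slack1[OF this]
    have one: "{m \<in> J. covers (it m) (T - 1) 1 T} = {cv (T - 1) 1 T}"
      using T k2 TW by (intro cv) auto
    have "1 < k" using k2 by simp
    note S3 = S(3)[OF this, of T T, unfolded emp one sl]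
    have "(2, T, 1, T) \<in> set ps" using k2 TW by (simp add: set_positions)
    from sums[OF this] S3 show ?thesis using T by (simp add: target_def)
  qed
  have mcD: "mc t \<in> J" "\<exists>e hs. it (mc t) = Ctl t e hs \<and> e \<in> set (delta_table M) \<and> length hs = k \<and> (\<forall>j<k. hs ! j < W)"
    if "t < T" for t
  proof -
    have "mc t \<in> {m \<in> J. is_ctl (it m) t}" using mc[OF that] by simp
    then have *: "mc t \<in> J" "is_ctl (it (mc t)) t" by auto
    then obtain e hs where e: "it (mc t) = Ctl t e hs" by (auto simp: is_ctl_def)
    have "Ctl t e hs \<in> set its" using it[OF *(1)] e by simp
    then show "mc t \<in> J" "\<exists>e hs. it (mc t) = Ctl t e hs \<and> e \<in> set (delta_table M) \<and> length hs = k \<and> (\<forall>j<k. hs ! j < W)"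
      using * e by (auto simp: set_its)
  qed
  have cvD: "cv t j i \<in> J" "covers (it (cv t j i)) t j i" if "t < T" "j < k" "i < W" for t j i
    using cv[OF that] by auto
  \<comment> \<open>Without truncation in \<open>K - v\<close> the equations can be solved for the
    value read; hence this bound and the next.\<close>
  have rd_le: "rd (it (cv t j i)) j \<le> K" if tji: "t < T" "j < k" "i < W" for t j i
  proof -
    have c: "covers (it (cv t j i)) t j i" "it (cv t j i) \<in> set its" using cvD[OF tji] it by auto
    have "rd (it (cv t j i)) j < tm_symbols M"
    proof (cases "it (cv t j i)")
      case (Ctl t' e hs)
      then have "e \<in> set (delta_table M)" using c(2) by (simp add: set_its)
      then obtain ys where ys: "length ys = k" "set ys \<subseteq> {..<tm_symbols M}" "\<forall>j<k. fst (snd (snd e) ! j) = ys ! j"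
        using delta_tableD(3)[OF wf] by blast
      have "ys ! j \<in> set ys" using ys(1) tji(2) by simp
      then show ?thesis using ys(2,3) tji(2) Ctl by auto
    next
      case (Keep t' j' i' a)
      then show ?thesis using c(2) by (simp add: set_its)
    qed (use c(1) in \<open>simp_all add: covers_def\<close>)
    then show ?thesis by (simp add: cap_def)
  qed
  have val_le: "val_in k (it (mc t)) j \<le> K" if t: "t < T" and jk: "j \<le> k" for t j
  proof -
    obtain e hs where e: "it (mc t) = Ctl t e hs" "e \<in> set (delta_table M)" "\<forall>j<k. hs ! j < W"
      using mcD(2)[OF t] by blast
    have "fst e \<le> tm_states M" by (rule delta_tableD[OF wf e(2)])
    moreover have "hs ! j < W" if "j \<noteq> k" using e(3) jk that by simp
    ultimately show ?thesis using e(1) by (auto simp: cap_def)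
  qed
  \<comment> \<open>Coordinate \<open>i\<close> is the cell \<open>int i - int T\<close>.\<close>
  let ?inv = "\<lambda>t. val_in k (it (mc t)) k = fst (conf M z t) \<and>
    (\<forall>j<k. int (val_in k (it (mc t)) j) = hpos M z t j + int T) \<and>
    (\<forall>j<k. \<forall>i<W. rd (it (cv t j i)) j = cell M z t j (int i - int T))"
  have step: "val_out k (it (mc t)) k = Suc (fst (conf M z (Suc t))) \<and>
      (\<forall>j<k. int (val_out k (it (mc t)) j) = hpos M z (Suc t) j + int T + 1) \<and>
      (\<forall>j<k. \<forall>i<W. wr (it (cv t j i)) j = cell M z (Suc t) j (int i - int T))"
    if t: "t < T" and inv: "?inv t" for t
  proof -
    obtain e hs where e: "it (mc t) = Ctl t e hs" "e \<in> set (delta_table M)" "length hs = k" "\<forall>j<k. hs ! j < W"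
      using mcD(2)[OF t] by blast
    obtain ys where ys: "e = entry_of M (fst e) ys" "length ys = k" "\<forall>j<k. fst (snd (snd e) ! j) = ys ! j"
      using delta_tableD(3)[OF wf e(2)] by blast
    have hs: "int (hs ! j) = hpos M z t j + int T" if "j < k" for j
    proof -
      have "int (val_in k (it (mc t)) j) = hpos M z t j + int T" using inv that by blast
      then show ?thesis unfolding e(1) val_in.simps using that by simp
    qed
    \<comment> \<open>By tag 3 the cell under the head has only one item, and the control item is
      one; so the symbols in its table entry are those actually scanned.\<close>
    have cv_mc: "cv t j (hs ! j) = mc t" if "j < k" for j
    proof -
      have "mc t \<in> {m \<in> J. covers (it m) t j (hs ! j)}" using mcD(1)[OF t] e(1) by simp
      moreover have "{m \<in> J. covers (it m) t j (hs ! j)} = {cv t j (hs ! j)}"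
        using e(4) that by (intro cv[OF t that]) blast
      ultimately have "mc t \<in> {cv t j (hs ! j)}" by blast
      then show ?thesis by simp
    qed
    have "ys ! j = scan M z t ! j" if j: "j < k" for j
    proof -
      have "rd (it (mc t)) j = ys ! j" unfolding e(1) rd.simps using ys(3) j by blast
      moreover have "rd (it (cv t j (hs ! j))) j = cell M z t j (int (hs ! j) - int T)"
        using inv j e(4) by blast
      moreover have "int (hs ! j) - int T = hpos M z t j" using hs[OF j] by linarith
      ultimately show ?thesis unfolding cv_mc[OF j] scan_nth(1)[OF j] by (simp only:)
    qed
    then have 1: "ys = scan M z t" using ys(2) scan_nth(2) by (intro nth_equalityI) auto
    have 2: "fst e = fst (conf M z t)" using inv e(1) by simp
    have ent: "e = entry_of M (fst (conf M z t)) (scan M z t)"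
      by (rule trans[OF ys(1)]) (simp only: 1 2)
    have acts: "snd (snd e) ! j = (scan M z t ! j, fst (snd (next_step M z t) ! j),
        dir_code (snd (snd (next_step M z t) ! j)))" if "j < k" for j
      unfolding ent next_step_def
      by (rule entry_of_nth[OF scan_nth(2)]) (use next_step_wf[of z t] that in \<open>auto simp: next_step_def\<close>)
    have A: "fst (snd e) = fst (conf M z (Suc t))"
      unfolding conf_Suc(1) next_step_def by (subst ent) (simp add: entry_of_def)
    have B: "int (val_out k (it (mc t)) j) = hpos M z (Suc t) j + int T + 1" if j: "j < k" for j
    proof -
      have "val_out k (it (mc t)) j = hs ! j + dir_code (snd (snd (next_step M z t) ! j))"
        unfolding e(1) val_out.simps acts[OF j] using j by simp
      then show ?thesis using hs[OF j] unfolding conf_Suc(4)[OF j] shift_dir_code by simp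
    qed
    have C: "wr (it (cv t j i)) j = cell M z (Suc t) j (int i - int T)" if j: "j < k" and i: "i < W" for j i
    proof (cases "hs ! j = i")
      case True
      then have "int i - int T = hpos M z t j" using hs[OF j] by simp
      then have "cell M z (Suc t) j (int i - int T) = fst (snd (next_step M z t) ! j)"
        unfolding conf_Suc(3)[OF j] by (simp only: if_True refl)
      moreover have "cv t j i = mc t" using cv_mc[OF j] unfolding True .
      moreover have "wr (it (mc t)) j = fst (snd (next_step M z t) ! j)"
        unfolding e(1) wr.simps acts[OF j] by (simp only: fst_conv snd_conv)
      ultimately show ?thesis by (simp only:)
    next
      case False
      then have ne: "int i - int T \<noteq> hpos M z t j" using hs[OF j] by auto
      \<comment> \<open>Away from the head the item of a cell is no control item, since the only one
        at time \<open>t\<close> is \<open>mc t\<close>; hence it keeps the symbol.\<close>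
      have "\<not> is_ctl (it (cv t j i)) t"
      proof
        assume "is_ctl (it (cv t j i)) t"
        then have "cv t j i = mc t" using cvD(1)[OF t j i] mc[OF t] by auto
        then show False using cvD(2)[OF t j i] e(1) False by simp
      qed
      with cvD(2)[OF t j i] obtain a where "it (cv t j i) = Keep t j i a"
        unfolding covers_def is_ctl_def by blast
      then have "wr (it (cv t j i)) j = rd (it (cv t j i)) j" by simp
      moreover have "rd (it (cv t j i)) j = cell M z t j (int i - int T)" using inv i j by blast
      moreover have "cell M z (Suc t) j (int i - int T) = cell M z t j (int i - int T)"
        unfolding conf_Suc(3)[OF j] using ne by simp
      ultimately show ?thesis by simp
    qed
    have "val_out k (it (mc t)) k = Suc (fst (conf M z (Suc t)))" unfolding e(1) A[symmetric] by simp
    then show ?thesis using B C by blast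
  qed
  have inv: "?inv t" if "t < T" for t
    using that
  proof (induction t)
    case 0
    have "val_in k (it (mc 0)) k = 0" using IF0[of k] val_le[OF T, of k] by simp
    moreover have "val_in k (it (mc 0)) j = T" if "j < k" for j
      using IF0[of j] val_le[OF T, of j] that by simp
    moreover have "rd (it (cv 0 j i)) j = cell M z 0 j (int i - int T)" if "j < k" "i < W" for j i
      using SY0[OF that] rd_le[OF T that] that by (auto simp: conf_0 split: if_splits)
    ultimately show ?case using conf_0 by simp
  next
    case (Suc t)
    then have t: "t < T" by simp
    note st = step[OF t Suc.IH[OF t]]
    have "val_in k (it (mc (Suc t))) k = fst (conf M z (Suc t))"
      using IF[of k t] val_le[OF Suc.prems, of k] st Suc.prems by simp
    moreover have "int (val_in k (it (mc (Suc t))) j) = hpos M z (Suc t) j + int T" if "j < k" for j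
    proof -
      have "Suc (val_in k (it (mc (Suc t))) j) = val_out k (it (mc t)) j"
        using IF[of j t] val_le[OF Suc.prems, of j] Suc.prems that by simp
      then have "int (Suc (val_in k (it (mc (Suc t))) j)) = int (val_out k (it (mc t)) j)" by simp
      then show ?thesis using st that by simp
    qed
    moreover have "rd (it (cv (Suc t) j i)) j = cell M z (Suc t) j (int i - int T)" if "j < k" "i < W" for j i
      using SY[OF that Suc.prems] rd_le[OF Suc.prems that] st that by simp
    ultimately show ?case by blast
  qed
  have "T - 1 < T" "Suc (T - 1) = T" using T by auto
  then have "wr (it (cv (T - 1) 1 T)) 1 = cell M z T 1 (int T - int T)"
    using step[of "T - 1"] inv[of "T - 1"] k2 TW by auto
  then show ?thesis using acc u z_def by auto
qed

text \<open>The items dictated by the run satisfy all constraints that admit no slack; at time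
  \<open>T\<close> only produced values are counted, and slack items add what is missing.\<close>

lemma tableau_complete:
  assumes u: "length u \<le> P" and acc: "cell M (X @ u) T 1 0 = 2"
  shows "\<exists>J\<subseteq>{..<length its}. \<forall>p\<in>set ps. (\<Sum>m\<in>J. vec (ivec (its ! m)) p) = target K T p"
proof -
  define z where "z = X @ u"
  define h where "h t j = nat (hpos M z t j + int T)" for t j
  define ent where "ent t = entry_of M (fst (conf M z t)) (scan M z t)" for t
  define hds where "hds t = map (h t) [0..<k]" for t
  define cl where "cl t j i = cell M z t j (int i - int T)" for t j and i :: nat
  define bt where "bt i = (if u ! i then 2 else 1 :: nat)" for i
  define ctl where "ctl t = Ctl t (ent t) (hds t)" for t
  define cov where "cov t j i = (if i = h t j then ctl t else Keep t j i (cl t j i))" for t j i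
  define vin where "vin t j = (if j = k then fst (conf M z t) else h t j)" for t j
  \<comment> \<open>Slack is left out at first, as its amounts depend on the sums of the other
    items.\<close>
  define A0 where "A0 = {x. case x of Ctl t e hs \<Rightarrow> t < T \<and> e = ent t \<and> hs = hds t
      | Keep t j i a \<Rightarrow> t < T \<and> j < k \<and> i < W \<and> i \<noteq> h t j \<and> a = cl t j i
      | Start l \<Rightarrow> l = length u | Bit i s \<Rightarrow> i < length u \<and> s = bt i | Slack p a \<Rightarrow> False}"
  have A0: "Ctl t e hs \<in> A0 \<longleftrightarrow> t < T \<and> e = ent t \<and> hs = hds t"
    "Keep t j i a \<in> A0 \<longleftrightarrow> t < T \<and> j < k \<and> i < W \<and> i \<noteq> h t j \<and> a = cl t j i"
    "Start l \<in> A0 \<longleftrightarrow> l = length u" "Bit i s \<in> A0 \<longleftrightarrow> i < length u \<and> s = bt i" "Slack p a \<notin> A0"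
    for t e hs j i a l s p by (simp_all add: A0_def)
  have h: "int (h t j) = hpos M z t j + int T" "h t j < W" if "t \<le> T" "j < k" for t j
  proof -
    have "\<bar>hpos M z t j\<bar> \<le> int t" using conf_inv[OF wf, of z t] that(2) by blast
    then show "int (h t j) = hpos M z t j + int T" "h t j < W" using that(1) by (auto simp: h_def width_def)
  qed
  have hd: "length (hds t) = k" "j < k \<Longrightarrow> hds t ! j = h t j" for t j by (simp_all add: hds_def)
  have st: "fst (conf M z t) \<le> tm_states M" for t using conf_inv[OF wf, of z t] by blast
  have cls: "cl t j i < tm_symbols M" if "j < k" for t j i
    unfolding cl_def using conf_inv[OF wf, of z t] that by blast
  have ent_mem: "ent t \<in> set (delta_table M)" for t
  proof -
    have "(fst (conf M z t), scan M z t) \<in> set (List.product [0..<Suc (tm_states M)] (List.n_lists k [0..<tm_symbols M]))"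
      using st scan_nth(2,3) by (simp add: set_product set_n_lists less_Suc_eq_le atLeast0LessThan del: upt_Suc)
    then show ?thesis unfolding ent_def delta_table_def set_map by (rule image_eqI[rotated]) simp
  qed
  have acts: "snd (snd (ent t)) ! j = (scan M z t ! j, fst (snd (next_step M z t) ! j),
      dir_code (snd (snd (next_step M z t) ! j)))" if "j < k" for t j
    unfolding ent_def next_step_def
    by (rule entry_of_nth[OF scan_nth(2)]) (use next_step_wf[of z t] that in \<open>auto simp: next_step_def\<close>)
  have sub: "x \<in> set its" if "x \<in> A0" for x
  proof (cases x)
    case (Ctl t e hs)
    then have "t < T" "e = ent t" "hs = hds t" using that A0(1) by auto
    then show ?thesis unfolding Ctl set_its(1) using ent_mem hd h(2)[of t] by auto
  next
    case (Keep t j i a)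
    then have "t < T" "j < k" "i < W" "a = cl t j i" using that A0(2) by auto
    then show ?thesis unfolding Keep set_its(2) using cls by auto
  next
    case (Start l)
    then show ?thesis using that u A0(3) set_its(3) by auto
  next
    case (Bit i s)
    then have "i < length u" "s = bt i" using that A0(4) by auto
    then show ?thesis unfolding Bit set_its(4) using u by (auto simp: bt_def)
  next
    case (Slack p a)
    then show ?thesis using that A0(5) by auto
  qed
  have fin: "finite A0" by (rule finite_subset[of _ "set its"]) (use sub in auto)
  have "\<forall>x\<in>A0. x \<in> set its" using sub by blast
  note S = sum_vecs[where it = "\<lambda>x. x", OF fin this]
  have F1: "{x \<in> A0. is_ctl x t} = (if t < T then {ctl t} else {})" for t
  proof (rule Set.set_eqI)
    fix x show "x \<in> {x \<in> A0. is_ctl x t} \<longleftrightarrow> x \<in> (if t < T then {ctl t} else {})"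
      by (cases x) (auto simp: A0 ctl_def)
  qed
  have F2: "{x \<in> A0. covers x t j i} = (if t < T then {cov t j i} else {})" if "j < k" "i < W" for t j i
  proof (rule Set.set_eqI)
    fix x show "x \<in> {x \<in> A0. covers x t j i} \<longleftrightarrow> x \<in> (if t < T then {cov t j i} else {})"
      using that by (cases x) (auto simp: A0 ctl_def cov_def hd)
  qed
  have F3: "{x \<in> A0. is_start x} = {Start (length u)}"
    "{x \<in> A0. is_start x \<and> start_len x \<le> i} = (if length u \<le> i then {Start (length u)} else {})"
    "{x \<in> A0. is_bit x i} = (if i < length u then {Bit i (bt i)} else {})" for i
  proof (rule_tac [!] Set.set_eqI)
    fix x
    show "x \<in> {x \<in> A0. is_start x} \<longleftrightarrow> x \<in> {Start (length u)}" by (cases x) (auto simp: A0)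
    show "x \<in> {x \<in> A0. is_start x \<and> start_len x \<le> i} \<longleftrightarrow> x \<in> (if length u \<le> i then {Start (length u)} else {})"
      by (cases x) (auto simp: A0)
    show "x \<in> {x \<in> A0. is_bit x i} \<longleftrightarrow> x \<in> (if i < length u then {Bit i (bt i)} else {})"
      by (cases x) (auto simp: A0)
  qed
  have F6: "(\<Sum>x\<in>A0. slack_val x p) = 0" for p
  proof (rule sum.neutral, rule ballI)
    fix x assume "x \<in> A0"
    then show "slack_val x p = 0" by (cases x) (auto simp: A0)
  qed
  have F7: "(\<Sum>x\<in>A0. bit_val c0 x i) = (if c0 \<le> i \<and> i < c0 + length u then bt (i - c0) else 0)" for i
  proof (cases "c0 \<le> i \<and> i < c0 + length u")
    case True
    define b where "b = Bit (i - c0) (bt (i - c0))"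
    have "(\<Sum>x\<in>A0. bit_val c0 x i) = (\<Sum>x\<in>{b}. bit_val c0 x i)"
    proof (rule sum.mono_neutral_right[OF fin])
      show "{b} \<subseteq> A0" using True by (auto simp: b_def A0)
      show "\<forall>x\<in>A0 - {b}. bit_val c0 x i = 0"
      proof
        fix x assume "x \<in> A0 - {b}"
        then show "bit_val c0 x i = 0" by (cases x) (auto simp: A0 b_def)
      qed
    qed
    then show ?thesis using True by (auto simp: b_def)
  next
    case False
    have "(\<Sum>x\<in>A0. bit_val c0 x i) = 0"
    proof (rule sum.neutral, rule ballI)
      fix x assume "x \<in> A0"
      then show "bit_val c0 x i = 0" using False by (cases x) (auto simp: A0)
    qed
    then show ?thesis unfolding if_not_P[OF False] .
  qed
  have init: "(if T \<le> i \<and> i < T + length X then (if X ! (i - T) then 2 else 1) else 0) +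
      (if c0 \<le> i \<and> i < c0 + length u then bt (i - c0) else 0) = cl 0 0 i" for i
  proof (cases "T \<le> i")
    case True
    define d where "d = i - T"
    have d: "i = T + d" "int i - int T = int d" using True by (auto simp: d_def)
    have "cl 0 0 i = contents z (int d)" unfolding cl_def d(2) using conf_0(3)[of 0 z] k2 by simp
    then show ?thesis unfolding contents_at z_def d(1) by (auto simp: nth_append bt_def)
  next
    case False
    then have "cl 0 0 i = 0" unfolding cl_def using conf_0(3)[of 0 z] k2 by (simp add: contents_def)
    then show ?thesis using False by simp
  qed
  have vi: "val_in k (ctl t) j = vin t j" if "j \<le> k" for t j
    using that hd(2)[of j t] by (simp add: ctl_def vin_def ent_def entry_of_def)
  have vo: "val_out k (ctl t) j = Suc (vin (Suc t) j)" if "j \<le> k" "t < T" for t j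
  proof (cases "j = k")
    case True
    have "fst (snd (ent t)) = fst (conf M z (Suc t))"
      unfolding conf_Suc(1) next_step_def ent_def by (simp add: entry_of_def)
    then show ?thesis using True by (simp add: ctl_def vin_def)
  next
    case False
    then have j: "j < k" using that by simp
    have "int (h t j + dir_code (snd (snd (next_step M z t) ! j))) = int (Suc (h (Suc t) j))"
      using h(1)[of t j] h(1)[of "Suc t" j] j that(2) conf_Suc(4)[OF j, of z t] by (simp add: shift_dir_code)
    then have "h t j + dir_code (snd (snd (next_step M z t) ! j)) = Suc (h (Suc t) j)" by (simp only: of_nat_eq_iff)
    then show ?thesis using False j acts[OF j] hd(2)[OF j] by (simp add: ctl_def vin_def)
  qed
  have vin_le: "vin t j \<le> K" if "t \<le> T" "j \<le> k" for t j
    using st[of t] h(2)[of t j] that by (auto simp: vin_def cap_def)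
  have rdc: "rd (cov t j i) j = cl t j i" if "t \<le> T" "j < k" for t j i
  proof (cases "i = h t j")
    case True
    have "int i - int T = hpos M z t j" using h(1)[OF that] True by simp
    then have "cl t j i = scan M z t ! j" unfolding cl_def scan_nth(1)[OF that(2)] by (simp only:)
    then show ?thesis using True acts[OF that(2)] by (simp add: cov_def ctl_def)
  qed (simp add: cov_def)
  have wrc: "wr (cov t j i) j = cl (Suc t) j i" if "t \<le> T" "j < k" for t j i
  proof (cases "i = h t j")
    case True
    have "int i - int T = hpos M z t j" using h(1)[OF that] True by simp
    then have "cl (Suc t) j i = fst (snd (next_step M z t) ! j)"
      unfolding cl_def conf_Suc(3)[OF that(2)] by (rule if_P)
    then show ?thesis using True acts[OF that(2)] by (simp add: cov_def ctl_def)
  next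
    case False
    have "int i - int T \<noteq> hpos M z t j" using h(1)[OF that] False by auto
    then have "cl (Suc t) j i = cl t j i" unfolding cl_def conf_Suc(3)[OF that(2)] by (rule if_not_P)
    then show ?thesis using False by (simp add: cov_def)
  qed
  have cl_le: "cl t j i \<le> K" if "j < k" for t j i using cls[OF that, of t i] by (simp add: cap_def)
  define val where "val p = (\<Sum>x\<in>A0. vec (ivec x) p)" for p
  have E0: "val (0, t, 0, 0) = 1" if "t < T" for t unfolding val_def S(1) F1 using that by simp
  have E1: "val (1, t, j, 0) = (if t < T then Suc K else Suc (vin T j))" if "t \<le> T" "j \<le> k" for t j
  proof (cases t)
    case 0
    have "val (1, t, j, 0) = K - vin 0 j + (if j = k then 1 else Suc T)"
      unfolding val_def S(2)[OF that(2)] F1 F3 F6 0 using T vi[OF that(2)] by simp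
    moreover have "vin 0 j = (if j = k then 0 else T)"
      using that(2) conf_0(2)[of j z] conf_0(1)[of z] by (auto simp: vin_def h_def)
    moreover have "T \<le> K" by (simp add: cap_def width_def)
    ultimately show ?thesis using 0 T by auto
  next
    case (Suc t')
    have "val (1, t, j, 0) = (if t < T then K - vin t j else 0) + Suc (vin t j)"
      unfolding val_def S(2)[OF that(2)] F1 F3 F6 using Suc that vi[OF that(2)] vo[OF that(2), of t'] by simp
    then show ?thesis using that vin_le[OF that] by auto
  qed
  have E2: "val (2, t, j, i) = (if t < T then K else cl T j i)" if "t \<le> T" "j < k" "i < W" for t j i
  proof (cases t)
    case 0
    have "val (2, t, j, i) = K - cl 0 j i + (if j = 0 then cl 0 0 i else 0)"
      unfolding val_def S(3)[OF that(2)] F2[OF that(2,3)] F3 F6 F7 0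
      using T rdc[OF _ that(2), of 0 i] by (cases "j = 0") (simp_all add: init[symmetric] del: One_nat_def)
    moreover have "cl 0 j i = 0" if "j \<noteq> 0" unfolding cl_def using conf_0(3)[OF \<open>j < k\<close>, of z] that by simp
    ultimately show ?thesis using 0 T cl_le[OF that(2), of 0 i] by auto
  next
    case (Suc t')
    have "val (2, t, j, i) = (if t < T then K - cl t j i else 0) + cl t j i"
      unfolding val_def S(3)[OF that(2)] F2[OF that(2,3)] F3 F6
      using Suc that(1) rdc[OF that(1,2), of i] wrc[OF _ that(2), of t' i] by simp
    then show ?thesis using that cl_le[OF that(2), of t i] by auto
  qed
  have E3: "val (3, t, j, i) = 1" if "t < T" "j < k" "i < W" for t j i
    unfolding val_def S(4)[OF that(2)] F2[OF that(2,3)] using that by simp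
  have E4: "val (4, 0, 0, i) = 1" if "i < P" for i unfolding val_def S(5)[OF that] F3 by simp
  have E5: "val (5, 0, 0, 0) = 1" unfolding val_def S(6) F3 by simp
  have tgt: "(if is_slack_pos T p then val p \<le> target K T p else val p = target K T p) \<and> target K T p \<le> Suc K"
    if pm: "p \<in> set ps" for p
  proof -
    obtain c t j i where p: "p = (c, t, j, i)" by (cases p)
    have "2 \<le> K" by (simp add: cap_def)
    consider "c = 0" "t < T" "j = 0" "i = 0" | "c = 1" "t \<le> T" "j \<le> k" "i = 0"
      | "c = 2" "t \<le> T" "j < k" "i < W" | "c = 3" "t < T" "j < k" "i < W"
      | "c = 4" "t = 0" "j = 0" "i < P" | "c = 5" "t = 0" "j = 0" "i = 0"
      using pm unfolding p set_positions by blast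
    then show ?thesis
    proof cases
      case 1 then show ?thesis using E0[of t] by (simp add: p is_slack_pos_def target_def)
    next
      case 2 then show ?thesis using E1[of t j] vin_le[of T j] by (auto simp: p is_slack_pos_def target_def)
    next
      case 3
      have "cl T 1 T = 2" using acc by (simp add: cl_def z_def)
      then show ?thesis using 3 E2[of t j i] cl_le[of j T i] \<open>2 \<le> K\<close>
        by (auto simp: p is_slack_pos_def target_def)
    next
      case 4 then show ?thesis using E3[of t j i] by (simp add: p is_slack_pos_def target_def)
    next
      case 5 then show ?thesis using E4[of i] by (simp add: p is_slack_pos_def target_def)
    next
      case 6 then show ?thesis using E5 by (simp add: p is_slack_pos_def target_def)
    qed
  qed
  \<comment> \<open>No deficit exceeds \<open>Suc K\<close>, and there are slack items for all
    amounts below \<open>K + 2\<close>.\<close>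
  define Q where "Q = {p \<in> set ps. is_slack_pos T p}"
  define sl where "sl p = Slack p (target K T p - val p)" for p
  define A where "A = A0 \<union> sl ` Q"
  have inj: "inj_on sl Q" by (auto simp: inj_on_def sl_def)
  have finQ: "finite Q" unfolding Q_def by simp
  have disj: "A0 \<inter> sl ` Q = {}" by (auto simp: sl_def A0)
  have "A \<subseteq> set its"
  proof
    fix x assume "x \<in> A"
    then consider "x \<in> A0" | p where "p \<in> Q" "x = sl p" unfolding A_def by blast
    then show "x \<in> set its"
    proof cases
      case 2
      then have "target K T p \<le> Suc K" using tgt[of p] unfolding Q_def by blast
      then show ?thesis using 2 unfolding sl_def by (auto simp: set_its Q_def)
    qed (rule sub)
  qed
  have sums: "(\<Sum>x\<in>A. vec (ivec x) p) = target K T p" if p: "p \<in> set ps" for p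
  proof -
    have "(\<Sum>x\<in>sl ` Q. vec (ivec x) p) = (\<Sum>q\<in>Q. if q = p then target K T p - val p else 0)"
      unfolding sum.reindex[OF inj] o_def by (rule sum.cong) (auto simp: sl_def)
    also have "\<dots> = (if p \<in> Q then target K T p - val p else 0)" using finQ by (simp add: sum.delta)
    finally have q: "(\<Sum>x\<in>sl ` Q. vec (ivec x) p) = (if p \<in> Q then target K T p - val p else 0)" .
    have "(\<Sum>x\<in>A. vec (ivec x) p) = val p + (\<Sum>x\<in>sl ` Q. vec (ivec x) p)"
      unfolding A_def val_def by (rule sum.union_disjoint[OF fin finite_imageI[OF finQ] disj])
    then have "(\<Sum>x\<in>A. vec (ivec x) p) = val p + (if p \<in> Q then target K T p - val p else 0)" unfolding q .
    then show ?thesis using tgt[OF p] p by (auto simp: Q_def split: if_splits)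
  qed
  \<comment> \<open>A selection is a set of indices, so one index is chosen for each item of
    \<open>A\<close>.\<close>
  have "set its = (!) its ` {..<length its}" by (auto simp: set_conv_nth)
  then obtain J where J: "J \<subseteq> {..<length its}" "inj_on ((!) its) J" "A = (!) its ` J"
    using \<open>A \<subseteq> set its\<close> subset_image_inj[of A "(!) its" "{..<length its}"] by auto
  have "(\<Sum>m\<in>J. vec (ivec (its ! m)) p) = (\<Sum>x\<in>A. vec (ivec x) p)" for p
    unfolding J(3) sum.reindex[OF J(2)] by simp
  then show ?thesis using J(1) sums by auto
qed

end

section \<open>Hardness\<close>

lemma ptime_product:
  assumes l: "ptime A l" and g: "ptime A g"
  shows "ptime A (\<lambda>x. List.product (l x) (g x))"
proof -
  have "ptime {z. fst z \<in> A \<and> snd z \<in> set (l (fst z))} (\<lambda>z. g (fst z))"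
    by (rule ptime_compose[OF ptime_fst[OF ptime_id] g]) simp
  then show ?thesis unfolding product_concat_map
    by (intro ptime_concat ptime_map[OF l] ptime_map ptime_Pair ptime_fst ptime_snd ptime_id)
qed

lemma ptime_ctl_vec:
  assumes K: "ptime A K" "pbound A K" and t: "ptime A t" and e: "ptime A e" and hs: "ptime A hs"
  shows "ptime A (\<lambda>x. ctl_vec k (K x) (t x) (e x) (hs x))"
proof -
  let ?l = "\<lambda>x. zip [0..<k] (zip (hs x) (snd (snd (e x))))"
  let ?S = "{z. fst z \<in> A \<and> snd z \<in> set (?l (fst z))}"
  have K': "ptime ?S (\<lambda>z. K (fst z))" by (rule ptime_compose[OF ptime_fst[OF ptime_id] K(1)]) simp
  have t': "ptime ?S (\<lambda>z. t (fst z))" by (rule ptime_compose[OF ptime_fst[OF ptime_id] t]) simp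
  have l: "ptime A ?l" by (intro ptime_zip ptime_const hs ptime_snd e)
  have "ptime A (\<lambda>x. concat (map (\<lambda>z. [((1, t x, fst z, 0), K x - fst (snd z)),
         ((1, Suc (t x), fst z, 0), fst (snd z) + snd (snd (snd (snd z)))),
         ((3, t x, fst z, fst (snd z)), 1),
         ((2, t x, fst z, fst (snd z)), K x - fst (snd (snd z))),
         ((2, Suc (t x), fst z, fst (snd z)), fst (snd (snd (snd z))))]) (?l x)))"
    by (intro ptime_concat ptime_map[OF l] ptime_Cons ptime_Pair ptime_diff[OF K' pbound_fst[OF K(2)]] ptime_add
        ptime_Suc t' ptime_fst ptime_snd ptime_id ptime_const)
  then show ?thesis unfolding ctl_vec_def
    by (intro ptime_Cons ptime_Pair ptime_diff[OF K] ptime_Suc t ptime_fst ptime_snd e ptime_const)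
qed

lemma ptime_start_vec:
  assumes T: "ptime A T" and P: "ptime A P" "pbound A P" and X: "ptime A X" and l: "ptime A l"
  shows "ptime A (\<lambda>x. start_vec k (T x) (P x) (X x) (l x))"
proof -
  have T': "ptime {z. fst z \<in> A \<and> Q z} (\<lambda>z. T (fst z))" for Q :: "'a \<times> 'b::encodable \<Rightarrow> bool"
    by (rule ptime_compose[OF ptime_fst[OF ptime_id] T]) simp
  have T'': "ptime {z. fst z \<in> A \<and> Q z} (\<lambda>z. T (fst z))" for Q :: "'a \<times> nat \<times> bool \<Rightarrow> bool"
    by (rule ptime_compose[OF ptime_fst[OF ptime_id] T]) simp
  have T3: "ptime {z. fst z \<in> A \<and> Q z} (\<lambda>z. T (fst z))" for Q :: "'a \<times> nat \<Rightarrow> bool"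
    by (rule ptime_compose[OF ptime_fst[OF ptime_id] T]) simp
  have l': "ptime {z. fst z \<in> A \<and> Q z} (\<lambda>z. l (fst z))" for Q :: "'a \<times> nat \<Rightarrow> bool"
    by (rule ptime_compose[OF ptime_fst[OF ptime_id] l]) simp
  have b: "pbound A (\<lambda>x. length (X x))" by (rule pbound_mono[OF ptime_esize[OF X]]) (rule length_le_esize)
  have 1: "ptime A (\<lambda>x. map (\<lambda>j. ((1::nat, 0::nat, j, 0::nat), Suc (T x))) [0..<k])"
    by (intro ptime_map ptime_const ptime_Pair ptime_Suc T3 ptime_snd ptime_id)
  have 2: "ptime A (\<lambda>x. map (\<lambda>z. ((2::nat, 0::nat, 0::nat, T x + fst z), if snd z then 2 else 1 :: nat)) (zip [0..<length (X x)] (X x)))"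
    by (intro ptime_map ptime_zip ptime_upt ptime_length X b ptime_Pair ptime_If ptime_add T'' ptime_fst ptime_snd ptime_id ptime_const)
  have f: "ptime A (\<lambda>x. filter (\<lambda>i. l x \<le> i) [0..<P x])"
    by (intro ptime_filter ptime_upt P ptime_le l' ptime_snd ptime_id)
  have 3: "ptime A (\<lambda>x. map (\<lambda>i. ((4::nat, 0::nat, 0::nat, i), 1::nat)) (filter (\<lambda>i. l x \<le> i) [0..<P x]))"
    by (intro ptime_map f ptime_Pair ptime_snd ptime_id ptime_const)
  show ?thesis unfolding start_vec_def by (intro ptime_Cons ptime_append 1 2 3 ptime_const)
qed

lemma ptime_positions:
  assumes T: "ptime A T" "pbound A T" and W: "ptime A W" "pbound A W" and P: "ptime A P" "pbound A P"
  shows "ptime A (\<lambda>x. positions k (T x) (W x) (P x))"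
  unfolding positions_def
  by (intro ptime_append ptime_map ptime_product ptime_upt T W P ptime_Suc pbound_Suc ptime_Pair ptime_fst ptime_snd
      ptime_id ptime_const)

lemma ptime_target:
  assumes "ptime A K" "ptime A T" "ptime A p"
  shows "ptime A (\<lambda>x. target (K x) (T x) (p x))"
  unfolding target_def
  by (intro ptime_If ptime_conj ptime_eq_nat ptime_fst ptime_snd assms ptime_Suc ptime_const)

lemma ptime_is_slack_pos:
  assumes "ptime A T" "ptime A p"
  shows "ptime A (\<lambda>x. is_slack_pos (T x) (p x))"
  unfolding is_slack_pos_def
  by (intro ptime_conj ptime_disj ptime_Not ptime_eq_nat ptime_fst ptime_snd assms ptime_const)

section \<open>The tableau as a subset sum instance computed in polynomial time\<close>

definition tab_vecs :: "tm \<Rightarrow> nat \<Rightarrow> nat \<Rightarrow> bool list \<Rightarrow> (pos \<times> nat) list list" where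
  "tab_vecs M T P X = map (item_vec M T P X) (items M T P)"

definition tab_target :: "tm \<Rightarrow> nat \<Rightarrow> nat \<Rightarrow> (pos \<times> nat) list" where
  "tab_target M T P = map (\<lambda>p. (p, target (cap M T) T p)) (positions (tm_tapes M) T (width T) P)"

lemma ptime_tab:
  fixes T P :: "'a::encodable \<Rightarrow> nat"
  assumes T: "ptime A T" "pbound A T" and P: "ptime A P" "pbound A P" and X: "ptime A X"
  shows "ptime A (\<lambda>x. tab_vecs M (T x) (P x) (X x))" "ptime A (\<lambda>x. tab_target M (T x) (P x))"
proof -
  let ?k = "tm_tapes M"
  define W where "W x = width (T x)" for x
  define K where "K x = cap M (T x)" for x
  have W: "ptime A W" "pbound A W" unfolding W_def width_def
    by (intro ptime_add ptime_mult T ptime_const) (intro pbound_add pbound_mult T pbound_const)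
  have K: "ptime A K" "pbound A K" unfolding K_def cap_def W_def[symmetric]
    by (intro ptime_add W ptime_const) (intro pbound_add W pbound_const)
  note tr = ptime_compose[OF ptime_fst[OF ptime_id]]
  have ps: "ptime A (\<lambda>x. positions ?k (T x) (W x) (P x))" by (intro ptime_positions T W P)
  have K': "ptime {z. fst z \<in> A \<and> Q z} (\<lambda>z. K (fst z))" for Q :: "'a \<times> 'b::encodable \<Rightarrow> bool" by (rule tr[OF K(1)]) simp
  have K2: "ptime {z. fst z \<in> A \<and> Q z} (\<lambda>z. K (fst z))" for Q :: "'a \<times> pos \<Rightarrow> bool" by (rule tr[OF K(1)]) simp
  have T2: "ptime {z. fst z \<in> A \<and> Q z} (\<lambda>z. T (fst z))" for Q :: "'a \<times> pos \<Rightarrow> bool" by (rule tr[OF T(1)]) simp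
  show "ptime A (\<lambda>x. tab_target M (T x) (P x))"
    unfolding tab_target_def W_def[symmetric] K_def[symmetric]
    by (intro ptime_map ps ptime_Pair ptime_target K2 T2 ptime_snd ptime_id)
  have 1: "ptime A (\<lambda>x. map (\<lambda>z. ctl_vec ?k (K x) (fst z) (fst (snd z)) (snd (snd z)))
       (List.product [0..<T x] (List.product (delta_table M) (List.n_lists ?k [0..<W x]))))"
  proof (rule ptime_map)
    show l: "ptime A (\<lambda>x. List.product [0..<T x] (List.product (delta_table M) (List.n_lists ?k [0..<W x])))"
      by (intro ptime_product ptime_upt T W ptime_n_lists ptime_const)
    show "ptime {z. fst z \<in> A \<and> snd z \<in> set (List.product [0..<T (fst z)] (List.product (delta_table M) (List.n_lists ?k [0..<W (fst z)])))}
        (\<lambda>z. ctl_vec ?k (K (fst z)) (fst (snd z)) (fst (snd (snd z))) (snd (snd (snd z))))"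
      by (intro ptime_ctl_vec tr[OF K(1)] pbound_fst[OF K(2)] ptime_fst ptime_snd ptime_id) simp
  qed
  have 2: "ptime A (\<lambda>x. map (\<lambda>z. keep_vec (K x) (fst z) (fst (snd z)) (fst (snd (snd z))) (snd (snd (snd z))))
       (List.product [0..<T x] (List.product [0..<?k] (List.product [0..<W x] [0..<tm_symbols M]))))"
  proof (rule ptime_map)
    show l: "ptime A (\<lambda>x. List.product [0..<T x] (List.product [0..<?k] (List.product [0..<W x] [0..<tm_symbols M])))"
      by (intro ptime_product ptime_upt T W ptime_const)
    show "ptime {z. fst z \<in> A \<and> snd z \<in> set (List.product [0..<T (fst z)] (List.product [0..<?k] (List.product [0..<W (fst z)] [0..<tm_symbols M])))}
        (\<lambda>z. keep_vec (K (fst z)) (fst (snd z)) (fst (snd (snd z))) (fst (snd (snd (snd z)))) (snd (snd (snd (snd z)))))"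
      unfolding keep_vec_def
      by (intro ptime_Cons ptime_Pair ptime_diff tr[OF K(1)] pbound_fst[OF K(2)] ptime_Suc ptime_fst ptime_snd ptime_id ptime_const) simp
  qed
  have 3: "ptime A (\<lambda>x. map (start_vec ?k (T x) (P x) (X x)) [0..<Suc (P x)])"
  proof (rule ptime_map)
    show "ptime A (\<lambda>x. [0..<Suc (P x)])" by (intro ptime_upt ptime_Suc pbound_Suc P)
    show "ptime {z. fst z \<in> A \<and> snd z \<in> set [0..<Suc (P (fst z))]} (\<lambda>z. start_vec ?k (T (fst z)) (P (fst z)) (X (fst z)) (snd z))"
      by (rule ptime_start_vec[OF tr[OF T(1)] tr[OF P(1)] pbound_fst[OF P(2)] tr[OF X] ptime_snd[OF ptime_id]]) simp_all
  qed
  have 4: "ptime A (\<lambda>x. map (\<lambda>z. bit_vec (T x + length (X x)) (fst z) (snd z)) (List.product [0..<P x] [1, 2]))"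
  proof (rule ptime_map)
    show "ptime A (\<lambda>x. List.product [0..<P x] [1, 2 :: nat])" by (intro ptime_product ptime_upt P ptime_const)
    have c: "ptime {z. fst z \<in> A \<and> Q z} (\<lambda>z. T (fst z) + length (X (fst z)))" for Q :: "'a \<times> nat \<times> nat \<Rightarrow> bool"
      by (intro ptime_add ptime_length tr[OF T(1)] tr[OF X]) simp_all
    show "ptime {z. fst z \<in> A \<and> snd z \<in> set (List.product [0..<P (fst z)] [1, 2 :: nat])}
        (\<lambda>z. bit_vec (T (fst z) + length (X (fst z))) (fst (snd z)) (snd (snd z)))"
      unfolding bit_vec_def
      by (intro ptime_Cons ptime_Pair ptime_add[OF c] c ptime_fst ptime_snd ptime_id ptime_const)
  qed
  have 5: "ptime A (\<lambda>x. map (\<lambda>z. [(fst z, snd z)])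
       (List.product (filter (is_slack_pos (T x)) (positions ?k (T x) (W x) (P x))) [0..<K x + 2]))"
    by (intro ptime_map ptime_product ptime_filter ps ptime_is_slack_pos T2 ptime_upt ptime_add K pbound_add
        pbound_const ptime_Cons ptime_Pair ptime_fst ptime_snd ptime_id ptime_const)
  have eq: "tab_vecs M (T x) (P x) (X x) =
     map (\<lambda>z. ctl_vec ?k (K x) (fst z) (fst (snd z)) (snd (snd z)))
       (List.product [0..<T x] (List.product (delta_table M) (List.n_lists ?k [0..<W x]))) @
     map (\<lambda>z. keep_vec (K x) (fst z) (fst (snd z)) (fst (snd (snd z))) (snd (snd (snd z))))
       (List.product [0..<T x] (List.product [0..<?k] (List.product [0..<W x] [0..<tm_symbols M]))) @
     map (start_vec ?k (T x) (P x) (X x)) [0..<Suc (P x)] @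
     map (\<lambda>z. bit_vec (T x + length (X x)) (fst z) (snd z)) (List.product [0..<P x] [1, 2]) @
     map (\<lambda>z. [(fst z, snd z)])
       (List.product (filter (is_slack_pos (T x)) (positions ?k (T x) (W x) (P x))) [0..<K x + 2])" for x
    unfolding tab_vecs_def items_def map_append map_map o_def item_vec.simps W_def K_def by (rule refl)
  show "ptime A (\<lambda>x. tab_vecs M (T x) (P x) (X x))"
    unfolding eq by (intro ptime_append 1 2 3 4 5)
qed

lemma tab_subset_sum:
  fixes M T P X
  defines "N \<equiv> T + width T + tm_tapes M + P + 10"
  defines "B \<equiv> vectors_base (tab_vecs M T P X) (tab_target M T P)"
  assumes wf: "wf_tm M" and fit: "length X + P \<le> T" "0 < T"
  shows "subset_sum (map (\<lambda>l. numeral_of B (index_vec N l)) (tab_vecs M T P X)) (numeral_of B (index_vec N (tab_target M T P)))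
    \<longleftrightarrow> (\<exists>u. length u \<le> P \<and> cell M (X @ u) T 1 0 = 2)"
    and "l \<in> set (tab_vecs M T P X) \<Longrightarrow> fst ` set l \<subseteq> pos_box N" "fst ` set (tab_target M T P) \<subseteq> pos_box N"
proof -
  let ?ps = "positions (tm_tapes M) T (width T) P" and ?its = "items M T P"
  have box: "set ?ps \<subseteq> pos_box N" by (rule positions_box) (simp add: N_def)
  have sub: "fst ` set l \<subseteq> set ?ps" if "l \<in> set (tab_vecs M T P X)" for l
    using that item_positions[OF wf fit] unfolding tab_vecs_def by auto
  show "l \<in> set (tab_vecs M T P X) \<Longrightarrow> fst ` set l \<subseteq> pos_box N" using sub box by blast
  show "fst ` set (tab_target M T P) \<subseteq> pos_box N" using box by (auto simp: tab_target_def)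
  have len: "length (tab_vecs M T P X) = length ?its" by (simp add: tab_vecs_def)
  have nth: "(\<Sum>j\<in>J. vec (tab_vecs M T P X ! j) p) = (\<Sum>j\<in>J. vec (item_vec M T P X (?its ! j)) p)"
    if "J \<subseteq> {..<length ?its}" for J p
    using that by (intro sum.cong) (auto simp: tab_vecs_def)
  have "subset_sum (map (\<lambda>l. numeral_of B (index_vec N l)) (tab_vecs M T P X)) (numeral_of B (index_vec N (tab_target M T P)))
    \<longleftrightarrow> (\<exists>J\<subseteq>{..<length (tab_vecs M T P X)}. \<forall>p\<in>set ?ps. (\<Sum>j\<in>J. vec (tab_vecs M T P X ! j) p) = target (cap M T) T p)"
    unfolding B_def tab_target_def by (rule subset_sum_vectors[OF positions_distinct box]) (use sub in blast)
  also have "\<dots> \<longleftrightarrow> (\<exists>u. length u \<le> P \<and> cell M (X @ u) T 1 0 = 2)"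
  proof
    assume "\<exists>J\<subseteq>{..<length (tab_vecs M T P X)}. \<forall>p\<in>set ?ps. (\<Sum>j\<in>J. vec (tab_vecs M T P X ! j) p) = target (cap M T) T p"
    then obtain J where J: "J \<subseteq> {..<length ?its}"
      "\<forall>p\<in>set ?ps. (\<Sum>j\<in>J. vec (tab_vecs M T P X ! j) p) = target (cap M T) T p" unfolding len by blast
    show "\<exists>u. length u \<le> P \<and> cell M (X @ u) T 1 0 = 2"
      by (rule tableau_sound[OF wf fit J(1)]) (use J(2) nth[OF J(1)] in simp)
  next
    assume "\<exists>u. length u \<le> P \<and> cell M (X @ u) T 1 0 = 2"
    then obtain u where u: "length u \<le> P" "cell M (X @ u) T 1 0 = 2" by blast
    from tableau_complete[OF wf fit u] obtain J where J: "J \<subseteq> {..<length ?its}"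
      "\<forall>p\<in>set ?ps. (\<Sum>m\<in>J. vec (item_vec M T P X (?its ! m)) p) = target (cap M T) T p" by blast
    show "\<exists>J\<subseteq>{..<length (tab_vecs M T P X)}. \<forall>p\<in>set ?ps. (\<Sum>j\<in>J. vec (tab_vecs M T P X ! j) p) = target (cap M T) T p"
      unfolding len by (rule exI[of _ J]) (use J nth[OF J(1)] in simp)
  qed
  finally show "subset_sum (map (\<lambda>l. numeral_of B (index_vec N l)) (tab_vecs M T P X)) (numeral_of B (index_vec N (tab_target M T P)))
    \<longleftrightarrow> (\<exists>u. length u \<le> P \<and> cell M (X @ u) T 1 0 = 2)" .
qed

text \<open>A halted machine no longer changes, so its output may be inspected at a common time
  \<open>T\<close>, and one cell decides: \<open>2\<close> is the symbol of
  \<open>True\<close>.\<close>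

lemma outputs_cell:
  assumes "outputs_within M y [y \<in> B] n" "n \<le> T"
  shows "cell M y T 1 0 = 2 \<longleftrightarrow> y \<in> B"
proof -
  let ?C = "(step M ^^ n) (start M y)"
  have h: "fst ?C = tm_states M" and o: "fst (snd ?C ! 1) (int 0) = contents [y \<in> B] (int 0)"
    using assms(1) unfolding outputs_within_def Let_def by auto
  have "conf M y T = (step M ^^ (T - n)) ?C"
    using assms(2) by (simp add: conf_def flip: funpow_add[unfolded o_def, THEN fun_cong])
  also have "\<dots> = ?C" by (rule step_halted[OF h])
  finally have "cell M y T 1 0 = contents [y \<in> B] 0" unfolding cell_def using o by simp
  then show ?thesis by (simp add: contents_def)
qed

lemma length_enc_bits: "length (enc_bits x) = 2 * length x + 1"
  by (induction x) (simp_all add: enc_bits_def enc_list_def)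

theorem NP_hard_Min_Max_Delay: "NP_hard Min_Max_Delay"
  unfolding NP_hard_def
proof (intro allI impI)
  fix A assume "in_NP A"
  then obtain B and p :: "nat poly" where B: "in_P B"
    and A: "\<And>x. x \<in> A \<longleftrightarrow> (\<exists>u. length u \<le> poly p (length x) \<and> pair_string x u \<in> B)"
    unfolding in_NP_def by blast
  obtain M and r :: "nat poly" where wf: "wf_tm M"
    and M: "\<And>y. outputs_within M y [y \<in> B] (poly r (length y))"
    using B unfolding in_P_def polytime_def by blast
  define P where "P x = poly p (length x)" for x :: "bool list"
  \<comment> \<open>\<open>L x\<close> bounds the length of \<open>pair_string x u\<close> for all
    admissible \<open>u\<close>; hence \<open>T x\<close> covers the running time on all of them
    and, by its first summand, leaves room for the input.\<close>
  define L where "L x = 2 * length x + 1 + P x" for x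
  define T where "T x = L x + poly r (L x)" for x
  define N where "N x = T x + width (T x) + tm_tapes M + P x + 10" for x
  define Bs where "Bs x = vectors_base (tab_vecs M (T x) (P x) (enc_bits x)) (tab_target M (T x) (P x))" for x
  define f where "f x = encode (mk_inst (subset_sum_inst
      (map (\<lambda>l. numeral_of (Bs x) (index_vec (N x) l)) (tab_vecs M (T x) (P x) (enc_bits x)))
      (numeral_of (Bs x) (index_vec (N x) (tab_target M (T x) (P x))))))" for x
  have fit: "length (enc_bits x) + P x \<le> T x" "0 < T x" for x
    by (simp_all add: length_enc_bits T_def L_def)
  have len: "ptime UNIV (\<lambda>x :: bool list. length x)" "pbound UNIV (\<lambda>x :: bool list. length x)"
    by (intro ptime_length ptime_id) (rule pbound_mono[OF pbound_self length_le_esize])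
  have Pp: "ptime UNIV P" "pbound UNIV P" unfolding P_def by (intro ptime_poly len) (intro pbound_poly len)
  have Lp: "ptime UNIV L" "pbound UNIV L" unfolding L_def
    by (intro ptime_add ptime_mult len Pp ptime_const) (intro pbound_add pbound_mult len Pp pbound_const)
  have Tp: "ptime UNIV T" "pbound UNIV T" unfolding T_def
    by (intro ptime_add ptime_poly Lp) (intro pbound_add pbound_poly Lp)
  have Np: "ptime UNIV N" "pbound UNIV N" unfolding N_def width_def
    by (intro ptime_add ptime_mult Tp Pp ptime_const) (intro pbound_add pbound_mult Tp Pp pbound_const)
  note tab = ptime_tab[OF Tp Pp ptime_enc_bits[OF ptime_id], of M]
  have Bp: "ptime UNIV Bs" unfolding Bs_def vectors_base_def
    by (intro ptime_Suc ptime_add ptime_sum_list ptime_map tab ptime_snd ptime_id)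
  note box = tab_subset_sum(2,3)[OF wf fit, folded N_def]
  have "ptime UNIV f" unfolding f_def
  proof (intro ptime_subset_sum_inst ptime_map tab)
    show "ptime {z. fst z \<in> UNIV \<and> snd z \<in> set (tab_vecs M (T (fst z)) (P (fst z)) (enc_bits (fst z)))}
      (\<lambda>z. numeral_of (Bs (fst z)) (index_vec (N (fst z)) (snd z)))"
    proof (rule ptime_numeral_of)
      let ?S = "{z. fst z \<in> UNIV \<and> snd z \<in> set (tab_vecs M (T (fst z)) (P (fst z)) (enc_bits (fst z)))}"
      show "ptime ?S (\<lambda>z. Bs (fst z))" by (rule ptime_compose_UNIV[OF Bp ptime_fst[OF ptime_id]])
      show "ptime ?S (\<lambda>z. N (fst z))" by (rule ptime_compose_UNIV[OF Np(1) ptime_fst[OF ptime_id]])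
      show "ptime ?S (\<lambda>z. snd z)" by (intro ptime_snd ptime_id)
      show "pbound ?S (\<lambda>z. N (fst z))" by (rule pbound_fst[OF Np(2)])
      show "fst ` set (snd z) \<subseteq> pos_box (N (fst z))" if "z \<in> ?S" for z using that box(1) by blast
    qed
    show "ptime UNIV (\<lambda>x. numeral_of (Bs x) (index_vec (N x) (tab_target M (T x) (P x))))"
      by (rule ptime_numeral_of[OF Bp tab(2) Np]) (rule box(2))
  qed
  moreover have "x \<in> A \<longleftrightarrow> f x \<in> Min_Max_Delay" for x
  proof -
    have c: "cell M (enc_bits x @ u) (T x) 1 0 = 2 \<longleftrightarrow> pair_string x u \<in> B" if "length u \<le> P x" for u
    proof -
      have "length (pair_string x u) \<le> L x" using that by (simp add: pair_string_def length_enc_bits L_def)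
      then have "poly r (length (pair_string x u)) \<le> T x"
        unfolding T_def using poly_nat_mono[of "length (pair_string x u)" "L x" r] by simp
      from outputs_cell[OF M this] show ?thesis by (simp only: pair_string_def)
    qed
    have "f x \<in> Min_Max_Delay \<longleftrightarrow> (\<exists>u. length u \<le> P x \<and> cell M (enc_bits x @ u) (T x) 1 0 = 2)"
      unfolding f_def subset_sum_inst_correct Bs_def N_def by (rule tab_subset_sum(1)[OF wf fit])
    also have "\<dots> \<longleftrightarrow> x \<in> A" unfolding A P_def[symmetric] using c by blast
    finally show ?thesis by blast
  qed
  ultimately show "poly_reducible A Min_Max_Delay"
    unfolding poly_reducible_def using polytime_if_ptime by blast
qed

section \<open>Small rational solutions of linear systems\<close>

text \<open>If the columns are dependent, moving from \<open>x\<close> along a kernel vector until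
  the first coordinate vanishes gives a nonnegative solution with smaller support.\<close>

lemma independent_support:
  fixes a :: "'j \<Rightarrow> nat \<Rightarrow> real" and x :: "'j \<Rightarrow> real"
  assumes "finite S" "\<forall>j\<in>S. 0 < x j" "\<forall>i<r. (\<Sum>j\<in>S. a j i * x j) = b i"
  shows "\<exists>S' x'. S' \<subseteq> S \<and> (\<forall>j\<in>S'. 0 < x' j) \<and> (\<forall>i<r. (\<Sum>j\<in>S'. a j i * x' j) = b i) \<and>
    (\<forall>c. (\<forall>i<r. (\<Sum>j\<in>S'. a j i * c j) = 0) \<longrightarrow> (\<forall>j\<in>S'. c j = 0))"
  using assms
proof (induction S arbitrary: x rule: finite_psubset_induct)
  case (psubset S)
  show ?case
  proof (cases "\<forall>c. (\<forall>i<r. (\<Sum>j\<in>S. a j i * c j) = 0) \<longrightarrow> (\<forall>j\<in>S. c j = 0)")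
    case True
    then show ?thesis using psubset.prems by blast
  next
    case False
    then obtain c0 j0 where c0: "\<forall>i<r. (\<Sum>j\<in>S. a j i * c0 j) = 0" "j0 \<in> S" "c0 j0 \<noteq> 0" by blast
    \<comment> \<open>The sign makes \<open>c\<close> positive at \<open>j0\<close>, so that the
      minimum of ratios below ranges over a nonempty set.\<close>
    define c where "c j = sgn (c0 j0) * c0 j" for j
    have c: "(\<Sum>j\<in>S. a j i * c j) = 0" if "i < r" for i
    proof -
      have "(\<Sum>j\<in>S. a j i * c j) = sgn (c0 j0) * (\<Sum>j\<in>S. a j i * c0 j)"
        unfolding sum_distrib_left by (rule sum.cong) (simp_all add: c_def)
      then show ?thesis using c0(1) that by simp
    qed
    define Q where "Q = {j \<in> S. 0 < c j}"
    have Q: "finite Q" "j0 \<in> Q" using psubset.hyps c0(2,3) by (auto simp: Q_def c_def sgn_if)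
    \<comment> \<open>The largest step along \<open>- c\<close> that keeps all coordinates
      nonnegative.\<close>
    define \<theta> where "\<theta> = Min ((\<lambda>j. x j / c j) ` Q)"
    have "\<theta> \<in> (\<lambda>j. x j / c j) ` Q" unfolding \<theta>_def using Q by (intro Min_in) auto
    then obtain j1 where j1: "j1 \<in> Q" "\<theta> = x j1 / c j1" by blast
    have \<theta>_le: "\<theta> \<le> x j / c j" if "j \<in> Q" for j unfolding \<theta>_def using Q that by (intro Min_le) auto
    have \<theta>: "0 < \<theta>" using j1 psubset.prems(1) by (auto simp: Q_def)
    define y where "y j = x j - \<theta> * c j" for j
    have y0: "0 \<le> y j" if "j \<in> S" for j
    proof (cases "0 < c j")
      case True
      then show ?thesis using \<theta>_le[of j] that by (simp add: Q_def y_def pos_le_divide_eq)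
    next
      case False
      then have "\<theta> * c j \<le> 0" using \<theta> by (intro mult_nonneg_nonpos) auto
      moreover have "0 < x j" using psubset.prems(1) that by blast
      ultimately show ?thesis unfolding y_def by linarith
    qed
    have y1: "y j1 = 0" using j1 by (auto simp: y_def Q_def)
    define S1 where "S1 = {j \<in> S. 0 < y j}"
    have "j1 \<in> S" "j1 \<notin> S1" "S1 \<subseteq> S" using j1(1) y1 by (auto simp: S1_def Q_def)
    then have S1: "S1 \<subset> S" by blast
    have "(\<Sum>j\<in>S1. a j i * y j) = b i" if i: "i < r" for i
    proof -
      have "(\<Sum>j\<in>S1. a j i * y j) = (\<Sum>j\<in>S. a j i * y j)"
      proof (rule sum.mono_neutral_left)
        show "\<forall>j\<in>S - S1. a j i * y j = 0"
        proof
          fix j assume "j \<in> S - S1"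
          then have "y j = 0" using y0[of j] by (auto simp: S1_def)
          then show "a j i * y j = 0" by simp
        qed
      qed (use psubset.hyps S1 in auto)
      also have "\<dots> = (\<Sum>j\<in>S. a j i * x j) - \<theta> * (\<Sum>j\<in>S. a j i * c j)"
        unfolding sum_distrib_left sum_subtractf[symmetric] by (rule sum.cong) (simp_all add: y_def algebra_simps)
      finally show ?thesis using psubset.prems(2) c[OF i] i by simp
    qed
    moreover have "\<forall>j\<in>S1. 0 < y j" by (simp add: S1_def)
    ultimately obtain S' x' where "S' \<subseteq> S1" and x': "\<forall>j\<in>S'. 0 < x' j" "\<forall>i<r. (\<Sum>j\<in>S'. a j i * x' j) = b i"
      "\<forall>c. (\<forall>i<r. (\<Sum>j\<in>S'. a j i * c j) = 0) \<longrightarrow> (\<forall>j\<in>S'. c j = 0)"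
      using psubset.IH[OF S1, of y] by blast
    have "S' \<subseteq> S" using \<open>S' \<subseteq> S1\<close> S1 by blast
    with x' show ?thesis by blast
  qed
qed

text \<open>Each of the \<open>fact k\<close> terms of the Leibniz expansion is at most
  \<open>r ^ k\<close> in absolute value. This crude bound suffices, since only the number of digits
  counts.\<close>

lemma abs_det_le:
  fixes G :: "int mat"
  assumes G: "G \<in> carrier_mat k k" and le: "\<And>l l'. l < k \<Longrightarrow> l' < k \<Longrightarrow> \<bar>G $$ (l, l')\<bar> \<le> int r"
  shows "\<bar>det G\<bar> \<le> int (fact k * r ^ k)"
proof -
  have "\<bar>det G\<bar> \<le> (\<Sum>p | p permutes {0..<k}. \<bar>signof p * (\<Prod>i = 0..<k. G $$ (i, p i))\<bar>)"
    unfolding det_def'[OF G] by (rule sum_abs)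
  also have "\<dots> \<le> (\<Sum>p | p permutes {0..<k}. int r ^ k)"
  proof (rule sum_mono)
    fix p assume "p \<in> {p. p permutes {0..<k}}"
    then have p: "p i < k" if "i < k" for i using permutes_in_image[of p "{0..<k}" i] that by simp
    have "\<bar>signof p * (\<Prod>i = 0..<k. G $$ (i, p i))\<bar> = (\<Prod>i = 0..<k. \<bar>G $$ (i, p i)\<bar>)"
      by (simp add: abs_mult abs_prod sign_def)
    also have "\<dots> \<le> (\<Prod>i = 0..<k. int r)" using le p by (intro prod_mono) auto
    finally show "\<bar>signof p * (\<Prod>i = 0..<k. G $$ (i, p i))\<bar> \<le> int r ^ k" by simp
  qed
  also have "\<dots> = int (fact k * r ^ k)" by (simp add: card_permutations)
  finally show ?thesis .
qed

text \<open>
  A solution with minimal support has independent columns, so Cramer's rule applies to the system of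
  normal equations, whose matrix is the Gram matrix of these columns.
\<close>

lemma small_solution:
  fixes a :: "'j \<Rightarrow> nat \<Rightarrow> nat" and b :: "nat \<Rightarrow> nat" and x :: "'j \<Rightarrow> real"
  assumes fin: "finite S" and a: "\<And>j i. a j i \<le> 1" and x: "\<forall>j\<in>S. 0 < x j"
    "\<forall>i<r. (\<Sum>j\<in>S. real (a j i) * x j) = real (b i)"
  shows "\<exists>S' (q :: nat) (y :: 'j \<Rightarrow> nat). S' \<subseteq> S \<and> card S' \<le> r \<and> 0 < q \<and> q \<le> r ^ r * r ^ r \<and>
    (\<forall>i<r. (\<Sum>j\<in>S'. a j i * y j) = q * b i)"
proof -
  obtain S' x' where S': "S' \<subseteq> S" and x': "\<forall>j\<in>S'. 0 < x' j" "\<forall>i<r. (\<Sum>j\<in>S'. real (a j i) * x' j) = real (b i)"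
    and indep: "\<forall>c. (\<forall>i<r. (\<Sum>j\<in>S'. real (a j i) * c j) = 0) \<longrightarrow> (\<forall>j\<in>S'. c j = 0)"
    using independent_support[where a = "\<lambda>j i. real (a j i)" and b = "\<lambda>i. real (b i)", OF fin x] by blast
  define k where "k = card S'"
  have fS: "finite S'" using S' fin finite_subset by blast
  obtain h where h: "bij_betw h {..<k} S'" using ex_bij_betw_nat_finite[OF fS] unfolding k_def atLeast0LessThan by blast
  have re: "(\<Sum>j\<in>S'. g j) = (\<Sum>l<k. g (h l))" for g :: "'j \<Rightarrow> real" by (rule sum.reindex_bij_betw[OF h, symmetric])
  have hS: "h l \<in> S'" if "l < k" for l using h that by (auto simp: bij_betw_def)
  define \<iota> where "\<iota> = inv_into {..<k} h"
  have \<iota>: "\<iota> (h l) = l" if "l < k" for l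
    unfolding \<iota>_def using h that by (intro inv_into_f_f) (auto simp: bij_betw_def)
  define A where "A l i = real (a (h l) i)" for l i
  have ind: "c l = 0" if 0: "\<And>i. i < r \<Longrightarrow> (\<Sum>l<k. A l i * c l) = 0" and l: "l < k" for c l
  proof -
    have "(\<Sum>j\<in>S'. real (a j i) * c (\<iota> j)) = 0" if "i < r" for i
    proof -
      have "(\<Sum>j\<in>S'. real (a j i) * c (\<iota> j)) = (\<Sum>l<k. A l i * c l)"
        unfolding re by (rule sum.cong) (simp_all add: \<iota> A_def)
      then show ?thesis using 0[OF that] by simp
    qed
    then have "\<forall>j\<in>S'. c (\<iota> j) = 0" using indep[rule_format, of "\<lambda>j. c (\<iota> j)"] by blast
    then show ?thesis using hS[OF l] \<iota>[OF l] by force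
  qed
  have kr: "k \<le> r"
  proof (rule ccontr)
    assume "\<not> k \<le> r"
    then have rk: "r < k" by simp
    \<comment> \<open>With more than \<open>r\<close> columns, padding by zero rows gives a singular
      square matrix, whose kernel contradicts independence.\<close>
    define Z where "Z = mat k k (\<lambda>(i, l). if i < r then A l i else 0)"
    have Z: "Z \<in> carrier_mat k k" by (simp add: Z_def)
    have "det Z = 0"
      unfolding det_def'[OF Z]
    proof (rule sum.neutral, rule ballI)
      fix p assume "p \<in> {p. p permutes {0..<k}}"
      then have "p r < k" using permutes_in_image[of p "{0..<k}" r] rk by simp
      then have "Z $$ (r, p r) = 0" using rk by (simp add: Z_def)
      then have "(\<Prod>i = 0..<k. Z $$ (i, p i)) = 0" using rk by (intro prod_zero) auto
      then show "signof p * (\<Prod>i = 0..<k. Z $$ (i, p i)) = 0" by simp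
    qed
    then obtain v where v: "v \<in> carrier_vec k" "v \<noteq> 0\<^sub>v k" "Z *\<^sub>v v = 0\<^sub>v k"
      using det_0_iff_vec_prod_zero_field[OF Z] by blast
    have "(\<Sum>l<k. A l i * v $ l) = 0" if "i < r" for i
    proof -
      have ik: "i < k" using that rk by simp
      have "(Z *\<^sub>v v) $ i = (\<Sum>l<k. A l i * v $ l)"
        using ik that v(1) by (simp add: Z_def scalar_prod_def atLeast0LessThan)
      then show ?thesis unfolding v(3) using ik by simp
    qed
    then have "v $ l = 0" if "l < k" for l using ind[of "\<lambda>l. v $ l" l] that by blast
    then have "v = 0\<^sub>v k" using v(1) by (intro eq_vecI) auto
    then show False using v(2) by blast
  qed
  define G :: "int mat" where "G = mat k k (\<lambda>(l, l'). \<Sum>i<r. int (a (h l) i) * int (a (h l') i))"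
  have G: "G \<in> carrier_mat k k" by (simp add: G_def)
  have Gr: "real_of_int (G $$ (l, l')) = (\<Sum>i<r. A l i * A l' i)" if "l < k" "l' < k" for l l'
    using that by (simp add: G_def A_def)
  \<comment> \<open>The quadratic form of \<open>G\<close> at \<open>v\<close> is the sum of the
    squares of the rows applied to \<open>v\<close>. It is zero for a kernel vector of
    \<open>G\<close>, which is then a dependence between the columns.\<close>
  have gram: "v l = 0" if 0: "\<And>l. l < k \<Longrightarrow> (\<Sum>l'<k. real_of_int (G $$ (l, l')) * v l') = 0" and l: "l < k" for v l
  proof -
    have "(\<Sum>i<r. (\<Sum>l<k. A l i * v l)\<^sup>2) = (\<Sum>i<r. \<Sum>l<k. \<Sum>l'<k. A l i * v l * (A l' i * v l'))"
      by (simp add: power2_eq_square sum_product)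
    also have "\<dots> = (\<Sum>l<k. \<Sum>i<r. \<Sum>l'<k. A l i * v l * (A l' i * v l'))" by (rule sum.swap)
    also have "\<dots> = (\<Sum>l<k. \<Sum>l'<k. \<Sum>i<r. A l i * v l * (A l' i * v l'))" by (intro sum.cong refl sum.swap)
    also have "\<dots> = (\<Sum>l<k. v l * (\<Sum>l'<k. (\<Sum>i<r. A l i * A l' i) * v l'))"
      unfolding sum_distrib_left sum_distrib_right by (intro sum.cong refl) (simp only: mult_ac)
    also have "\<dots> = (\<Sum>l<k. v l * (\<Sum>l'<k. real_of_int (G $$ (l, l')) * v l'))"
      by (intro sum.cong refl arg_cong2[where f = times]) (simp_all add: Gr)
    also have "\<dots> = 0" using 0 by (intro sum.neutral) simp
    finally have "\<forall>i\<in>{..<r}. (\<Sum>l<k. A l i * v l)\<^sup>2 = 0" by (subst (asm) sum_nonneg_eq_0_iff) auto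
    then have "(\<Sum>l<k. A l i * v l) = 0" if "i < r" for i using that by simp
    then show ?thesis using ind[of v l] l by blast
  qed
  have det: "det G \<noteq> 0"
  proof
    assume "det G = 0"
    then have "det (map_mat real_of_int G) = 0" by simp
    moreover have Gc: "map_mat real_of_int G \<in> carrier_mat k k" using G by simp
    ultimately obtain v where v: "v \<in> carrier_vec k" "v \<noteq> 0\<^sub>v k" "map_mat real_of_int G *\<^sub>v v = 0\<^sub>v k"
      using det_0_iff_vec_prod_zero_field[OF Gc] by blast
    have "(\<Sum>l'<k. real_of_int (G $$ (l, l')) * v $ l') = 0" if l: "l < k" for l
    proof -
      have "(map_mat real_of_int G *\<^sub>v v) $ l = (\<Sum>l'<k. real_of_int (G $$ (l, l')) * v $ l')"
        using l v(1) G by (simp add: scalar_prod_def atLeast0LessThan)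
      then show ?thesis unfolding v(3) using l by simp
    qed
    then have "v $ l = 0" if "l < k" for l using gram[of "\<lambda>l. v $ l" l] that by blast
    then have "v = 0\<^sub>v k" using v(1) by (intro eq_vecI) auto
    then show False using v(2) by blast
  qed
  define w where "w l = (\<Sum>i<r. int (a (h l) i) * int (b i))" for l
  \<comment> \<open>The adjugate gives an integral vector with \<open>G Y = det G w\<close>. As
    \<open>X\<close> satisfies the normal equations \<open>G X = w\<close>, regularity of
    \<open>G\<close> yields \<open>Y = det G X\<close>.\<close>
  define Y where "Y l = (\<Sum>m<k. adj_mat G $$ (l, m) * w m)" for l
  have ga: "(\<Sum>l'<k. G $$ (l, l') * adj_mat G $$ (l', m)) = (if l = m then det G else 0)" if "l < k" "m < k" for l m
  proof -
    have "(G * adj_mat G) $$ (l, m) = (\<Sum>l'<k. G $$ (l, l') * adj_mat G $$ (l', m))"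
      using that G adj_mat(1)[OF G] by (simp add: scalar_prod_def atLeast0LessThan)
    then show ?thesis unfolding adj_mat(2)[OF G] using that by auto
  qed
  have GY: "(\<Sum>l'<k. G $$ (l, l') * Y l') = det G * w l" if l: "l < k" for l
  proof -
    have "(\<Sum>l'<k. G $$ (l, l') * Y l') = (\<Sum>l'<k. \<Sum>m<k. G $$ (l, l') * adj_mat G $$ (l', m) * w m)"
      unfolding Y_def sum_distrib_left by (simp only: mult.assoc)
    also have "\<dots> = (\<Sum>m<k. \<Sum>l'<k. G $$ (l, l') * adj_mat G $$ (l', m) * w m)" by (rule sum.swap)
    also have "\<dots> = (\<Sum>m<k. (if l = m then det G else 0) * w m)"
      unfolding sum_distrib_right[symmetric] by (rule sum.cong) (simp_all add: ga[OF l])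
    also have "\<dots> = (\<Sum>m<k. if m = l then det G * w m else 0)" by (rule sum.cong) auto
    finally show ?thesis using l by simp
  qed
  define X where "X l = x' (h l)" for l
  have X: "0 < X l" if "l < k" for l using x'(1) hS[OF that] by (simp add: X_def)
  have AX: "(\<Sum>l<k. A l i * X l) = real (b i)" if "i < r" for i
    using x'(2) that unfolding re by (simp add: A_def X_def)
  have GX: "(\<Sum>l'<k. real_of_int (G $$ (l, l')) * X l') = real_of_int (w l)" if l: "l < k" for l
  proof -
    have "(\<Sum>l'<k. real_of_int (G $$ (l, l')) * X l') = (\<Sum>l'<k. \<Sum>i<r. A l i * (A l' i * X l'))"
      by (rule sum.cong) (simp_all add: Gr[OF l] sum_distrib_right mult.assoc)
    also have "\<dots> = (\<Sum>i<r. A l i * (\<Sum>l'<k. A l' i * X l'))" unfolding sum_distrib_left by (rule sum.swap)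
    also have "\<dots> = (\<Sum>i<r. A l i * real (b i))" by (rule sum.cong) (simp_all add: AX)
    also have "\<dots> = real_of_int (w l)" by (simp add: w_def A_def)
    finally show ?thesis .
  qed
  have YX: "real_of_int (Y l) = real_of_int (det G) * X l" if "l < k" for l
  proof -
    have "(\<Sum>l'<k. real_of_int (G $$ (l, l')) * (real_of_int (Y l') - real_of_int (det G) * X l')) = 0" if l: "l < k" for l
    proof -
      have "(\<Sum>l'<k. real_of_int (G $$ (l, l')) * (real_of_int (Y l') - real_of_int (det G) * X l')) =
          real_of_int (\<Sum>l'<k. G $$ (l, l') * Y l') - real_of_int (det G) * (\<Sum>l'<k. real_of_int (G $$ (l, l')) * X l')"
        unfolding sum_distrib_left of_int_sum sum_subtractf[symmetric]
        by (rule sum.cong) (simp_all add: algebra_simps)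
      then show ?thesis unfolding GY[OF l] GX[OF l] by simp
    qed
    from gram[OF this \<open>l < k\<close>] show ?thesis by simp
  qed
  \<comment> \<open>Every \<open>X l\<close> is positive, so \<open>Y l\<close> has the sign of
    \<open>det G\<close>, and passing to absolute values preserves the ratio.\<close>
  define q where "q = nat \<bar>det G\<bar>"
  define y where "y j = nat \<bar>Y (\<iota> j)\<bar>" for j
  have yX: "real (y (h l)) = real q * X l" if "l < k" for l
  proof -
    have "\<bar>real_of_int (Y l)\<bar> = \<bar>real_of_int (det G)\<bar> * X l" using YX[OF that] X[OF that] by (simp add: abs_mult)
    then show ?thesis using \<iota>[OF that] by (simp add: y_def q_def)
  qed
  have "(\<Sum>j\<in>S'. a j i * y j) = q * b i" if i: "i < r" for i
  proof -
    have "real (\<Sum>j\<in>S'. a j i * y j) = (\<Sum>l<k. A l i * real (y (h l)))"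
      unfolding of_nat_sum re by (simp add: A_def)
    also have "\<dots> = real q * (\<Sum>l<k. A l i * X l)"
      unfolding sum_distrib_left by (rule sum.cong) (simp_all add: yX)
    also have "\<dots> = real (q * b i)" using AX[OF i] by simp
    finally show ?thesis by (simp only: of_nat_eq_iff)
  qed
  moreover have "0 < q" using det by (simp add: q_def)
  moreover have "q \<le> r ^ r * r ^ r"
  proof -
    have "\<bar>G $$ (l, l')\<bar> \<le> int r" if "l < k" "l' < k" for l l'
    proof -
      have "int (a (h l) i) * int (a (h l') i) \<le> 1" for i
        using mult_le_mono[OF a[of "h l" i] a[of "h l'" i]] by (simp flip: of_nat_mult)
      then have "(\<Sum>i<r. int (a (h l) i) * int (a (h l') i)) \<le> (\<Sum>i<r. 1)" by (intro sum_mono)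
      moreover have "0 \<le> (\<Sum>i<r. int (a (h l) i) * int (a (h l') i))" by (intro sum_nonneg) simp
      ultimately show ?thesis using that by (simp add: G_def)
    qed
    from abs_det_le[OF G this] have "q \<le> fact k * r ^ k" unfolding q_def by linarith
    also have "\<dots> \<le> r ^ r * r ^ r"
    proof (cases "r = 0")
      case False
      have "(fact k :: nat) \<le> k ^ k" using fact_le_power[of k, where 'a = nat] by simp
      also have "\<dots> \<le> r ^ k" using kr by (intro power_mono) auto
      finally have "(fact k :: nat) \<le> r ^ k" .
      moreover have "r ^ k \<le> r ^ r" using kr False by (intro power_increasing) auto
      ultimately show ?thesis by (intro mult_le_mono) auto
    qed (use kr in simp)
    finally show ?thesis .
  qed
  ultimately show ?thesis using S' kr unfolding k_def by blast
qed

section \<open>Membership in NP\<close>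

text \<open>The certificate repeats the instance. The verifier encodes it again and compares the
  result with the input, so \<open>encode\<close> is never inverted.\<close>

type_synonym cert = "inst_tuple \<times> nat \<times> ((nat \<times> nat) list \<times> nat) list"

definition dec_pair :: "val \<Rightarrow> nat \<times> nat" where
  "dec_pair v = (vnat (vcar v), vnat (vcdr v))"

definition dec_edge :: "val \<Rightarrow> (nat \<times> nat) \<times> nat \<times> nat" where
  "dec_edge v = (dec_pair (vcar v), dec_pair (vcdr v))"

definition dec_inst :: "val \<Rightarrow> inst_tuple" where
  "dec_inst v = (map vnat (vlist (vcar v)), map dec_edge (vlist (vcar (vcdr v))),
     vnat (vcar (vcdr (vcdr v))), vnat (vcar (vcdr (vcdr (vcdr v)))),
     dec_pair (vcdr (vcdr (vcdr (vcdr v)))))"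

definition dec_flow :: "val \<Rightarrow> (nat \<times> nat) list \<times> nat" where
  "dec_flow v = (map dec_pair (vlist (vcar v)), vnat (vcdr v))"

definition dec_cert :: "val \<Rightarrow> cert" where
  "dec_cert v = (dec_inst (vcar v), vnat (vcar (vcdr v)), map dec_flow (vlist (vcdr (vcdr v))))"

lemma dec_pair_repr: "dec_pair (repr p) = p"
  by (cases p) (simp add: dec_pair_def)

lemma dec_pair_Nd: "dec_pair (Nd (repr a) (repr b)) = (a, b)" for a b :: nat
  by (simp add: dec_pair_def)

lemma dec_edge_repr: "dec_edge (repr e) = e"
  by (cases e) (simp add: dec_edge_def dec_pair_repr dec_pair_Nd)

lemma dec_flow_repr: "dec_flow (repr z) = z"
  by (cases z) (simp add: dec_flow_def dec_pair_repr comp_def)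

lemma dec_cert_repr: "dec_cert (repr c) = c"
proof -
  obtain I q fl where c: "c = (I, q, fl)" by (cases c)
  obtain vs es s t R D where I: "I = (vs, es, s, t, R, D)" by (cases I)
  show ?thesis unfolding c I
    by (simp add: dec_cert_def dec_inst_def dec_edge_repr dec_flow_repr dec_pair_Nd comp_def)
qed

lemma ptime_dec_pair: "ptime A f \<Longrightarrow> ptime A (\<lambda>x. dec_pair (f x))"
  unfolding dec_pair_def by (intro ptime_Pair ptime_vnat ptime_vfst ptime_vsnd)

lemma ptime_dec_cert: "ptime A f \<Longrightarrow> ptime A (\<lambda>x. dec_cert (f x))"
  unfolding dec_cert_def dec_inst_def dec_edge_def dec_flow_def
  by (intro ptime_Pair ptime_map ptime_dec_pair ptime_vnat ptime_vlist ptime_vfst ptime_vsnd ptime_snd ptime_id)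

lemma ptime_mem_nat: "ptime A f \<Longrightarrow> ptime A l \<Longrightarrow> ptime A (\<lambda>x. (f x :: nat) \<in> set (l x))"
  by (rule ptime_mem) (auto intro!: ptime_eq_nat ptime_snd ptime_id ptime_compose[OF ptime_fst[OF ptime_id], where B = A])

lemma ptime_eq_arc: "ptime A f \<Longrightarrow> ptime A g \<Longrightarrow> ptime A (\<lambda>x. (f x :: nat \<times> nat) = g x)"
  by (intro ptime_eq_prod ptime_eq_nat ptime_fst ptime_snd)

lemma ptime_mem_arc: "ptime A f \<Longrightarrow> ptime A l \<Longrightarrow> ptime A (\<lambda>x. (f x :: nat \<times> nat) \<in> set (l x))"
  by (rule ptime_mem) (auto intro!: ptime_eq_arc ptime_snd ptime_id ptime_compose[OF ptime_fst[OF ptime_id], where B = A])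

definition wf_check :: "inst_tuple \<Rightarrow> bool" where
  "wf_check I \<longleftrightarrow> (\<forall>z\<in>set (fst (snd I)). fst (fst z) \<in> set (fst I) \<and> snd (fst z) \<in> set (fst I)) \<and>
     distinct (fst I) \<and> distinct (map fst (fst (snd I))) \<and> fst (snd (snd I)) \<in> set (fst I) \<and>
     fst (snd (snd (snd I))) \<in> set (fst I) \<and> fst (snd (snd (snd I))) \<noteq> fst (snd (snd I)) \<and>
     fst (snd (snd (snd (snd I)))) \<noteq> 0"

lemma wf_check_iff: "wf_check I \<longleftrightarrow> wf_instance (mk_inst I)"
proof -
  have "wf_digraph (inst_graph (mk_inst I)) \<longleftrightarrow> (\<forall>e. e \<in> fst ` set (fst (snd I)) \<longrightarrow> fst e \<in> set (fst I)) \<and>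
      (\<forall>e. e \<in> fst ` set (fst (snd I)) \<longrightarrow> snd e \<in> set (fst I))"
    by (simp add: wf_digraph_def inst_graph_def del: split_paired_All)
  also have "\<dots> \<longleftrightarrow> (\<forall>z\<in>set (fst (snd I)). fst (fst z) \<in> set (fst I) \<and> snd (fst z) \<in> set (fst I))" by blast
  finally have *: "wf_digraph (inst_graph (mk_inst I)) \<longleftrightarrow>
      (\<forall>z\<in>set (fst (snd I)). fst (fst z) \<in> set (fst I) \<and> snd (fst z) \<in> set (fst I))" .
  show ?thesis unfolding wf_check_def wf_instance_def * mk_inst_sel Diff_iff singleton_iff neq0_conv by blast
qed

text \<open>Both zipped lists should run through the vertices of the walk: one as tails followed by
  the sink, the other as the source followed by heads. Their agreement is consecutiveness.\<close>

definition path_check :: "inst_tuple \<Rightarrow> (nat \<times> nat) list \<Rightarrow> bool" where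
  "path_check I p \<longleftrightarrow>
     (\<forall>z\<in>set (zip (map fst p @ [fst (snd (snd (snd I)))]) (fst (snd (snd I)) # map snd p)). fst z = snd z) \<and>
     distinct (fst (snd (snd I)) # map snd p) \<and> (\<forall>e\<in>set p. e \<in> set (map fst (fst (snd I))))"

text \<open>Runs through the edge list instead of the path, so that no delay has to be looked up; as
  \<open>path_delay\<close> sums over the set of edges, both agree on paths of the graph.\<close>

definition delay_sum :: "((nat \<times> nat) \<times> nat \<times> nat) list \<Rightarrow> (nat \<times> nat) list \<Rightarrow> nat" where
  "delay_sum es p = sum_list (map (\<lambda>z. if fst z \<in> set p then snd (snd z) else 0) es)"

text \<open>Amounts are numerators over the common denominator \<open>q\<close>; rate and capacities
  are multiplied by \<open>q\<close>, so that all checks concern natural numbers.\<close>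

definition flow_check :: "inst_tuple \<Rightarrow> nat \<Rightarrow> ((nat \<times> nat) list \<times> nat) list \<Rightarrow> bool" where
  "flow_check I q fl \<longleftrightarrow>
     (\<forall>z\<in>set fl. path_check I (fst z) \<and> delay_sum (fst (snd I)) (fst z) \<le> snd (snd (snd (snd (snd I))))) \<and>
     sum_list (map snd fl) = fst (snd (snd (snd (snd I)))) * q \<and>
     (\<forall>e\<in>set (fst (snd I)). sum_list (map (\<lambda>z. if fst e \<in> set (fst z) then snd z else 0) fl) \<le> fst (snd e) * q)"

definition verify :: "bool list \<Rightarrow> cert \<Rightarrow> bool" where
  "verify x c \<longleftrightarrow> x = encode (mk_inst (fst c)) \<and> wf_check (fst c) \<and> fst (snd c) \<noteq> 0 \<and>
     flow_check (fst c) (fst (snd c)) (snd (snd c))"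

lemma ptime_wf_check: "ptime UNIV wf_check"
proof -
  have "ptime UNIV (\<lambda>I. wf_check I)" unfolding wf_check_def
    by (intro ptime_conj ptime_ball ptime_mem_nat ptime_distinct ptime_Not ptime_eq_nat ptime_eq_arc ptime_map ptime_fst
        ptime_snd ptime_id ptime_const)
  then show ?thesis .
qed

lemma ptime_path_check:
  assumes "ptime A f" "ptime A g" shows "ptime A (\<lambda>x. path_check (f x) (g x))"
proof -
  have "ptime UNIV (\<lambda>w. path_check (fst w) (snd w))" unfolding path_check_def
    by (intro ptime_conj ptime_ball ptime_zip ptime_mem_arc ptime_distinct ptime_eq_nat ptime_append ptime_Cons ptime_map
        ptime_fst ptime_snd ptime_id ptime_const)
  from ptime_compose_UNIV[OF this ptime_Pair[OF assms]] show ?thesis by simp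
qed

lemma ptime_delay_sum:
  assumes "ptime A f" "ptime A g" shows "ptime A (\<lambda>x. delay_sum (f x) (g x))"
proof -
  have "ptime UNIV (\<lambda>w. delay_sum (fst w) (snd w))" unfolding delay_sum_def
    by (intro ptime_sum_list ptime_map ptime_If ptime_mem_arc ptime_fst ptime_snd ptime_id ptime_const)
  from ptime_compose_UNIV[OF this ptime_Pair[OF assms]] show ?thesis by simp
qed

lemma ptime_flow_check:
  assumes "ptime A f" "ptime A g" "ptime A h" shows "ptime A (\<lambda>x. flow_check (f x) (g x) (h x))"
proof -
  have "ptime UNIV (\<lambda>w. flow_check (fst w) (fst (snd w)) (snd (snd w)))" unfolding flow_check_def
    by (intro ptime_conj ptime_ball ptime_path_check ptime_delay_sum ptime_le ptime_eq_nat ptime_mult ptime_sum_list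
        ptime_map ptime_If ptime_mem_arc ptime_fst ptime_snd ptime_id ptime_const)
  from ptime_compose_UNIV[OF this ptime_Pair[OF assms(1) ptime_Pair[OF assms(2,3)]]] show ?thesis by simp
qed

lemma ptime_verify:
  assumes "ptime A f" "ptime A g" shows "ptime A (\<lambda>x. verify (f x) (g x))"
  unfolding verify_def
  by (intro ptime_conj ptime_eq_bits assms ptime_encode ptime_compose_UNIV[OF ptime_wf_check] ptime_Not ptime_eq_0
      ptime_flow_check ptime_fst ptime_snd)

lemma sum_vec:
  "finite Q \<Longrightarrow> (\<Sum>p\<in>Q. vec fl p) = sum_list (map (\<lambda>z. if fst z \<in> Q then snd z else 0) fl)"
  by (induction fl) (auto simp: sum.distrib)

context
  fixes I :: inst_tuple
  assumes wf: "wf_instance (mk_inst I)"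
begin

private abbreviation "es \<equiv> fst (snd I)"
private abbreviation "s \<equiv> fst (snd (snd I))"
private abbreviation "t \<equiv> fst (snd (snd (snd I)))"
private abbreviation "R \<equiv> fst (snd (snd (snd (snd I))))"
private abbreviation "D \<equiv> snd (snd (snd (snd (snd I))))"
private abbreviation "GI \<equiv> inst_graph (mk_inst I)"
private abbreviation "ST \<equiv> st_paths GI s t"

private lemma G_sel: "verts GI = set (fst I)" "arcs GI = fst ` set es" "tail GI = fst" "head GI = snd"
  by (simp_all add: inst_graph_def)

private lemma es_distinct: "distinct (map fst es)" and s_vert: "s \<in> set (fst I)" and R_pos: "0 < R"
  using wf by (auto simp: wf_instance_def)

private lemma finite_ST: "finite ST"
proof -
  interpret wf_digraph GI using wf by (simp add: wf_instance_def)
  interpret fin_digraph GI by unfold_locales (simp_all add: G_sel)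
  show ?thesis unfolding st_paths_def by (rule apaths_finite)
qed

private lemma cas_iff:
  "(\<forall>z\<in>set (zip (map fst p @ [v]) (u # map snd p)). fst z = snd z) \<longleftrightarrow> pre_digraph.cas GI u p v"
  by (induction p arbitrary: u) (auto simp: pre_digraph.cas.simps G_sel)

private lemma awalk_verts: "pre_digraph.cas GI u p v \<Longrightarrow> pre_digraph.awalk_verts GI u p = u # map snd p"
  by (induction p arbitrary: u) (auto simp: pre_digraph.cas.simps pre_digraph.awalk_verts.simps G_sel)

private lemma path_check_iff: "path_check I p \<longleftrightarrow> p \<in> ST"
proof -
  have st: "p \<in> ST \<longleftrightarrow> set p \<subseteq> arcs GI \<and> pre_digraph.cas GI s p t \<and> distinct (pre_digraph.awalk_verts GI s p)"
    unfolding st_paths_def mem_Collect_eq pre_digraph.apath_def pre_digraph.awalk_def using s_vert by (auto simp: G_sel)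
  show ?thesis
  proof (cases "pre_digraph.cas GI s p t")
    case True
    show ?thesis unfolding st path_check_def cas_iff awalk_verts[OF True] G_sel set_map by blast
  next
    case False
    then show ?thesis unfolding st path_check_def cas_iff by blast
  qed
qed

private lemma inst_values:
  assumes "z \<in> set es"
  shows "inst_capacity (mk_inst I) (fst z) = fst (snd z)" "inst_delay (mk_inst I) (fst z) = snd (snd z)"
proof -
  have "map_of es (fst z) = Some (snd z)" using es_distinct assms by (intro map_of_is_SomeI) auto
  then show "inst_capacity (mk_inst I) (fst z) = fst (snd z)" "inst_delay (mk_inst I) (fst z) = snd (snd z)"
    by (simp_all add: inst_capacity_def inst_delay_def)
qed

private lemma delay_sum_eq:
  assumes "p \<in> ST" shows "delay_sum es p = path_delay (inst_delay (mk_inst I)) p"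
proof -
  have sub: "set p \<subseteq> fst ` set es"
    using assms by (auto simp: st_paths_def pre_digraph.apath_def pre_digraph.awalk_def G_sel)
  have inj: "inj_on fst (set es)" and d: "distinct es" using es_distinct by (auto simp: distinct_map)
  have "delay_sum es p = (\<Sum>z\<in>set es. if fst z \<in> set p then snd (snd z) else 0)"
    unfolding delay_sum_def by (rule sum_list_distinct_conv_sum_set[OF d])
  also have "\<dots> = (\<Sum>z\<in>set es. if fst z \<in> set p then inst_delay (mk_inst I) (fst z) else 0)"
    by (rule sum.cong) (simp_all add: inst_values)
  also have "\<dots> = (\<Sum>e\<in>fst ` set es. if e \<in> set p then inst_delay (mk_inst I) e else 0)"
    by (simp add: sum.reindex[OF inj])
  also have "\<dots> = (\<Sum>e\<in>fst ` set es \<inter> set p. inst_delay (mk_inst I) e)" by (simp add: sum.inter_restrict)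
  also have "fst ` set es \<inter> set p = set p" using sub by blast
  finally show ?thesis by (simp add: path_delay_def)
qed

lemma flow_check_sound:
  assumes q: "q \<noteq> 0" and fl: "flow_check I q fl"
  shows "mmd_yes (mk_inst I)"
proof -
  \<comment> \<open>A path may occur several times in \<open>fl\<close>; \<open>vec\<close> adds up
    its amounts.\<close>
  define f where "f p = real (vec fl p) / real q" for p
  have paths: "fst z \<in> ST" "path_delay (inst_delay (mk_inst I)) (fst z) \<le> D" if "z \<in> set fl" for z
  proof -
    show "fst z \<in> ST" using fl that path_check_iff unfolding flow_check_def by blast
    then show "path_delay (inst_delay (mk_inst I)) (fst z) \<le> D"
      using fl that unfolding flow_check_def delay_sum_eq[OF \<open>fst z \<in> ST\<close>, symmetric] by blast
  qed
  have sumf: "(\<Sum>p\<in>Q. f p) = real (sum_list (map (\<lambda>z. if fst z \<in> Q then snd z else 0) fl)) / real q" if "finite Q" for Q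
    unfolding f_def sum_divide_distrib[symmetric] of_nat_sum[symmetric] sum_vec[OF that] ..
  have total: "(\<Sum>p\<in>ST. f p) = real R"
  proof -
    have m: "map (\<lambda>z. if fst z \<in> ST then snd z else 0) fl = map snd fl" using paths(1) by simp
    have t: "sum_list (map snd fl) = R * q" using fl by (simp add: flow_check_def)
    show ?thesis unfolding sumf[OF finite_ST] m t using q by simp
  qed
  have edge: "edge_rate GI s t f e \<le> real (inst_capacity (mk_inst I) e)" if e: "e \<in> arcs GI" for e
  proof -
    obtain z where z: "z \<in> set es" "e = fst z" using e unfolding G_sel by blast
    have "finite {p \<in> ST. e \<in> set p}" using finite_ST by simp
    note s = sumf[OF this]
    have m: "map (\<lambda>z. if fst z \<in> {p \<in> ST. e \<in> set p} then snd z else 0) fl =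
        map (\<lambda>z. if e \<in> set (fst z) then snd z else 0) fl" using paths(1) by simp
    have "sum_list (map (\<lambda>z. if e \<in> set (fst z) then snd z else 0) fl) \<le> inst_capacity (mk_inst I) e * q"
      using fl z inst_values(1)[OF z(1)] unfolding flow_check_def by auto
    then have "real (sum_list (map (\<lambda>z. if e \<in> set (fst z) then snd z else 0) fl)) \<le> real (inst_capacity (mk_inst I) e) * real q"
      by (simp only: of_nat_mult[symmetric] of_nat_le_iff)
    then show ?thesis unfolding edge_rate_def s m using q by (simp add: pos_divide_le_eq)
  qed
  have feas: "feasible_flow GI (inst_capacity (mk_inst I)) s t R f"
    unfolding feasible_flow_def using total edge by (auto simp: f_def)
  have "{p \<in> ST. 0 < f p} \<noteq> {}"
  proof
    assume e: "{p \<in> ST. 0 < f p} = {}"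
    have "f p = 0" if "p \<in> ST" for p
    proof -
      have "0 \<le> f p" by (simp add: f_def)
      moreover have "\<not> 0 < f p" using e that by blast
      ultimately show ?thesis by linarith
    qed
    then have "(\<Sum>p\<in>ST. f p) = 0" by (rule sum.neutral[OF ballI])
    then show False using total R_pos by simp
  qed
  moreover have "path_delay (inst_delay (mk_inst I)) p \<le> D" if "0 < f p" for p
  proof -
    have nz: "vec fl p \<noteq> 0"
    proof
      assume "vec fl p = 0"
      then show False using that by (simp add: f_def)
    qed
    have "p \<in> fst ` set fl"
    proof (rule ccontr)
      assume "p \<notin> fst ` set fl"
      from vec_eq_0[OF this] nz show False by simp
    qed
    then show ?thesis using paths(2) by blast
  qed
  ultimately have "max_delay GI (inst_delay (mk_inst I)) s t f \<le> D"
    unfolding max_delay_def using finite_ST by (subst Max_le_iff) auto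
  with feas show ?thesis unfolding mmd_yes_def by auto
qed

lemma flow_check_complete:
  assumes yes: "mmd_yes (mk_inst I)"
  defines "r \<equiv> Suc (length es)"
  shows "\<exists>q fl. 0 < q \<and> q \<le> r ^ r * r ^ r \<and> length fl \<le> r \<and> flow_check I q fl \<and> (\<forall>z\<in>set fl. snd z \<le> R * q)"
proof -
  obtain f where feas: "feasible_flow GI (inst_capacity (mk_inst I)) s t R f"
    and md: "max_delay GI (inst_delay (mk_inst I)) s t f \<le> D"
    using yes unfolding mmd_yes_def by auto
  have f0: "0 \<le> f p" if "p \<in> ST" for p using feas that by (simp add: feasible_flow_def)
  have fR: "(\<Sum>p\<in>ST. f p) = real R" using feas by (simp add: feasible_flow_def)
  define Q where "Q = {p \<in> ST. 0 < f p}"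
  have Q: "finite Q" "Q \<subseteq> ST" using finite_ST by (auto simp: Q_def)
  have delay: "path_delay (inst_delay (mk_inst I)) p \<le> D" if "p \<in> Q" for p
  proof -
    have "path_delay (inst_delay (mk_inst I)) p \<le> Max (path_delay (inst_delay (mk_inst I)) ` Q)"
      using Q that by (intro Max_ge) auto
    then show ?thesis using md unfolding max_delay_def Q_def by simp
  qed
  define c where "c m = fst (snd (es ! m))" for m
  \<comment> \<open>The residual capacity turns the capacity inequality of an edge into an
    equation.\<close>
  define zs where "zs m = real (c m) - edge_rate GI s t f (fst (es ! m))" for m
  have zs: "0 \<le> zs m" if "m < length es" for m
  proof -
    have m: "es ! m \<in> set es" using that by simp
    then have "fst (es ! m) \<in> arcs GI" unfolding G_sel by blast
    then have "edge_rate GI s t f (fst (es ! m)) \<le> real (inst_capacity (mk_inst I) (fst (es ! m)))"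
      using feas unfolding feasible_flow_def by blast
    then show ?thesis unfolding inst_values(1)[OF m] zs_def c_def by simp
  qed
  \<comment> \<open>Only residual capacities that are positive enter the system, as
    \<open>small_solution\<close> asks for positive unknowns.\<close>
  define Z where "Z = {m. m < length es \<and> 0 < zs m}"
  \<comment> \<open>Columns are paths and residual capacities. Row \<open>0\<close> is the rate
    requirement, and row \<open>Suc m\<close> belongs to the edge at index \<open>m\<close>.\<close>
  define a :: "((nat \<times> nat) list + nat) \<Rightarrow> nat \<Rightarrow> nat" where
    "a j i = (case j of Inl p \<Rightarrow> if i = 0 \<or> fst (es ! (i - 1)) \<in> set p then 1 else 0
       | Inr m \<Rightarrow> if i = Suc m then 1 else 0)" for j i
  define b where "b i = (if i = 0 then R else c (i - 1))" for i
  define x where "x j = (case j of Inl p \<Rightarrow> f p | Inr m \<Rightarrow> zs m)" for j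
  have finZ: "finite Z" by (simp add: Z_def)
  have rows: "(\<Sum>j\<in>Q <+> Z. real (a j i) * x j) = real (b i)" if i: "i < r" for i
  proof (cases i)
    case 0
    have "(\<Sum>j\<in>Q <+> Z. real (a j i) * x j) = (\<Sum>p\<in>Q. f p)"
      unfolding sum.Plus[OF Q(1) finZ] by (simp add: a_def x_def 0)
    also have "\<dots> = (\<Sum>p\<in>ST. f p)"
    proof (rule sum.mono_neutral_left[OF finite_ST Q(2)])
      show "\<forall>p\<in>ST - Q. f p = 0" using f0 by (force simp: Q_def)
    qed
    finally show ?thesis using fR 0 by (simp add: b_def)
  next
    case (Suc m)
    then have m: "m < length es" using i by (simp add: r_def)
    let ?e = "fst (es ! m)"
    have "(\<Sum>p\<in>Q. real (a (Inl p) i) * x (Inl p)) = (\<Sum>p\<in>Q. if ?e \<in> set p then f p else 0)"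
      by (rule sum.cong) (simp_all add: a_def x_def Suc)
    also have "\<dots> = (\<Sum>p\<in>{p \<in> Q. ?e \<in> set p}. f p)" using Q(1) by (simp add: sum.inter_filter)
    also have "\<dots> = edge_rate GI s t f ?e" unfolding edge_rate_def
    proof (rule sum.mono_neutral_left)
      show "\<forall>p\<in>{p \<in> ST. ?e \<in> set p} - {p \<in> Q. ?e \<in> set p}. f p = 0" using f0 by (force simp: Q_def)
    qed (use finite_ST Q in auto)
    finally have 1: "(\<Sum>p\<in>Q. real (a (Inl p) i) * x (Inl p)) = edge_rate GI s t f ?e" .
    have "(\<Sum>m'\<in>Z. real (a (Inr m') i) * x (Inr m')) = (\<Sum>m'\<in>Z. if m' = m then zs m else 0)"
      by (rule sum.cong) (auto simp: a_def x_def Suc)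
    also have "\<dots> = zs m" using finZ zs[OF m] m by (auto simp: Z_def)
    finally show ?thesis unfolding sum.Plus[OF Q(1) finZ] comp_def 1 by (simp add: zs_def b_def Suc)
  qed
  have fin: "finite (Q <+> Z)" using Q(1) finZ by simp
  have "\<forall>j\<in>Q <+> Z. 0 < x j" by (auto simp: x_def Q_def Z_def)
  moreover have "a j i \<le> 1" for j i by (auto simp: a_def split: sum.splits)
  ultimately obtain S' q y where S': "S' \<subseteq> Q <+> Z" "card S' \<le> r" and q: "0 < q" "q \<le> r ^ r * r ^ r"
    and y: "\<forall>i<r. (\<Sum>j\<in>S'. a j i * y j) = q * b i"
    using small_solution[of "Q <+> Z" a x r b] fin rows by blast
  define Q' where "Q' = {p. Inl p \<in> S'}"
  define Z' where "Z' = {m. Inr m \<in> S'}"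
  have S'_eq: "S' = Q' <+> Z'"
  proof (rule Set.set_eqI)
    fix j show "j \<in> S' \<longleftrightarrow> j \<in> Q' <+> Z'" by (cases j) (auto simp: Q'_def Z'_def)
  qed
  have Q': "Q' \<subseteq> Q" "finite Q'" "finite Z'"
  proof -
    show "Q' \<subseteq> Q" using S'(1) by (auto simp: Q'_def)
    then show "finite Q'" using Q(1) finite_subset by blast
    have "Z' \<subseteq> Z" using S'(1) by (auto simp: Z'_def)
    then show "finite Z'" using finZ finite_subset by blast
  qed
  have rows': "(\<Sum>p\<in>Q'. a (Inl p) i * y (Inl p)) + (\<Sum>m\<in>Z'. a (Inr m) i * y (Inr m)) = q * b i" if "i < r" for i
    using y that unfolding S'_eq sum.Plus[OF Q'(2,3)] comp_def by blast
  obtain ps where ps: "set ps = Q'" "distinct ps" using finite_distinct_list[OF Q'(2)] by blast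
  define fl where "fl = map (\<lambda>p. (p, y (Inl p))) ps"
  have "card Q' \<le> card S'"
    unfolding S'_eq using Q'(2,3) by (simp add: card_Plus)
  then have len: "length fl \<le> r" using S'(2) ps distinct_card[of ps] by (simp add: fl_def)
  have tot: "(\<Sum>p\<in>Q'. y (Inl p)) = R * q"
    using rows'[of 0] by (simp add: a_def b_def r_def mult.commute)
  have "path_check I (fst z) \<and> delay_sum es (fst z) \<le> D" if "z \<in> set fl" for z
  proof -
    have "fst z \<in> Q" using that ps Q'(1) by (auto simp: fl_def)
    then have "fst z \<in> ST" "path_delay (inst_delay (mk_inst I)) (fst z) \<le> D" using Q(2) delay by auto
    then show ?thesis using path_check_iff delay_sum_eq by simp
  qed
  moreover have "sum_list (map snd fl) = R * q"
    using tot sum_list_distinct_conv_sum_set[OF ps(2), of "\<lambda>p. y (Inl p)"] ps(1) by (simp add: fl_def comp_def)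
  moreover have "sum_list (map (\<lambda>z. if fst e \<in> set (fst z) then snd z else 0) fl) \<le> fst (snd e) * q" if e: "e \<in> set es" for e
  proof -
    obtain m where m: "m < length es" "e = es ! m" using e by (metis in_set_conv_nth)
    have "map (\<lambda>z. if fst e \<in> set (fst z) then snd z else 0) fl = map (\<lambda>p. if fst e \<in> set p then y (Inl p) else 0) ps"
      unfolding fl_def map_map comp_def fst_conv snd_conv by (rule refl)
    then have "sum_list (map (\<lambda>z. if fst e \<in> set (fst z) then snd z else 0) fl) = (\<Sum>p\<in>Q'. if fst e \<in> set p then y (Inl p) else 0)"
      using sum_list_distinct_conv_sum_set[OF ps(2), of "\<lambda>p. if fst e \<in> set p then y (Inl p) else 0"] unfolding ps(1)
      by (simp only:)
    also have "\<dots> = (\<Sum>p\<in>Q'. a (Inl p) (Suc m) * y (Inl p))" by (rule sum.cong) (simp_all add: a_def m(2))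
    \<comment> \<open>Dropping the residual part of row \<open>Suc m\<close> leaves the capacity
      inequality.\<close>
    also have "\<dots> \<le> q * b (Suc m)" using rows'[of "Suc m"] m(1) by (simp add: r_def)
    finally show ?thesis by (simp add: b_def c_def m(2) mult.commute)
  qed
  ultimately have "flow_check I q fl" unfolding flow_check_def by blast
  moreover have "snd z \<le> R * q" if z: "z \<in> set fl" for z
  proof -
    obtain p where p: "p \<in> Q'" "snd z = y (Inl p)" using z ps(1) by (auto simp: fl_def)
    then show ?thesis using member_le_sum[OF p(1), of "\<lambda>p. y (Inl p)"] Q'(2) tot by simp
  qed
  ultimately show ?thesis using q len by blast
qed

text \<open>The heads along a checked path are distinct, so it repeats no edge and is no longer than
  the edge list. This bounds each path of a certificate.\<close>

lemma flow_check_path_size: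
  assumes "flow_check I q fl" "z \<in> set fl"
  shows "length (fst z) \<le> length es" "e \<in> set (fst z) \<Longrightarrow> esize e \<le> esize es"
proof -
  have p: "path_check I (fst z)" using assms by (simp add: flow_check_def)
  then have sub: "set (fst z) \<subseteq> fst ` set es" unfolding path_check_def by auto
  have "distinct (fst z)" using p by (auto simp: path_check_def distinct_map)
  then have "length (fst z) = card (set (fst z))" by (simp add: distinct_card)
  also have "\<dots> \<le> card (fst ` set es)" using sub by (intro card_mono) auto
  also have "\<dots> \<le> length es" using card_image_le[of "set es" fst] card_length[of es] by simp
  finally show "length (fst z) \<le> length es" .
  assume "e \<in> set (fst z)"
  then obtain z' where "z' \<in> set es" "e = fst z'" using sub by blast
  then show "esize e \<le> esize es" using esize_fst[of z'] esize_mem[of z' es] by simp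
qed

end

text \<open>With \<open>b\<close> binary digits the size is at most \<open>4 * b + 1\<close> and the
  code has length \<open>2 * b + 1\<close>, which gives the factor 3. The \<open>Suc\<close> pays
  for the tree node that joins the number to the rest of a tuple or list.\<close>

lemma esize_enc_nat: "Suc (esize (n :: nat)) \<le> 3 * length (enc_nat n)"
proof -
  have "length (enc_bits bs) = 2 * length bs + 1" for bs
    by (induction bs) (simp_all add: enc_bits_def enc_list_def)
  then show ?thesis using esize_bits(2)[of "nat_bits n"] by (simp add: enc_nat_def esize_nat)
qed

lemma esize_enc_list:
  assumes "\<And>x. Suc (esize x) \<le> 3 * length (c x)"
  shows "Suc (esize xs) \<le> 3 * length (enc_list c xs)"
proof (induction xs)
  case (Cons x xs)
  then show ?case using assms[of x] by (simp add: enc_list_def)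
qed (simp add: enc_list_def)

lemma esize_enc_edge: "Suc (esize e) \<le> 3 * length (enc_edge e)"
proof -
  obtain u v c d where e: "e = ((u, v), c, d)" by (metis prod.collapse)
  show ?thesis unfolding e
    using esize_enc_nat[of u] esize_enc_nat[of v] esize_enc_nat[of c] esize_enc_nat[of d] by simp
qed

lemma esize_inst: "esize I \<le> 3 * length (encode (mk_inst I))"
proof -
  obtain vs es s t R D where I: "I = (vs, es, s, t, R, D)" by (metis prod.collapse)
  show ?thesis unfolding I encode_def
    using esize_enc_list[OF esize_enc_nat, of vs] esize_enc_list[OF esize_enc_edge, of es]
      esize_enc_nat[of s] esize_enc_nat[of t] esize_enc_nat[of R] esize_enc_nat[of D] by simp
qed

lemma esize_list_le:
  assumes "\<And>x. x \<in> set xs \<Longrightarrow> esize x \<le> c" "length xs \<le> n"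
  shows "esize xs \<le> Suc (n * Suc c)"
proof -
  have "esize xs \<le> Suc (length xs * Suc c)" using assms(1)
  proof (induction xs)
    case (Cons x xs)
    have "esize x \<le> c" "esize xs \<le> Suc (length xs * Suc c)" using Cons by auto
    then show ?case by simp
  qed simp
  also have "\<dots> \<le> Suc (n * Suc c)" using assms(2) by (simp only: Suc_le_mono mult_le_mono1)
  finally show ?thesis .
qed

text \<open>Here \<open>n\<close> bounds the size of the instance. As
  \<open>r \<le> n < 2 ^ n\<close>, the denominator has at most \<open>2 * (n * n) + 1\<close>
  binary digits; an amount is at most the rate times \<open>q\<close> and has at most
  \<open>n\<close> more. A digit takes at most 4 symbols.\<close>

definition cert_bound :: "nat \<Rightarrow> nat" where
  "cert_bound n = Suc (n + Suc (Suc (4 * (2 * (n * n) + 1)) + Suc (n * Suc (Suc (Suc (n * Suc n) +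
     Suc (4 * (n + (2 * (n * n) + 1))))))))"

lemma cert_size:
  assumes wf: "wf_instance (mk_inst I)" and fl: "flow_check I q fl" and r: "r = Suc (length (fst (snd I)))"
    and q: "q \<le> r ^ r * r ^ r" and len: "length fl \<le> r" and n: "\<forall>z\<in>set fl. snd z \<le> fst (snd (snd (snd (snd I)))) * q"
    and I: "esize I \<le> n"
  shows "esize (I, q, fl) \<le> cert_bound n"
proof -
  let ?es = "fst (snd I)" and ?R = "fst (snd (snd (snd (snd I))))"
  have es: "esize ?es \<le> n" using esize_fst[of "snd I"] esize_snd[of I] I by linarith
  have R: "esize ?R \<le> n"
    using esize_snd[of I] esize_snd[of "snd I"] esize_snd[of "snd (snd I)"] esize_snd[of "snd (snd (snd I))"]
      esize_fst[of "snd (snd (snd (snd I)))"] I by linarith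
  have len_es: "length xs < esize xs" for xs :: "((nat \<times> nat) \<times> nat \<times> nat) list"
    by (induction xs) simp_all
  have rn: "r \<le> n" using len_es[of ?es] es r by simp
  have "r ^ r \<le> (2 ^ n) ^ n"
  proof -
    have "r ^ r \<le> n ^ r" using rn by (intro power_mono) auto
    also have "\<dots> \<le> n ^ n" using rn r by (intro power_increasing) auto
    also have "\<dots> \<le> (2 ^ n) ^ n" using less_exp[of n] by (intro power_mono) auto
    finally show ?thesis .
  qed
  then have "r ^ r * r ^ r \<le> (2 ^ n) ^ n * (2 ^ n) ^ n" by (intro mult_le_mono)
  also have "\<dots> = 2 ^ (2 * (n * n))" by (simp add: power_mult[symmetric] power_add[symmetric] mult_2)
  also have "\<dots> < 2 ^ (2 * (n * n) + 1)" by simp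
  finally have q2: "q < 2 ^ (2 * (n * n) + 1)" using q by linarith
  have "?R < 2 ^ n" using less_two_power_esize[of ?R] power_increasing[OF R, of "2::nat"] by linarith
  have fs: "esize z \<le> Suc (Suc (n * Suc n) + Suc (4 * (n + (2 * (n * n) + 1))))" if z: "z \<in> set fl" for z
  proof -
    have "esize (fst z) \<le> Suc (n * Suc n)"
    proof (rule esize_list_le)
      show "length (fst z) \<le> n" using flow_check_path_size(1)[OF wf fl z] len_es[of ?es] es by linarith
      show "esize e \<le> n" if "e \<in> set (fst z)" for e using flow_check_path_size(2)[OF wf fl z that] es by linarith
    qed
    moreover have "snd z < 2 ^ (n + (2 * (n * n) + 1))"
    proof -
      have "snd z \<le> ?R * q" using n z by blast
      also have "\<dots> \<le> 2 ^ n * q" using \<open>?R < 2 ^ n\<close> by (intro mult_le_mono1) simp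
      also have "\<dots> < 2 ^ n * 2 ^ (2 * (n * n) + 1)" using q2 by simp
      finally show ?thesis by (simp add: power_add)
    qed
    from esize_nat_le[OF this] have "esize (snd z) \<le> Suc (4 * (n + (2 * (n * n) + 1)))" by simp
    ultimately show ?thesis by (cases z) simp
  qed
  have "esize fl \<le> Suc (n * Suc (Suc (Suc (n * Suc n) + Suc (4 * (n + (2 * (n * n) + 1))))))"
    by (rule esize_list_le[OF fs]) (use len rn in auto)
  moreover have "esize q \<le> Suc (4 * (2 * (n * n) + 1))" using esize_nat_le[OF q2] by simp
  ultimately show ?thesis unfolding cert_bound_def esize_simps using I by linarith
qed

theorem in_NP_Min_Max_Delay: "in_NP Min_Max_Delay"
proof -
  define B where "B = {z. verify (fst (unpair z)) (dec_cert (bits_val (snd (unpair z))))}"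
  have "ptime UNIV (\<lambda>z. verify (fst (unpair z)) (dec_cert (bits_val (snd (unpair z)))))"
    by (intro ptime_verify ptime_dec_cert ptime_bits_val ptime_unpair ptime_fst ptime_snd ptime_id)
  then have B: "in_P B" by (intro in_P_if_ptime) (simp add: B_def)
  have "pbound UNIV (\<lambda>x :: bool list. cert_bound (3 * length x))"
    unfolding cert_bound_def
    by (intro pbound_Suc pbound_add pbound_mult pbound_const pbound_mono[OF pbound_self length_le_esize])
  then obtain p :: "nat poly" where p: "\<And>x :: bool list. cert_bound (3 * length x) \<le> poly p (length x)"
    using pbound_bits by blast
  have "x \<in> Min_Max_Delay \<longleftrightarrow> (\<exists>u. length u \<le> poly p (length x) \<and> pair_string x u \<in> B)" for x
  proof
    assume "x \<in> Min_Max_Delay"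
    then obtain J where J: "x = encode J" "wf_instance J" "mmd_yes J" unfolding Min_Max_Delay_def by blast
    obtain I where "J = mk_inst I" using mk_inst_surj by blast
    note I = J[unfolded this]
    obtain q fl where q: "0 < q" "q \<le> Suc (length (fst (snd I))) ^ Suc (length (fst (snd I))) * Suc (length (fst (snd I))) ^ Suc (length (fst (snd I)))"
      and fl: "length fl \<le> Suc (length (fst (snd I)))" "flow_check I q fl"
      "\<forall>z\<in>set fl. snd z \<le> fst (snd (snd (snd (snd I)))) * q"
      using flow_check_complete[OF I(2,3)] by blast
    define u where "u = val_bits (repr (I, q, fl))"
    have "esize I \<le> 3 * length x" unfolding I(1) by (rule esize_inst)
    from cert_size[OF I(2) fl(2) refl q(2) fl(1,3) this] have "length u \<le> poly p (length x)"
      unfolding u_def length_val_bits using p[of x] by linarith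
    moreover have "verify x (I, q, fl)" unfolding verify_def using I q fl wf_check_iff by simp
    then have "pair_string x u \<in> B" unfolding B_def u_def mem_Collect_eq unpair_pair_string fst_conv snd_conv bits_val_bits dec_cert_repr .
    ultimately show "\<exists>u. length u \<le> poly p (length x) \<and> pair_string x u \<in> B" by blast
  next
    assume "\<exists>u. length u \<le> poly p (length x) \<and> pair_string x u \<in> B"
    then obtain u where u: "pair_string x u \<in> B" by blast
    define c where "c = dec_cert (bits_val u)"
    have "verify x c" using u unfolding B_def c_def mem_Collect_eq unpair_pair_string fst_conv snd_conv .
    then have "x = encode (mk_inst (fst c))" "wf_instance (mk_inst (fst c))" "fst (snd c) \<noteq> 0"
      "flow_check (fst c) (fst (snd c)) (snd (snd c))"
      unfolding verify_def wf_check_iff by blast+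
    then show "x \<in> Min_Max_Delay" unfolding Min_Max_Delay_def using flow_check_sound by blast
  qed
  with B show ?thesis unfolding in_NP_def by blast
qed

theorem theorem1:
  shows "NP_complete Min_Max_Delay"
  unfolding NP_complete_def using in_NP_Min_Max_Delay NP_hard_Min_Max_Delay by blast

end
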